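(* Let $R$ be an associative ring with identity. Then $R$ is quasi-Frobenius if and only if $R$ is a strongly right ss-injective and right noetherian ring such that $S_r$ is essential in $R_R$.
   Context: Modules are unitary. $S_r=\mathrm{soc}(R_R)$ is the right socle of $R$. $R$ is quasi-Frobenius (QF) if it is right (or left) artinian and right (or left) self-injective. A submodule $K$ of a module $N$ is small if $K+L\neq N$ for every proper submodule $L$ of $N$. $R$ is strongly right ss-injective if for every right $R$-module $N$ and every semisimple small submodule $K$ of $N$, every $R$-homomorphism $K\to R_R$ extends to an $R$-homomorphism $N\to R_R$. *)

theory Defs
  imports "HOL-Algebra.Algebra"
begin

text \<open>
  The library locale \<^locale>\<open>module\<close> is restricted to commutative rings, so right modules over an
  arbitrary ring are introduced here. The record and the notion of \<^const>\<open>submodule\<close> are those of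
  the library: the value \<open>r \<odot>\<^bsub>M\<^esub> x\<close> is the right action, written \<open>x r\<close> on paper.
\<close>

locale right_module = R?: ring R + M?: abelian_group M
  for R :: "('a, 'r) ring_scheme" (structure) and M :: "('a, 'm, 'c) module_scheme" (structure) +
  assumes smult_closed:
      "\<lbrakk>r \<in> carrier R; x \<in> carrier M\<rbrakk> \<Longrightarrow> r \<odot>\<^bsub>M\<^esub> x \<in> carrier M"
    and smult_l_distr:
      "\<lbrakk>r \<in> carrier R; s \<in> carrier R; x \<in> carrier M\<rbrakk> \<Longrightarrow>
        (r \<oplus> s) \<odot>\<^bsub>M\<^esub> x = r \<odot>\<^bsub>M\<^esub> x \<oplus>\<^bsub>M\<^esub> s \<odot>\<^bsub>M\<^esub> x"
    and smult_r_distr: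
      "\<lbrakk>r \<in> carrier R; x \<in> carrier M; y \<in> carrier M\<rbrakk> \<Longrightarrow>
        r \<odot>\<^bsub>M\<^esub> (x \<oplus>\<^bsub>M\<^esub> y) = r \<odot>\<^bsub>M\<^esub> x \<oplus>\<^bsub>M\<^esub> r \<odot>\<^bsub>M\<^esub> y"
    and smult_assoc:
      "\<lbrakk>r \<in> carrier R; s \<in> carrier R; x \<in> carrier M\<rbrakk> \<Longrightarrow>
        (r \<otimes> s) \<odot>\<^bsub>M\<^esub> x = s \<odot>\<^bsub>M\<^esub> (r \<odot>\<^bsub>M\<^esub> x)"
    and smult_one:
      "x \<in> carrier M \<Longrightarrow> \<one> \<odot>\<^bsub>M\<^esub> x = x"

definition right_regular :: "('a, 'r) ring_scheme \<Rightarrow> ('a, 'a) module" where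
  "right_regular R = \<lparr>carrier = carrier R, monoid.mult = monoid.mult R, one = one R,
     ring.zero = ring.zero R, ring.add = ring.add R, smult = (\<lambda>r x. x \<otimes>\<^bsub>R\<^esub> r)\<rparr>"

text \<open>Left modules over \<open>R\<close> are right modules over the opposite ring.\<close>

definition opposite_ring :: "('a, 'r) ring_scheme \<Rightarrow> ('a, 'r) ring_scheme" where
  "opposite_ring R = R\<lparr>monoid.mult := (\<lambda>x y. y \<otimes>\<^bsub>R\<^esub> x)\<rparr>"

lemma ring_opposite_ring:
  assumes "ring R"
  shows "ring (opposite_ring R)"
proof -
  interpret ring R by (rule assms)
  show ?thesis
    by (rule ringI)
      (auto intro!: abelian_groupI monoidI bexI[of _ "\<ominus>\<^bsub>R\<^esub> _"]
        simp: opposite_ring_def l_distr r_distr m_assoc a_ac l_neg r_neg)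
qed

lemma right_module_right_regular:
  assumes "ring R"
  shows "right_module R (right_regular R)"
proof -
  interpret ring R by (rule assms)
  have "abelian_group (right_regular R)"
    by (rule abelian_groupI)
      (auto intro!: bexI[of _ "\<ominus>\<^bsub>R\<^esub> _"] simp: right_regular_def a_ac l_neg r_neg)
  then show ?thesis
    by (intro right_module.intro right_module_axioms.intro ring_axioms)
      (auto simp: right_regular_def l_distr r_distr m_assoc)
qed

definition rmod_hom ::
  "('a, 'r) ring_scheme \<Rightarrow> ('a, 'm, 'c) module_scheme \<Rightarrow> ('a, 'n, 'd) module_scheme
    \<Rightarrow> ('m \<Rightarrow> 'n) set" where
  "rmod_hom R M N = {f. f \<in> carrier M \<rightarrow> carrier N \<and>
     (\<forall>x \<in> carrier M. \<forall>y \<in> carrier M. f (x \<oplus>\<^bsub>M\<^esub> y) = f x \<oplus>\<^bsub>N\<^esub> f y) \<and>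
     (\<forall>r \<in> carrier R. \<forall>x \<in> carrier M. f (r \<odot>\<^bsub>M\<^esub> x) = r \<odot>\<^bsub>N\<^esub> f x)}"

definition homs_extend ::
  "('a, 'r) ring_scheme \<Rightarrow> ('a, 'n, 'd) module_scheme \<Rightarrow> 'n set \<Rightarrow> ('a, 'm, 'c) module_scheme
    \<Rightarrow> bool" where
  "homs_extend R N K M \<longleftrightarrow>
     (\<forall>f \<in> rmod_hom R (N\<lparr>carrier := K\<rparr>) M. \<exists>g \<in> rmod_hom R N M. \<forall>x \<in> K. g x = f x)"

definition simple_submodule ::
  "('a, 'r) ring_scheme \<Rightarrow> ('a, 'm, 'c) module_scheme \<Rightarrow> 'm set \<Rightarrow> bool" where
  "simple_submodule R M S \<longleftrightarrow> submodule S R M \<and> S \<noteq> {\<zero>\<^bsub>M\<^esub>} \<and>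
     (\<forall>L. submodule L R M \<and> L \<subseteq> S \<longrightarrow> L = {\<zero>\<^bsub>M\<^esub>} \<or> L = S)"

text \<open>The sum of a family of submodules is the additive subgroup generated by their union.\<close>

definition socle :: "('a, 'r) ring_scheme \<Rightarrow> ('a, 'm, 'c) module_scheme \<Rightarrow> 'm set" where
  "socle R M = generate (add_monoid M) (\<Union>{S. simple_submodule R M S})"

definition semisimple_module ::
  "('a, 'r) ring_scheme \<Rightarrow> ('a, 'm, 'c) module_scheme \<Rightarrow> bool" where
  "semisimple_module R M \<longleftrightarrow> right_module R M \<and> socle R M = carrier M"

definition small_submodule ::
  "('a, 'r) ring_scheme \<Rightarrow> ('a, 'm, 'c) module_scheme \<Rightarrow> 'm set \<Rightarrow> bool" where
  "small_submodule R M K \<longleftrightarrow> submodule K R M \<and>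
     (\<forall>L. submodule L R M \<and> L \<noteq> carrier M \<longrightarrow> K <+>\<^bsub>M\<^esub> L \<noteq> carrier M)"

definition essential_submodule ::
  "('a, 'r) ring_scheme \<Rightarrow> ('a, 'm, 'c) module_scheme \<Rightarrow> 'm set \<Rightarrow> bool" where
  "essential_submodule R M K \<longleftrightarrow> submodule K R M \<and>
     (\<forall>L. submodule L R M \<and> L \<noteq> {\<zero>\<^bsub>M\<^esub>} \<longrightarrow> K \<inter> L \<noteq> {\<zero>\<^bsub>M\<^esub>})"

definition noetherian_module ::
  "('a, 'r) ring_scheme \<Rightarrow> ('a, 'm, 'c) module_scheme \<Rightarrow> bool" where
  "noetherian_module R M \<longleftrightarrow>
     (\<forall>I :: nat \<Rightarrow> 'm set. (\<forall>n. submodule (I n) R M \<and> I n \<subseteq> I (Suc n)) \<longrightarrow>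
        (\<exists>n. \<forall>m \<ge> n. I m = I n))"

definition artinian_module ::
  "('a, 'r) ring_scheme \<Rightarrow> ('a, 'm, 'c) module_scheme \<Rightarrow> bool" where
  "artinian_module R M \<longleftrightarrow>
     (\<forall>I :: nat \<Rightarrow> 'm set. (\<forall>n. submodule (I n) R M \<and> I (Suc n) \<subseteq> I n) \<longrightarrow>
        (\<exists>n. \<forall>m \<ge> n. I m = I n))"

definition right_noetherian :: "('a, 'r) ring_scheme \<Rightarrow> bool" where
  "right_noetherian R \<longleftrightarrow> noetherian_module R (right_regular R)"

definition right_artinian :: "('a, 'r) ring_scheme \<Rightarrow> bool" where
  "right_artinian R \<longleftrightarrow> artinian_module R (right_regular R)"

definition left_artinian :: "('a, 'r) ring_scheme \<Rightarrow> bool" where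
  "left_artinian R \<longleftrightarrow> right_artinian (opposite_ring R)"

text \<open>
  HOL cannot quantify over all types inside a formula, so ``every module \<open>N\<close>'' is read as every
  module whose carrier is a subset of the type \<^typ>\<open>'n\<close> designated by the argument of type
  \<^typ>\<open>'n itself\<close>. The definitions have their usual meaning only when that type is large enough
  compared with \<open>R\<close>; see \<open>module_universe\<close> below.
\<close>

definition injective_module ::
  "'n itself \<Rightarrow> ('a, 'r) ring_scheme \<Rightarrow> ('a, 'm, 'c) module_scheme \<Rightarrow> bool" where
  "injective_module U R M \<longleftrightarrow> right_module R M \<and>
     (\<forall>(N :: ('a, 'n) module) K.
        right_module R N \<and> submodule K R N \<longrightarrow> homs_extend R N K M)"

definition right_self_injective :: "'n itself \<Rightarrow> ('a, 'r) ring_scheme \<Rightarrow> bool" where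
  "right_self_injective U R \<longleftrightarrow> injective_module U R (right_regular R)"

definition left_self_injective :: "'n itself \<Rightarrow> ('a, 'r) ring_scheme \<Rightarrow> bool" where
  "left_self_injective U R \<longleftrightarrow> right_self_injective U (opposite_ring R)"

definition strongly_right_ss_injective :: "'n itself \<Rightarrow> ('a, 'r) ring_scheme \<Rightarrow> bool" where
  "strongly_right_ss_injective U R \<longleftrightarrow>
     (\<forall>(N :: ('a, 'n) module) K.
        right_module R N \<and> semisimple_module R (N\<lparr>carrier := K\<rparr>) \<and> small_submodule R N K
        \<longrightarrow> homs_extend R N K (right_regular R))"

text \<open>The sides in the two disjunctions are chosen independently of each other.\<close>

definition quasi_frobenius :: "'n itself \<Rightarrow> ('a, 'r) ring_scheme \<Rightarrow> bool" where
  "quasi_frobenius U R \<longleftrightarrow> (right_artinian R \<or> left_artinian R) \<and>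
     (right_self_injective U R \<or> left_self_injective U R)"

text \<open>
  For a ring \<open>R\<close> with carrier in \<^typ>\<open>'a\<close>, the summand \<^typ>\<open>('a \<times> nat) set\<close> is large enough to decide
  both extension properties. It has room for a copy of \<open>R\<close>, hence for Baer's criterion. It
  also has room for a copy of the injective hull \<open>E\<close> of \<open>R\<close>, since \<open>E\<close> embeds into the group of
  additive maps from \<open>R\<close> to the divisible hull of \<open>(R, +)\<close>, which has at most
  \<open>max |R| \<aleph>\<^sub>0\<close> elements; and strong ss-injectivity only has to be tested on \<open>E\<close>: any
  \<open>f: K \<rightarrow> R\<close> with \<open>K\<close> semisimple and small in \<open>N\<close> extends to some \<open>h: N \<rightarrow> E\<close>, the image
  \<open>h K = f K\<close> is semisimple and small in \<open>E\<close>, and an extension \<open>E \<rightarrow> R\<close> of its inclusion into \<open>R\<close>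
  composed with \<open>h\<close> extends \<open>f\<close>. The second summand \<^typ>\<open>'u\<close> is arbitrary, so that a theorem
  polymorphic in \<^typ>\<open>'u\<close> speaks about modules over every type.
\<close>

type_synonym ('a, 'u) module_universe = "('a \<times> nat) set + 'u"

end

theory Submission
  imports Defs
begin

text \<open>
  Write \<open>r(a)\<close> and \<open>l(a)\<close> for the right and left annihilator and let \<open>Z\<close> be the right singular ideal of
  \<open>R\<close>, the set of all \<open>a\<close> for which \<open>r(a)\<close> is essential in \<open>R\<close> as a right module. Injectivity is used
  only in Baer's form (\<open>right_baer\<close>): every homomorphism from a right ideal to \<open>R\<close> is left multiplication
  by an element. Baer's criterion passes between this and injectivity in a given type of modules
  (\<open>right_baer_imp_injective\<close>, \<open>injective_imp_right_baer\<close>).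

  Baer's condition makes \<open>R/Z\<close> von Neumann regular (\<open>right_baer_regular\<close>), and a chain condition on either
  side turns \<open>R/Z\<close> into a semisimple ring. The same chain conditions make \<open>Z\<close> nilpotent. Over a ring that is
  semisimple modulo a nilpotent ideal, every nonzero cyclic module has a simple submodule and every nonzero
  right ideal has a maximal subideal; by peeling off simple factors one sees that right noetherian and right
  artinian are the same (\<open>noetherian_imp_artinian\<close>, \<open>artinian_imp_noetherian\<close>), and that the right socle
  is essential (\<open>essential_socle\<close>).

  Suppose that \<open>R\<close> is strongly right ss-injective and right noetherian with essential right socle. Given
  \<open>f: I \<rightarrow> R\<close>, divide \<open>R \<times> R\<close> by a submodule that contains the graph of \<open>f\<close> and is maximal subject to
  meeting \<open>0 \<times> R\<close> trivially. The result is an essential extension \<open>j: R \<rightarrow> N\<close>, and \<open>f\<close> extends to \<open>R\<close> if \<open>j\<close>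
  splits. The socle of \<open>N\<close> is a sum \<open>K + T\<close> with \<open>K\<close> small in \<open>N\<close> and \<open>T\<close> a direct summand of \<open>N\<close>; strong
  ss-injectivity handles \<open>K\<close>, the projection onto \<open>T\<close> handles \<open>T\<close>, and together they give \<open>\<phi>: N \<rightarrow> R\<close> with
  \<open>\<phi> (j s) = s\<close> on the socle of \<open>R\<close> (\<open>essential_extension_hom\<close>). So \<open>c = \<phi> (j 1)\<close> fixes the socle, which is
  essential, hence \<open>1 - c \<in> Z\<close>. As \<open>Z\<close> is nilpotent, \<open>d c = 1\<close> for some \<open>d\<close>, and \<open>d \<phi>\<close> splits \<open>j\<close>. Thus \<open>R\<close> is
  right self-injective, and right artinian by the preceding paragraph.

  Conversely, the definition of a quasi-Frobenius ring leaves both sides open, so it has to be shown that each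
  of the four combinations implies the right-hand conditions. Under Baer's condition every finitely generated
  left ideal \<open>L\<close> satisfies \<open>l(r(L)) = L\<close> (\<open>lann_rann_fg\<close>); this moves the artinian condition to the left
  side (\<open>right_baer_right_artinian\<close>). The decisive point is then \<open>r(l(A)) = A\<close> for every right ideal
  \<open>A\<close>. It holds because every simple right module embeds in \<open>R\<close>, which in turn rests on
  \<open>r(l(Z)) \<subseteq> Z\<close> (\<open>rann_lann_singular\<close>). With both double annihilator laws the lattices of left and right
  ideals are dual to each other, so all conditions pass from one side to the other
  (\<open>right_baer_left_artinian\<close>).
\<close>

section \<open>Submodules\<close>

lemma set_add_iff: "x \<in> A <+>\<^bsub>R\<^esub> B \<longleftrightarrow> (\<exists>a\<in>A. \<exists>b\<in>B. x = a \<oplus>\<^bsub>R\<^esub> b)"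
  by (simp add: set_add_def')

lemma set_addI: "a \<in> A \<Longrightarrow> b \<in> B \<Longrightarrow> a \<oplus>\<^bsub>R\<^esub> b \<in> A <+>\<^bsub>R\<^esub> B"
  by (auto simp: set_add_iff)

lemma set_add_mono: "A \<subseteq> A' \<Longrightarrow> A <+>\<^bsub>R\<^esub> B \<subseteq> A' <+>\<^bsub>R\<^esub> B"
  by (force simp: set_add_iff)

context right_module
begin

lemma smult_zero: "x \<in> carrier M \<Longrightarrow> \<zero> \<odot>\<^bsub>M\<^esub> x = \<zero>\<^bsub>M\<^esub>"
  using smult_l_distr[of "\<zero>" "\<zero>" x] smult_closed[of "\<zero>" x]
  by (simp add: M.add.l_cancel_one')

lemma smult_minus_one:
  assumes "x \<in> carrier M"
  shows "(\<ominus> \<one>) \<odot>\<^bsub>M\<^esub> x = \<ominus>\<^bsub>M\<^esub> x"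
proof (rule M.minus_equality[symmetric])
  show "(\<ominus> \<one>) \<odot>\<^bsub>M\<^esub> x \<oplus>\<^bsub>M\<^esub> x = \<zero>\<^bsub>M\<^esub>"
    using smult_l_distr[of "\<ominus> \<one>" "\<one>" x] assms by (simp add: smult_one R.l_neg smult_zero)
qed (use assms smult_closed in auto)

lemma submodule_iff:
  "submodule H R M \<longleftrightarrow> H \<subseteq> carrier M \<and> \<zero>\<^bsub>M\<^esub> \<in> H \<and> (\<forall>x\<in>H. \<forall>y\<in>H. x \<oplus>\<^bsub>M\<^esub> y \<in> H) \<and>
     (\<forall>x\<in>H. \<forall>r\<in>carrier R. r \<odot>\<^bsub>M\<^esub> x \<in> H)" (is "?L \<longleftrightarrow> ?R")
proof
  assume ?L
  then interpret s: submodule H R M .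
  show ?R using s.subset s.m_closed s.one_closed s.smult_closed by auto
next
  assume r: ?R
  have "inv\<^bsub>add_monoid M\<^esub> x \<in> H" if "x \<in> H" for x
  proof -
    have "(\<ominus> \<one>) \<odot>\<^bsub>M\<^esub> x \<in> H" using r that by simp
    moreover have "x \<in> carrier M" using r that by blast
    ultimately have "\<ominus>\<^bsub>M\<^esub> x \<in> H" using smult_minus_one[of x] by simp
    then show ?thesis unfolding a_inv_def .
  qed
  then show ?L using r
    by (auto intro!: submodule.intro subgroup.intro submodule_axioms.intro)
qed

lemma submoduleD:
  assumes "submodule H R M"
  shows "H \<subseteq> carrier M" "\<zero>\<^bsub>M\<^esub> \<in> H" "\<And>x y. x \<in> H \<Longrightarrow> y \<in> H \<Longrightarrow> x \<oplus>\<^bsub>M\<^esub> y \<in> H"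
    "\<And>x r. x \<in> H \<Longrightarrow> r \<in> carrier R \<Longrightarrow> r \<odot>\<^bsub>M\<^esub> x \<in> H" "\<And>x. x \<in> H \<Longrightarrow> x \<in> carrier M"
    "\<And>x. x \<in> H \<Longrightarrow> \<ominus>\<^bsub>M\<^esub> x \<in> H" "\<And>x y. x \<in> H \<Longrightarrow> y \<in> H \<Longrightarrow> x \<ominus>\<^bsub>M\<^esub> y \<in> H"
proof -
  have H: "H \<subseteq> carrier M" "\<zero>\<^bsub>M\<^esub> \<in> H" "\<And>x y. x \<in> H \<Longrightarrow> y \<in> H \<Longrightarrow> x \<oplus>\<^bsub>M\<^esub> y \<in> H"
    "\<And>x r. x \<in> H \<Longrightarrow> r \<in> carrier R \<Longrightarrow> r \<odot>\<^bsub>M\<^esub> x \<in> H"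
    using assms unfolding submodule_iff by blast+
  have neg: "\<ominus>\<^bsub>M\<^esub> x \<in> H" if x: "x \<in> H" for x
    using H(4)[OF x, of "\<ominus> \<one>"] smult_minus_one[of x] H(1) x by auto
  show "H \<subseteq> carrier M" "\<zero>\<^bsub>M\<^esub> \<in> H" "\<And>x y. x \<in> H \<Longrightarrow> y \<in> H \<Longrightarrow> x \<oplus>\<^bsub>M\<^esub> y \<in> H"
    "\<And>x r. x \<in> H \<Longrightarrow> r \<in> carrier R \<Longrightarrow> r \<odot>\<^bsub>M\<^esub> x \<in> H" "\<And>x. x \<in> H \<Longrightarrow> \<ominus>\<^bsub>M\<^esub> x \<in> H"
    by (fact H neg)+
  show "\<And>x. x \<in> H \<Longrightarrow> x \<in> carrier M" using H(1) by blast
  show "\<And>x y. x \<in> H \<Longrightarrow> y \<in> H \<Longrightarrow> x \<ominus>\<^bsub>M\<^esub> y \<in> H" using H(3) neg by (simp add: a_minus_def)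
qed

lemma submoduleI:
  assumes "H \<subseteq> carrier M" "\<zero>\<^bsub>M\<^esub> \<in> H" "\<And>x y. x \<in> H \<Longrightarrow> y \<in> H \<Longrightarrow> x \<oplus>\<^bsub>M\<^esub> y \<in> H"
    "\<And>x r. x \<in> H \<Longrightarrow> r \<in> carrier R \<Longrightarrow> r \<odot>\<^bsub>M\<^esub> x \<in> H"
  shows "submodule H R M"
  unfolding submodule_iff using assms by blast

lemma submodule_zero: "submodule {\<zero>\<^bsub>M\<^esub>} R M"
proof (rule submoduleI)
  show "r \<odot>\<^bsub>M\<^esub> x \<in> {\<zero>\<^bsub>M\<^esub>}" if "x \<in> {\<zero>\<^bsub>M\<^esub>}" "r \<in> carrier R" for x r
  proof -
    have "r \<odot>\<^bsub>M\<^esub> (\<zero>\<^bsub>M\<^esub> \<oplus>\<^bsub>M\<^esub> \<zero>\<^bsub>M\<^esub>) = r \<odot>\<^bsub>M\<^esub> \<zero>\<^bsub>M\<^esub> \<oplus>\<^bsub>M\<^esub> r \<odot>\<^bsub>M\<^esub> \<zero>\<^bsub>M\<^esub>"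
      using that by (intro smult_r_distr) auto
    then show ?thesis using that smult_closed[of r "\<zero>\<^bsub>M\<^esub>"] by simp
  qed
qed auto

lemma smult_minus:
  assumes "r \<in> carrier R" "x \<in> carrier M"
  shows "r \<odot>\<^bsub>M\<^esub> (\<ominus>\<^bsub>M\<^esub> x) = \<ominus>\<^bsub>M\<^esub> (r \<odot>\<^bsub>M\<^esub> x)"
proof (rule M.minus_equality[symmetric])
  show "r \<odot>\<^bsub>M\<^esub> (\<ominus>\<^bsub>M\<^esub> x) \<oplus>\<^bsub>M\<^esub> r \<odot>\<^bsub>M\<^esub> x = \<zero>\<^bsub>M\<^esub>"
    using assms submoduleD(4)[OF submodule_zero, of "\<zero>\<^bsub>M\<^esub>" r]
    by (simp add: smult_r_distr[symmetric] M.l_neg)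
qed (use assms smult_closed in auto)

lemma submodule_carrier: "submodule (carrier M) R M"
  by (rule submoduleI) (auto simp: smult_closed)

lemma submodule_Int: "submodule A R M \<Longrightarrow> submodule B R M \<Longrightarrow> submodule (A \<inter> B) R M"
  unfolding submodule_iff by blast

lemma submodule_sum:
  assumes A: "submodule A R M" and B: "submodule B R M"
  shows "submodule (A <+>\<^bsub>M\<^esub> B) R M"
proof (rule submoduleI)
  note a = submoduleD[OF A] and b = submoduleD[OF B]
  show "A <+>\<^bsub>M\<^esub> B \<subseteq> carrier M" using a(5) b(5) by (auto simp: set_add_iff)
  show "\<zero>\<^bsub>M\<^esub> \<in> A <+>\<^bsub>M\<^esub> B" using set_addI[OF a(2) b(2), of M] by simp
  show "x \<oplus>\<^bsub>M\<^esub> y \<in> A <+>\<^bsub>M\<^esub> B" if xy: "x \<in> A <+>\<^bsub>M\<^esub> B" "y \<in> A <+>\<^bsub>M\<^esub> B" for x y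
  proof -
    obtain u v u' v' where e: "u\<in>A" "v\<in>B" "u'\<in>A" "v'\<in>B" "x = u \<oplus>\<^bsub>M\<^esub> v" "y = u' \<oplus>\<^bsub>M\<^esub> v'"
      using xy by (auto simp: set_add_iff)
    then have "x \<oplus>\<^bsub>M\<^esub> y = (u \<oplus>\<^bsub>M\<^esub> u') \<oplus>\<^bsub>M\<^esub> (v \<oplus>\<^bsub>M\<^esub> v')" using a(5) b(5) by (simp add: M.a_ac)
    then show ?thesis using set_addI[OF a(3)[OF e(1,3)] b(3)[OF e(2,4)]] by simp
  qed
  show "r \<odot>\<^bsub>M\<^esub> x \<in> A <+>\<^bsub>M\<^esub> B" if xr: "x \<in> A <+>\<^bsub>M\<^esub> B" "r \<in> carrier R" for x r
  proof -
    obtain u v where e: "u\<in>A" "v\<in>B" "x = u \<oplus>\<^bsub>M\<^esub> v" using xr by (auto simp: set_add_iff)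
    then have "r \<odot>\<^bsub>M\<^esub> x = r \<odot>\<^bsub>M\<^esub> u \<oplus>\<^bsub>M\<^esub> r \<odot>\<^bsub>M\<^esub> v" using a(5) b(5) xr by (simp add: smult_r_distr)
    then show ?thesis using set_addI[OF a(4)[OF e(1) xr(2)] b(4)[OF e(2) xr(2)], of M] by simp
  qed
qed

lemma submodule_sum_upper:
  assumes A: "submodule A R M" and B: "submodule B R M"
  shows "A \<subseteq> A <+>\<^bsub>M\<^esub> B" "B \<subseteq> A <+>\<^bsub>M\<^esub> B"
proof -
  note a = submoduleD[OF A] and b = submoduleD[OF B]
  show "A \<subseteq> A <+>\<^bsub>M\<^esub> B" using set_addI[OF _ b(2), of _ A M] a(5) by fastforce
  show "B \<subseteq> A <+>\<^bsub>M\<^esub> B" using set_addI[OF a(2), of _ B M] b(5) by fastforce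
qed

lemma submodule_sum_least:
  "submodule C R M \<Longrightarrow> A \<subseteq> C \<Longrightarrow> B \<subseteq> C \<Longrightarrow> A <+>\<^bsub>M\<^esub> B \<subseteq> C"
  using submoduleD(3) by (fastforce simp: set_add_iff)

end

section \<open>One-sided ideals and annihilators\<close>

definition right_ideal :: "('a, 'r) ring_scheme \<Rightarrow> 'a set \<Rightarrow> bool" where
  "right_ideal R I \<longleftrightarrow> I \<subseteq> carrier R \<and> \<zero>\<^bsub>R\<^esub> \<in> I \<and> (\<forall>x\<in>I. \<forall>y\<in>I. x \<oplus>\<^bsub>R\<^esub> y \<in> I) \<and>
     (\<forall>x\<in>I. \<forall>r\<in>carrier R. x \<otimes>\<^bsub>R\<^esub> r \<in> I)"

definition left_ideal :: "('a, 'r) ring_scheme \<Rightarrow> 'a set \<Rightarrow> bool" where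
  "left_ideal R I \<longleftrightarrow> I \<subseteq> carrier R \<and> \<zero>\<^bsub>R\<^esub> \<in> I \<and> (\<forall>x\<in>I. \<forall>y\<in>I. x \<oplus>\<^bsub>R\<^esub> y \<in> I) \<and>
     (\<forall>x\<in>I. \<forall>r\<in>carrier R. r \<otimes>\<^bsub>R\<^esub> x \<in> I)"

definition two_sided :: "('a, 'r) ring_scheme \<Rightarrow> 'a set \<Rightarrow> bool" where
  "two_sided R I \<longleftrightarrow> right_ideal R I \<and> left_ideal R I"

definition rann :: "('a, 'r) ring_scheme \<Rightarrow> 'a set \<Rightarrow> 'a set" where
  "rann R A = {x \<in> carrier R. \<forall>a\<in>A. a \<otimes>\<^bsub>R\<^esub> x = \<zero>\<^bsub>R\<^esub>}"

definition lann :: "('a, 'r) ring_scheme \<Rightarrow> 'a set \<Rightarrow> 'a set" where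
  "lann R A = {x \<in> carrier R. \<forall>a\<in>A. x \<otimes>\<^bsub>R\<^esub> a = \<zero>\<^bsub>R\<^esub>}"

text \<open>
  The element \<open>c\<close> is the value at \<open>\<one>\<close> of an extension of \<open>f\<close> to the whole ring.
\<close>

definition right_baer :: "('a, 'r) ring_scheme \<Rightarrow> bool" where
  "right_baer R \<longleftrightarrow> (\<forall>I f. right_ideal R I \<and> f \<in> I \<rightarrow> carrier R \<and>
     (\<forall>x\<in>I. \<forall>y\<in>I. f (x \<oplus>\<^bsub>R\<^esub> y) = f x \<oplus>\<^bsub>R\<^esub> f y) \<and>
     (\<forall>x\<in>I. \<forall>r\<in>carrier R. f (x \<otimes>\<^bsub>R\<^esub> r) = f x \<otimes>\<^bsub>R\<^esub> r) \<longrightarrow>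
     (\<exists>c\<in>carrier R. \<forall>x\<in>I. f x = c \<otimes>\<^bsub>R\<^esub> x))"

text \<open>
  Every statement about left ideals is the statement about right ideals for the opposite ring.
\<close>

lemma opposite_simps [simp]:
  "carrier (opposite_ring R) = carrier R" "\<zero>\<^bsub>opposite_ring R\<^esub> = \<zero>\<^bsub>R\<^esub>"
  "\<one>\<^bsub>opposite_ring R\<^esub> = \<one>\<^bsub>R\<^esub>" "x \<oplus>\<^bsub>opposite_ring R\<^esub> y = x \<oplus>\<^bsub>R\<^esub> y"
  "x \<otimes>\<^bsub>opposite_ring R\<^esub> y = y \<otimes>\<^bsub>R\<^esub> x" "\<ominus>\<^bsub>opposite_ring R\<^esub> x = \<ominus>\<^bsub>R\<^esub> x"
  "x \<ominus>\<^bsub>opposite_ring R\<^esub> y = x \<ominus>\<^bsub>R\<^esub> y" "opposite_ring (opposite_ring R) = R"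
  by (simp_all add: opposite_ring_def a_inv_def a_minus_def)

lemma ideals_opposite [simp]:
  "right_ideal (opposite_ring R) I \<longleftrightarrow> left_ideal R I"
  "left_ideal (opposite_ring R) I \<longleftrightarrow> right_ideal R I"
  "two_sided (opposite_ring R) I \<longleftrightarrow> two_sided R I"
  "rann (opposite_ring R) A = lann R A" "lann (opposite_ring R) A = rann R A"
  by (auto simp: right_ideal_def left_ideal_def two_sided_def rann_def lann_def)

lemma right_idealI:
  assumes "I \<subseteq> carrier R" "\<zero>\<^bsub>R\<^esub> \<in> I" "\<And>x y. x \<in> I \<Longrightarrow> y \<in> I \<Longrightarrow> x \<oplus>\<^bsub>R\<^esub> y \<in> I"
    "\<And>x r. x \<in> I \<Longrightarrow> r \<in> carrier R \<Longrightarrow> x \<otimes>\<^bsub>R\<^esub> r \<in> I"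
  shows "right_ideal R I"
  using assms by (auto simp: right_ideal_def)

lemma left_idealI:
  assumes "I \<subseteq> carrier R" "\<zero>\<^bsub>R\<^esub> \<in> I" "\<And>x y. x \<in> I \<Longrightarrow> y \<in> I \<Longrightarrow> x \<oplus>\<^bsub>R\<^esub> y \<in> I"
    "\<And>x r. x \<in> I \<Longrightarrow> r \<in> carrier R \<Longrightarrow> r \<otimes>\<^bsub>R\<^esub> x \<in> I"
  shows "left_ideal R I"
  using assms by (auto simp: left_ideal_def)

lemma right_idealD:
  assumes "right_ideal R I"
  shows "I \<subseteq> carrier R" "\<zero>\<^bsub>R\<^esub> \<in> I" "\<And>x y. x \<in> I \<Longrightarrow> y \<in> I \<Longrightarrow> x \<oplus>\<^bsub>R\<^esub> y \<in> I"
    "\<And>x r. x \<in> I \<Longrightarrow> r \<in> carrier R \<Longrightarrow> x \<otimes>\<^bsub>R\<^esub> r \<in> I" "\<And>x. x \<in> I \<Longrightarrow> x \<in> carrier R"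
  using assms by (auto simp: right_ideal_def)

lemma left_idealD:
  assumes "left_ideal R I"
  shows "I \<subseteq> carrier R" "\<zero>\<^bsub>R\<^esub> \<in> I" "\<And>x y. x \<in> I \<Longrightarrow> y \<in> I \<Longrightarrow> x \<oplus>\<^bsub>R\<^esub> y \<in> I"
    "\<And>x r. x \<in> I \<Longrightarrow> r \<in> carrier R \<Longrightarrow> r \<otimes>\<^bsub>R\<^esub> x \<in> I" "\<And>x. x \<in> I \<Longrightarrow> x \<in> carrier R"
  using assms by (auto simp: left_ideal_def)

lemma set_add_opposite [simp]: "set_add (opposite_ring R) = set_add R"
  by (intro ext) (simp add: set_add_def')

lemma right_regular_simps [simp]:
  "carrier (right_regular R) = carrier R" "\<zero>\<^bsub>right_regular R\<^esub> = \<zero>\<^bsub>R\<^esub>"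
  "x \<oplus>\<^bsub>right_regular R\<^esub> y = x \<oplus>\<^bsub>R\<^esub> y" "r \<odot>\<^bsub>right_regular R\<^esub> x = x \<otimes>\<^bsub>R\<^esub> r"
  by (simp_all add: right_regular_def)

lemma set_add_right_regular [simp]: "set_add (right_regular R) = set_add R"
  by (intro ext) (simp add: set_add_def')

lemma submodule_right_regular:
  assumes "ring R"
  shows "submodule I R (right_regular R) \<longleftrightarrow> right_ideal R I"
  by (simp add: right_module.submodule_iff[OF right_module_right_regular[OF assms]] right_ideal_def)

context ring
begin

lemma opposite: "ring (opposite_ring R)"
  by (rule ring_opposite_ring[OF ring_axioms])

lemma right_ideal_minus:
  assumes "right_ideal R I" "x \<in> I"
  shows "\<ominus> x \<in> I"
proof -
  have "x \<otimes> \<ominus> \<one> \<in> I" "x \<in> carrier R" using assms by (auto simp: right_ideal_def)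
  then show ?thesis by (simp add: r_minus)
qed

lemma right_ideal_diff: "right_ideal R I \<Longrightarrow> x \<in> I \<Longrightarrow> y \<in> I \<Longrightarrow> x \<ominus> y \<in> I"
  using right_ideal_minus right_idealD(3) by (fastforce simp: a_minus_def)

lemma right_ideal_cancel:
  assumes I: "right_ideal R I" and "x \<ominus> y \<in> I" "y \<in> I" "x \<in> carrier R"
  shows "x \<in> I"
proof -
  have "x \<ominus> y \<oplus> y \<in> I" by (rule right_idealD(3)[OF I assms(2,3)])
  moreover have "y \<in> carrier R" by (rule right_idealD(5)[OF I assms(3)])
  then have "x \<ominus> y \<oplus> y = x" using assms(4)
    by (simp add: a_minus_def a_assoc l_neg)
  ultimately show ?thesis by simp
qed

lemma right_ideal_sum: "right_ideal R A \<Longrightarrow> right_ideal R B \<Longrightarrow> right_ideal R (A <+>\<^bsub>R\<^esub> B)"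
  using right_module.submodule_sum[OF right_module_right_regular[OF ring_axioms], of A B]
  by (simp add: submodule_right_regular[OF ring_axioms])

lemma right_ideal_sum_upper:
  "right_ideal R A \<Longrightarrow> right_ideal R B \<Longrightarrow> A \<subseteq> A <+>\<^bsub>R\<^esub> B"
  "right_ideal R A \<Longrightarrow> right_ideal R B \<Longrightarrow> B \<subseteq> A <+>\<^bsub>R\<^esub> B"
  using right_module.submodule_sum_upper[OF right_module_right_regular[OF ring_axioms], of A B]
  by (simp_all add: submodule_right_regular[OF ring_axioms])

lemma right_ideal_sum_least:
  "right_ideal R C \<Longrightarrow> A \<subseteq> C \<Longrightarrow> B \<subseteq> C \<Longrightarrow> A <+>\<^bsub>R\<^esub> B \<subseteq> C"
  using right_module.submodule_sum_least[OF right_module_right_regular[OF ring_axioms], of C A B]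
  by (simp add: submodule_right_regular[OF ring_axioms])

lemma right_ideal_Int: "right_ideal R A \<Longrightarrow> right_ideal R B \<Longrightarrow> right_ideal R (A \<inter> B)"
  by (auto simp: right_ideal_def)

lemma right_ideal_zero: "right_ideal R {\<zero>}"
  by (auto simp: right_ideal_def)

lemma right_ideal_carrier: "right_ideal R (carrier R)"
  by (auto simp: right_ideal_def)

lemma right_ideal_principal:
  assumes "a \<in> carrier R"
  shows "right_ideal R ((\<lambda>r. a \<otimes> r) ` carrier R)"
proof (rule right_idealI)
  show "\<zero> \<in> (\<lambda>r. a \<otimes> r) ` carrier R" using assms by (auto intro!: image_eqI[of _ _ \<zero>])
  show "x \<oplus> y \<in> (\<lambda>r. a \<otimes> r) ` carrier R"
    if "x \<in> (\<lambda>r. a \<otimes> r) ` carrier R" "y \<in> (\<lambda>r. a \<otimes> r) ` carrier R" for x y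
    using that assms by (auto simp: r_distr[symmetric])
qed (use assms in \<open>auto simp: m_assoc\<close>)

lemma principal_self: "a \<in> carrier R \<Longrightarrow> a \<in> (\<lambda>r. a \<otimes> r) ` carrier R"
  by (force intro!: image_eqI[of _ _ \<one>])

lemma right_ideal_rann: "A \<subseteq> carrier R \<Longrightarrow> right_ideal R (rann R A)"
proof (rule right_idealI)
  assume A: "A \<subseteq> carrier R"
  show "x \<otimes> r \<in> rann R A" if "x \<in> rann R A" "r \<in> carrier R" for x r
    using that A by (auto simp: rann_def m_assoc[symmetric] subset_iff)
qed (auto simp: rann_def r_distr subset_iff)

lemma left_ideal_lann: "A \<subseteq> carrier R \<Longrightarrow> left_ideal R (lann R A)"
  using ring.right_ideal_rann[OF opposite, of A] by simp

lemma two_sided_rann: "right_ideal R A \<Longrightarrow> two_sided R (rann R A)"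
  using right_ideal_rann[of A]
  by (auto simp: two_sided_def left_ideal_def right_ideal_def rann_def subset_iff m_assoc[symmetric] r_distr)

lemma two_sided_lann: "left_ideal R A \<Longrightarrow> two_sided R (lann R A)"
  using ring.two_sided_rann[OF opposite, of A] by simp

lemma right_ideal_colon:
  assumes W: "right_ideal R W" and a: "a \<in> carrier R"
  shows "right_ideal R {r \<in> carrier R. a \<otimes> r \<in> W}"
  by (rule right_idealI) (use W a right_idealD[OF W] in \<open>auto simp: r_distr m_assoc[symmetric]\<close>)

text \<open>
  This form of the modular law transfers a chain condition across a step in a chain of ideals.
\<close>

lemma right_ideal_modular:
  assumes A: "right_ideal R A" and B: "right_ideal R B" and W: "right_ideal R W"
    and "A \<subseteq> B" "A \<inter> W = B \<inter> W" "A <+>\<^bsub>R\<^esub> W = B <+>\<^bsub>R\<^esub> W"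
  shows "A = B"
proof
  show "B \<subseteq> A"
  proof
    fix b assume b: "b \<in> B"
    then have "b \<in> A <+>\<^bsub>R\<^esub> W" using right_ideal_sum_upper[OF B W] assms by blast
    then obtain a x where ax: "a \<in> A" "x \<in> W" "b = a \<oplus> x" by (auto simp: set_add_iff)
    note c = right_idealD(5)[OF A] right_idealD(5)[OF B] right_idealD(5)[OF W]
    have "x \<in> carrier R" "a \<in> carrier R" using ax c by auto
    then have "x = b \<ominus> a" unfolding ax(3) by algebra
    moreover have "b \<ominus> a \<in> B" using right_ideal_diff[OF B b] ax assms by blast
    ultimately have "x \<in> A" using ax assms by blast
    then show "b \<in> A" using ax right_idealD(3)[OF A] by blast
  qed
qed fact

text \<open>
  By the modular law a member of a chain is determined by its intersection and its sum with \<open>W\<close>. So a chain condition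
  below \<open>W\<close> and one above \<open>W\<close> combine.
\<close>

lemma right_ideal_chain_stable:
  fixes I :: "nat \<Rightarrow> 'a set"
  assumes I: "\<And>n. right_ideal R (I n)" and W: "right_ideal R W"
    and comparable: "\<And>m n. n \<le> m \<Longrightarrow> I n \<subseteq> I m \<or> I m \<subseteq> I n"
    and Int: "\<exists>n. \<forall>m\<ge>n. I m \<inter> W = I n \<inter> W"
    and sum: "\<exists>n. \<forall>m\<ge>n. I m <+>\<^bsub>R\<^esub> W = I n <+>\<^bsub>R\<^esub> W"
  shows "\<exists>n. \<forall>m\<ge>n. I m = I n"
proof -
  obtain n1 where n1: "\<And>m. m \<ge> n1 \<Longrightarrow> I m \<inter> W = I n1 \<inter> W" using Int by blast
  obtain n2 where n2: "\<And>m. m \<ge> n2 \<Longrightarrow> I m <+>\<^bsub>R\<^esub> W = I n2 <+>\<^bsub>R\<^esub> W" using sum by blast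
  let ?n = "max n1 n2"
  have "I m = I ?n" if m: "m \<ge> ?n" for m
  proof -
    have i: "I m \<inter> W = I ?n \<inter> W" using n1[of m] n1[of ?n] m by simp
    have s: "I m <+>\<^bsub>R\<^esub> W = I ?n <+>\<^bsub>R\<^esub> W" using n2[of m] n2[of ?n] m by simp
    show ?thesis
      using comparable[OF m] right_ideal_modular[OF I I W _ i s]
        right_ideal_modular[OF I I W _ i[symmetric] s[symmetric]] by metis
  qed
  then show ?thesis by blast
qed

end

section \<open>Chain conditions\<close>

lemma right_noetherian_iff:
  assumes "ring R"
  shows "right_noetherian R \<longleftrightarrow> (\<forall>I :: nat \<Rightarrow> _. (\<forall>n. right_ideal R (I n) \<and> I n \<subseteq> I (Suc n)) \<longrightarrow>
        (\<exists>n. \<forall>m \<ge> n. I m = I n))"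
  by (simp add: right_noetherian_def noetherian_module_def submodule_right_regular[OF assms])

lemma right_artinian_iff:
  assumes "ring R"
  shows "right_artinian R \<longleftrightarrow> (\<forall>I :: nat \<Rightarrow> _. (\<forall>n. right_ideal R (I n) \<and> I (Suc n) \<subseteq> I n) \<longrightarrow>
        (\<exists>n. \<forall>m \<ge> n. I m = I n))"
  by (simp add: right_artinian_def artinian_module_def submodule_right_regular[OF assms])

lemma right_noetherian_maximal:
  assumes R: "ring R" "right_noetherian R" and P: "\<And>I. P I \<Longrightarrow> right_ideal R I" and I0: "P I0"
  obtains M where "P M" "I0 \<subseteq> M" "\<And>I. P I \<Longrightarrow> M \<subseteq> I \<Longrightarrow> I = M"
proof -
  have "\<exists>M. (P M \<and> I0 \<subseteq> M) \<and> (\<forall>I. P I \<longrightarrow> M \<subseteq> I \<longrightarrow> I = M)"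
  proof (rule ccontr)
    assume no: "\<not> ?thesis"
    have "\<exists>f. \<forall>n::nat. (P (f n) \<and> I0 \<subseteq> f n) \<and> f n \<subset> f (Suc n)"
    proof (rule dependent_nat_choice[of "\<lambda>_ I. P I \<and> I0 \<subseteq> I" "\<lambda>_ I J. I \<subset> J"])
      show "\<exists>I. P I \<and> I0 \<subseteq> I" using I0 by blast
      show "\<exists>J. (P J \<and> I0 \<subseteq> J) \<and> I \<subset> J" if I: "P I \<and> I0 \<subseteq> I" for I
      proof -
        obtain J where "P J" "I \<subseteq> J" "J \<noteq> I" using no I by metis
        then show ?thesis using I by (intro exI[of _ J]) auto
      qed
    qed
    then obtain f where f: "\<And>n::nat. P (f n)" "\<And>n. f n \<subset> f (Suc n)" by metis
    have "\<forall>n. right_ideal R (f n) \<and> f n \<subseteq> f (Suc n)" using f P by (metis psubset_imp_subset)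
    then have "\<exists>n. \<forall>m\<ge>n. f m = f n"
      by (rule spec[OF R(2)[unfolded right_noetherian_iff[OF R(1)]], THEN mp]) 
    then obtain n where "\<forall>m\<ge>n. f m = f n" ..
    then have "f (Suc n) = f n" by (meson le_SucI order_refl)
    then show False using f(2)[of n] by simp
  qed
  then obtain M where "P M" "I0 \<subseteq> M" "\<forall>I. P I \<longrightarrow> M \<subseteq> I \<longrightarrow> I = M" by (elim exE conjE) rule
  then show thesis by (intro that[of M]) simp_all
qed

lemma right_artinian_minimal:
  assumes R: "ring R" "right_artinian R" and P: "\<And>I. P I \<Longrightarrow> right_ideal R I" and I0: "P I0"
  obtains M where "P M" "M \<subseteq> I0" "\<And>I. P I \<Longrightarrow> I \<subseteq> M \<Longrightarrow> I = M"
proof -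
  have "\<exists>M. (P M \<and> M \<subseteq> I0) \<and> (\<forall>I. P I \<longrightarrow> I \<subseteq> M \<longrightarrow> I = M)"
  proof (rule ccontr)
    assume no: "\<not> ?thesis"
    have "\<exists>f. \<forall>n::nat. (P (f n) \<and> f n \<subseteq> I0) \<and> f (Suc n) \<subset> f n"
    proof (rule dependent_nat_choice[of "\<lambda>_ I. P I \<and> I \<subseteq> I0" "\<lambda>_ I J. J \<subset> I"])
      show "\<exists>I. P I \<and> I \<subseteq> I0" using I0 by blast
      show "\<exists>J. (P J \<and> J \<subseteq> I0) \<and> J \<subset> I" if I: "P I \<and> I \<subseteq> I0" for I
      proof -
        obtain J where "P J" "J \<subseteq> I" "J \<noteq> I" using no I by metis
        then show ?thesis using I by (intro exI[of _ J]) auto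
      qed
    qed
    then obtain f where f: "\<And>n::nat. P (f n)" "\<And>n. f (Suc n) \<subset> f n" by metis
    have "\<forall>n. right_ideal R (f n) \<and> f (Suc n) \<subseteq> f n" using f P by (metis psubset_imp_subset)
    then have "\<exists>n. \<forall>m\<ge>n. f m = f n"
      by (rule spec[OF R(2)[unfolded right_artinian_iff[OF R(1)]], THEN mp]) 
    then obtain n where "\<forall>m\<ge>n. f m = f n" ..
    then have "f (Suc n) = f n" by (meson le_SucI order_refl)
    then show False using f(2)[of n] by simp
  qed
  then obtain M where "P M" "M \<subseteq> I0" "\<forall>I. P I \<longrightarrow> I \<subseteq> M \<longrightarrow> I = M" by (elim exE conjE) rule
  then show thesis by (intro that[of M]) simp_all
qed

section \<open>Nilpotence and the right singular ideal\<close>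

text \<open>
  That the right annihilator of \<open>a\<close> is essential means that it meets every \<open>x R \<noteq> 0\<close> nontrivially; this is the right
  singular ideal.
\<close>

definition right_singular :: "('a, 'r) ring_scheme \<Rightarrow> 'a set" where
  "right_singular R = {a \<in> carrier R. \<forall>x\<in>carrier R. x \<noteq> \<zero>\<^bsub>R\<^esub> \<longrightarrow>
     (\<exists>r\<in>carrier R. x \<otimes>\<^bsub>R\<^esub> r \<noteq> \<zero>\<^bsub>R\<^esub> \<and> a \<otimes>\<^bsub>R\<^esub> (x \<otimes>\<^bsub>R\<^esub> r) = \<zero>\<^bsub>R\<^esub>)}"

text \<open>
  Powers of an ideal enter only through the question whether all products of \<open>n\<close> factors vanish. In this form
  nilpotence is symmetric in left and right.
\<close>

definition products :: "('a, 'r) ring_scheme \<Rightarrow> 'a set \<Rightarrow> nat \<Rightarrow> 'a set" where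
  "products R Z n = {foldr (\<otimes>\<^bsub>R\<^esub>) zs \<one>\<^bsub>R\<^esub> | zs. set zs \<subseteq> Z \<and> length zs = n}"

definition nilpotent :: "('a, 'r) ring_scheme \<Rightarrow> 'a set \<Rightarrow> bool" where
  "nilpotent R Z \<longleftrightarrow> (\<exists>n. products R Z n \<subseteq> {\<zero>\<^bsub>R\<^esub>})"

context ring
begin

lemmas ring_expand = minus_eq l_distr r_distr l_minus r_minus minus_add m_assoc a_ac

text \<open>
  For sums, first move inside \<open>x R\<close> to an element killed by \<open>a\<close>, then inside the result to one killed by \<open>b\<close>. For
  \<open>a c\<close>, use that \<open>a\<close> kills a nonzero element of \<open>c x R\<close>, unless \<open>c x = \<zero>\<close> already.
\<close>

lemma two_sided_right_singular: "two_sided R (right_singular R)"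
proof -
  let ?Z = "right_singular R"
  have sub: "?Z \<subseteq> carrier R" by (auto simp: right_singular_def)
  have zero: "\<zero> \<in> ?Z"
    unfolding right_singular_def by (auto intro!: bexI[of _ \<one>])
  have add: "a \<oplus> b \<in> ?Z" if "a \<in> ?Z" "b \<in> ?Z" for a b
  proof -
    have ab: "a \<in> carrier R" "b \<in> carrier R" using that sub by auto
    have "\<exists>r\<in>carrier R. x \<otimes> r \<noteq> \<zero> \<and> (a \<oplus> b) \<otimes> (x \<otimes> r) = \<zero>" if x: "x \<in> carrier R" "x \<noteq> \<zero>" for x
    proof -
      obtain r where r: "r \<in> carrier R" "x \<otimes> r \<noteq> \<zero>" "a \<otimes> (x \<otimes> r) = \<zero>"
        using \<open>a \<in> ?Z\<close> x by (auto simp: right_singular_def)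
      obtain s where s: "s \<in> carrier R" "x \<otimes> r \<otimes> s \<noteq> \<zero>" "b \<otimes> (x \<otimes> r \<otimes> s) = \<zero>"
        using \<open>b \<in> ?Z\<close> x r by (auto simp: right_singular_def)
      have "a \<otimes> (x \<otimes> r \<otimes> s) = \<zero>" using r s(1) ab x by (simp add: m_assoc[symmetric])
      then have "(a \<oplus> b) \<otimes> (x \<otimes> (r \<otimes> s)) = \<zero>" using r s ab x by (simp add: l_distr m_assoc)
      then show ?thesis using r s x by (intro bexI[of _ "r \<otimes> s"]) (simp_all add: m_assoc)
    qed
    then show ?thesis using ab by (auto simp: right_singular_def)
  qed
  have lm: "c \<otimes> a \<in> ?Z" if a: "a \<in> ?Z" and c: "c \<in> carrier R" for a c
  proof -
    have ac: "a \<in> carrier R" using a sub by auto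
    have "\<exists>r\<in>carrier R. x \<otimes> r \<noteq> \<zero> \<and> (c \<otimes> a) \<otimes> (x \<otimes> r) = \<zero>" if x: "x \<in> carrier R" "x \<noteq> \<zero>" for x
    proof -
      obtain r where r: "r \<in> carrier R" "x \<otimes> r \<noteq> \<zero>" "a \<otimes> (x \<otimes> r) = \<zero>"
        using a x by (auto simp: right_singular_def)
      then show ?thesis using c ac x by (intro bexI[of _ r]) (simp_all add: m_assoc)
    qed
    then show ?thesis using ac c by (auto simp: right_singular_def)
  qed
  have rm: "a \<otimes> c \<in> ?Z" if a: "a \<in> ?Z" and c: "c \<in> carrier R" for a c
  proof -
    have ac: "a \<in> carrier R" "c \<in> carrier R" using a c sub by auto
    have "\<exists>r\<in>carrier R. x \<otimes> r \<noteq> \<zero> \<and> (a \<otimes> c) \<otimes> (x \<otimes> r) = \<zero>" if x: "x \<in> carrier R" "x \<noteq> \<zero>" for x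
    proof (cases "c \<otimes> x = \<zero>")
      case True
      then show ?thesis using x ac by (intro bexI[of _ \<one>]) (simp_all add: m_assoc)
    next
      case False
      then obtain r where r: "r \<in> carrier R" "c \<otimes> x \<otimes> r \<noteq> \<zero>" "a \<otimes> (c \<otimes> x \<otimes> r) = \<zero>"
        using a x ac by (auto simp: right_singular_def)
      have "x \<otimes> r \<noteq> \<zero>" using r ac x by (auto simp: m_assoc)
      then show ?thesis using r x ac by (intro bexI[of _ r]) (simp_all add: m_assoc)
    qed
    then show ?thesis using ac by (auto simp: right_singular_def)
  qed
  show ?thesis using sub zero add lm rm by (simp add: two_sided_def right_ideal_def left_ideal_def)
qed

lemma foldr_mult_closed [simp]: "set zs \<subseteq> carrier R \<Longrightarrow> foldr (\<otimes>) zs \<one> \<in> carrier R"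
  by (induction zs) auto

lemma foldr_mult_append:
  "set xs \<subseteq> carrier R \<Longrightarrow> set ys \<subseteq> carrier R \<Longrightarrow>
    foldr (\<otimes>) (xs @ ys) \<one> = foldr (\<otimes>) xs \<one> \<otimes> foldr (\<otimes>) ys \<one>"
  by (induction xs) (auto simp: m_assoc)

lemma products_carrier: "Z \<subseteq> carrier R \<Longrightarrow> products R Z n \<subseteq> carrier R"
  by (auto simp: products_def)

lemma products_SucE_left:
  assumes "p \<in> products R Z (Suc n)"
  obtains z q where "z \<in> Z" "q \<in> products R Z n" "p = z \<otimes> q"
proof -
  obtain zs where zs: "set zs \<subseteq> Z" "length zs = Suc n" "p = foldr (\<otimes>) zs \<one>"
    using assms by (auto simp: products_def)
  then obtain z ys where "zs = z # ys" by (cases zs) auto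
  then show thesis using zs that[of z "foldr (\<otimes>) ys \<one>"] by (auto simp: products_def)
qed

lemma products_SucE_right:
  assumes "Z \<subseteq> carrier R" "p \<in> products R Z (Suc n)"
  obtains z q where "z \<in> Z" "q \<in> products R Z n" "p = q \<otimes> z"
proof -
  obtain zs where zs: "set zs \<subseteq> Z" "length zs = Suc n" "p = foldr (\<otimes>) zs \<one>"
    using assms by (auto simp: products_def)
  then obtain z ys where e: "zs = ys @ [z]" by (cases zs rule: rev_cases) auto
  have "set ys \<subseteq> carrier R" "set [z] \<subseteq> carrier R" using zs e assms by auto
  then have "p = foldr (\<otimes>) ys \<one> \<otimes> z" using zs(3) foldr_mult_append[of ys "[z]"] by (simp add: e del: foldr_append)
  then show thesis using zs e that[of z "foldr (\<otimes>) ys \<one>"] by (auto simp: products_def)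
qed

lemma products_Suc_left: "z \<in> Z \<Longrightarrow> q \<in> products R Z n \<Longrightarrow> z \<otimes> q \<in> products R Z (Suc n)"
  unfolding products_def mem_Collect_eq
  by (elim exE conjE) (rule exI[of _ "z # _"], simp)

lemma products_Suc_right:
  assumes Z: "Z \<subseteq> carrier R" and z: "z \<in> Z" and q: "q \<in> products R Z n"
  shows "q \<otimes> z \<in> products R Z (Suc n)"
proof -
  obtain zs where zs: "set zs \<subseteq> Z" "length zs = n" "q = foldr (\<otimes>) zs \<one>"
    using q by (auto simp: products_def)
  have "set zs \<subseteq> carrier R" "z \<in> carrier R" using zs z Z by auto
  then have "q \<otimes> z = foldr (\<otimes>) (zs @ [z]) \<one>"
    using foldr_mult_append[of zs "[z]"] zs(3) by (simp del: foldr_append)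
  then show ?thesis unfolding products_def using zs z by (auto intro!: exI[of _ "zs @ [z]"] simp del: foldr_append)
qed

lemma foldr_opposite:
  "set zs \<subseteq> carrier R \<Longrightarrow> foldr (\<otimes>\<^bsub>opposite_ring R\<^esub>) zs \<one> = foldr (\<otimes>) (rev zs) \<one>"
  by (induction zs) (auto simp: foldr_mult_append simp del: foldr_append)

lemma nilpotent_opposite:
  assumes Z: "Z \<subseteq> carrier R"
  shows "nilpotent (opposite_ring R) Z \<longleftrightarrow> nilpotent R Z"
proof -
  have "products (opposite_ring R) Z n = products R Z n" for n
  proof (intro equalityI subsetI)
    fix p assume "p \<in> products (opposite_ring R) Z n"
    then obtain zs where "set zs \<subseteq> Z" "length zs = n" "p = foldr (\<otimes>) (rev zs) \<one>"
      using Z foldr_opposite by (auto simp: products_def)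
    then show "p \<in> products R Z n" by (auto simp: products_def intro!: exI[of _ "rev zs"])
  next
    fix p assume "p \<in> products R Z n"
    then obtain zs where zs: "set zs \<subseteq> Z" "length zs = n" "p = foldr (\<otimes>) zs \<one>"
      by (auto simp: products_def)
    then have "p = foldr (\<otimes>\<^bsub>opposite_ring R\<^esub>) (rev zs) \<one>" using Z foldr_opposite[of "rev zs"] by auto
    then show "p \<in> products (opposite_ring R) Z n" using zs by (auto simp: products_def intro!: exI[of _ "rev zs"])
  qed
  then show ?thesis by (simp add: nilpotent_def)
qed

text \<open>
  The left inverse is a partial sum of the geometric series of \<open>z\<close>.
\<close>

lemma nilpotent_left_inverse:
  assumes nil: "nilpotent R Z" and z: "z \<in> Z" and Z: "Z \<subseteq> carrier R"
  obtains d where "d \<in> carrier R" "d \<otimes> (\<one> \<ominus> z) = \<one>"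
proof -
  have zc: "z \<in> carrier R" using z Z by blast
  have main: "\<exists>d\<in>carrier R. d \<otimes> (\<one> \<ominus> z) = \<one> \<ominus> foldr (\<otimes>) (replicate n z) \<one>" for n
  proof (induction n)
    case 0
    show ?case using zc by (intro bexI[of _ \<zero>]) (simp_all add: a_minus_def r_neg)
  next
    case (Suc n)
    then obtain d where d: "d \<in> carrier R" "d \<otimes> (\<one> \<ominus> z) = \<one> \<ominus> foldr (\<otimes>) (replicate n z) \<one>" by blast
    have p: "foldr (\<otimes>) (replicate n z) \<one> \<in> carrier R"
      by (rule foldr_mult_closed) (use zc in auto)
    have "(z \<otimes> d \<oplus> \<one>) \<otimes> (\<one> \<ominus> z) = z \<otimes> (d \<otimes> (\<one> \<ominus> z)) \<oplus> (\<one> \<ominus> z)"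
      using zc d(1) by (simp add: l_distr m_assoc)
    also have "\<dots> = \<one> \<ominus> z \<otimes> foldr (\<otimes>) (replicate n z) \<one>"
      unfolding d(2) using zc p by (simp add: a_minus_def r_distr r_minus a_ac) (simp add: a_lcomm[of \<one> "\<ominus> z"] r_neg2)
    finally show ?case using zc d(1) by (intro bexI[of _ "z \<otimes> d \<oplus> \<one>"]) simp_all
  qed
  obtain n where n: "products R Z n \<subseteq> {\<zero>}" using nil by (auto simp: nilpotent_def)
  have "foldr (\<otimes>) (replicate n z) \<one> \<in> products R Z n"
    unfolding products_def using z by (intro CollectI exI[of _ "replicate n z"]) (auto simp: set_replicate_conv_if)
  then have "foldr (\<otimes>) (replicate n z) \<one> = \<zero>" using n by blast
  then show thesis using main[of n] that by (auto simp: a_minus_def)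
qed

text \<open>
  The right annihilators of the powers of \<open>Z\<close> ascend and become constant, say equal to \<open>A\<close>. If \<open>A \<noteq> R\<close>, choose
  \<open>a \<notin> A\<close> with \<open>r(a)\<close> maximal. For \<open>z \<in> Z\<close> the annihilator of \<open>z\<close> meets \<open>a R\<close>, so \<open>r(z a)\<close> is strictly larger than
  \<open>r(a)\<close>, and maximality gives \<open>z a \<in> A\<close>. Hence \<open>Z a \<subseteq> A\<close>, which puts \<open>a\<close> into the next annihilator of the chain, that
  is, into \<open>A\<close>.
\<close>

lemma right_singular_nilpotent:
  assumes "right_noetherian R"
  shows "nilpotent R (right_singular R)"
proof -
  let ?Z = "right_singular R"
  let ?A = "\<lambda>n. rann R (products R ?Z n)"
  have Z: "two_sided R ?Z" by (rule two_sided_right_singular)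
  then have Zc: "?Z \<subseteq> carrier R" by (auto simp: two_sided_def right_ideal_def)
  note pc = products_carrier[OF Zc]
  have ri: "right_ideal R (?A n)" for n using right_ideal_rann[OF pc] .
  have step: "?A n \<subseteq> ?A (Suc n)" for n
  proof
    fix y assume y: "y \<in> ?A n"
    have "p \<otimes> y = \<zero>" if "p \<in> products R ?Z (Suc n)" for p
    proof -
      from that obtain z q where zq: "z \<in> ?Z" "q \<in> products R ?Z n" "p = z \<otimes> q" by (rule products_SucE_left)
      then have "z \<in> carrier R" "q \<in> carrier R" "q \<otimes> y = \<zero>" "y \<in> carrier R" using Zc pc y by (auto simp: rann_def)
      then show ?thesis using zq by (simp add: m_assoc)
    qed
    then show "y \<in> ?A (Suc n)" using y by (auto simp: rann_def)
  qed
  have "\<forall>n. right_ideal R (?A n) \<and> ?A n \<subseteq> ?A (Suc n)" using ri step by blast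
  then have "\<exists>n. \<forall>m\<ge>n. ?A m = ?A n"
    by (rule spec[OF assms[unfolded right_noetherian_iff[OF ring_axioms]], THEN mp])
  then obtain n where n: "?A (Suc n) = ?A n" by (meson le_SucI order_refl)
  have "\<one> \<in> ?A n"
  proof (rule ccontr)
    assume n1: "\<one> \<notin> ?A n"
    let ?P = "\<lambda>I. \<exists>a\<in>carrier R - ?A n. I = rann R {a}"
    have P1: "?P (rann R {\<one>})" using n1 by auto
    have Pr: "right_ideal R I" if "?P I" for I using that right_ideal_rann by auto
    obtain M where M: "?P M" "\<And>I. ?P I \<Longrightarrow> M \<subseteq> I \<Longrightarrow> I = M"
      by (rule right_noetherian_maximal[OF ring_axioms assms, of ?P, OF Pr P1]) simp_all
    then obtain a where a: "a \<in> carrier R" "a \<notin> ?A n" "M = rann R {a}" by auto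
    have a0: "a \<noteq> \<zero>" using a right_idealD(2)[OF ri] by metis
    have za: "z \<otimes> a \<in> ?A n" if z: "z \<in> ?Z" for z
    proof (rule ccontr)
      assume no: "z \<otimes> a \<notin> ?A n"
      have zc: "z \<in> carrier R" using z Zc by auto
      obtain r where r: "r \<in> carrier R" "a \<otimes> r \<noteq> \<zero>" "z \<otimes> (a \<otimes> r) = \<zero>"
        using z a a0 by (auto simp: right_singular_def)
      have "?P (rann R {z \<otimes> a})" using no zc a by blast
      moreover have "M \<subseteq> rann R {z \<otimes> a}" using zc a by (auto simp: rann_def m_assoc)
      ultimately have "rann R {z \<otimes> a} = M" using M by blast
      moreover have "r \<in> rann R {z \<otimes> a}" using r zc a by (auto simp: rann_def m_assoc)
      ultimately show False using a r by (auto simp: rann_def)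
    qed
    have "p \<otimes> a = \<zero>" if "p \<in> products R ?Z (Suc n)" for p
    proof -
      from that obtain z q where zq: "z \<in> ?Z" "q \<in> products R ?Z n" "p = q \<otimes> z"
        by (rule products_SucE_right[OF Zc])
      then have "z \<in> carrier R" "q \<in> carrier R" "q \<otimes> (z \<otimes> a) = \<zero>" using Zc pc za by (auto simp: rann_def)
      then show ?thesis using zq a by (simp add: m_assoc)
    qed
    then have "a \<in> ?A (Suc n)" using a by (auto simp: rann_def)
    then show False using n a by simp
  qed
  then have "products R ?Z n \<subseteq> {\<zero>}" using pc[of n] by (auto simp: rann_def subset_iff)
  then show ?thesis by (auto simp: nilpotent_def)
qed

text \<open>
  Let \<open>B\<close> be the stable value of the descending chain of right ideals generated by the \<open>n\<close>-fold products. If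
  \<open>B \<noteq> 0\<close>, a right ideal \<open>A\<close> that is minimal among those not contained in \<open>l(B)\<close> satisfies \<open>A = x z R\<close> for some \<open>x \<in> A\<close> and \<open>z \<in> Z\<close>.
  Then \<open>x = x z r\<close>, and since \<open>\<one> - z r\<close> has a right inverse, \<open>x = \<zero>\<close>.
\<close>

lemma artinian_nilpotent:
  assumes art: "right_artinian R" and Z: "two_sided R Z"
    and unit: "\<And>z. z \<in> Z \<Longrightarrow> \<exists>d\<in>carrier R. (\<one> \<ominus> z) \<otimes> d = \<one>"
  shows "nilpotent R Z"
proof -
  have Zc: "Z \<subseteq> carrier R" using Z by (auto simp: two_sided_def right_ideal_def)
  have Zr: "right_ideal R Z" using Z by (simp add: two_sided_def)
  note pc = products_carrier[OF Zc]
  define B where "B n = \<Inter>{I. right_ideal R I \<and> products R Z n \<subseteq> I}" for n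
  have Bc: "B n \<subseteq> carrier R" for n unfolding B_def using right_ideal_carrier pc by blast
  have Bri: "right_ideal R (B n)" for n
    by (rule right_idealI) (use Bc[of n] in \<open>auto simp: B_def right_ideal_def\<close>)
  have BI: "B n \<subseteq> I" if "right_ideal R I" "products R Z n \<subseteq> I" for n I using that by (auto simp: B_def)
  have Bp: "products R Z n \<subseteq> B n" for n by (auto simp: B_def)
  have "B (Suc n) \<subseteq> B n" for n
  proof (rule BI[OF Bri], rule subsetI)
    fix p assume "p \<in> products R Z (Suc n)"
    then obtain z q where "z \<in> Z" "q \<in> products R Z n" "p = q \<otimes> z" by (rule products_SucE_right[OF Zc])
    then show "p \<in> B n" using right_idealD(4)[OF Bri] Bp Zc by blast
  qed
  then have "\<forall>n. right_ideal R (B n) \<and> B (Suc n) \<subseteq> B n" using Bri by simp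
  then have "\<exists>n. \<forall>m\<ge>n. B m = B n"
    by (rule spec[OF art[unfolded right_artinian_iff[OF ring_axioms]], THEN mp])
  then obtain n where n: "B (Suc n) = B n" by (meson le_SucI order_refl)
  let ?L = "lann R (B n)"
  \<comment> \<open>The ideal \<open>B n\<close> is generated by products with \<open>n + 1\<close> factors, so whatever kills \<open>Z B\<close> on the left kills \<open>B\<close>.\<close>
  have up: "x \<in> ?L" if x: "x \<in> carrier R" and xz: "\<And>z. z \<in> Z \<Longrightarrow> x \<otimes> z \<in> ?L" for x
  proof -
    have "products R Z (Suc n) \<subseteq> rann R {x}"
    proof
      fix p assume p: "p \<in> products R Z (Suc n)"
      then obtain z q where zq: "z \<in> Z" "q \<in> products R Z n" "p = z \<otimes> q" by (rule products_SucE_left)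
      then have "x \<otimes> z \<otimes> q = \<zero>" using xz Bp by (auto simp: lann_def)
      moreover have "z \<in> carrier R" "q \<in> carrier R" using zq Zc pc by auto
      ultimately show "p \<in> rann R {x}" using x zq by (simp add: rann_def m_assoc)
    qed
    then have "B n \<subseteq> rann R {x}" using BI[OF right_ideal_rann, of "{x}" "Suc n"] x n by simp
    then show ?thesis using x by (auto simp: lann_def rann_def)
  qed
  have "\<one> \<in> ?L"
  proof (rule ccontr)
    assume n1: "\<one> \<notin> ?L"
    let ?P = "\<lambda>I. right_ideal R I \<and> \<not> I \<subseteq> ?L"
    have P1: "?P (carrier R)" using right_ideal_carrier n1 by auto
    have Pr: "?P I \<Longrightarrow> right_ideal R I" for I by simp
    obtain A where A: "?P A" "\<And>I. ?P I \<Longrightarrow> I \<subseteq> A \<Longrightarrow> I = A"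
      by (rule right_artinian_minimal[OF ring_axioms art, of ?P, OF Pr P1]) simp_all
    then obtain x where x: "x \<in> A" "x \<notin> ?L" by auto
    have xc: "x \<in> carrier R" using x A right_idealD(5) by metis
    obtain z where z: "z \<in> Z" "x \<otimes> z \<notin> ?L" using up x xc by metis
    have zc: "z \<in> carrier R" using z Zc by auto
    let ?I = "(\<lambda>r. x \<otimes> z \<otimes> r) ` carrier R"
    have "?P ?I"
      using right_ideal_principal[of "x \<otimes> z"] principal_self[of "x \<otimes> z"] xc zc z by auto
    moreover have "?I \<subseteq> A" using A x zc right_idealD(4)[of R A] by (auto simp: xc)
    ultimately have "x \<in> ?I" using A x by metis
    then obtain r where r: "r \<in> carrier R" "x = x \<otimes> z \<otimes> r" by auto
    then have "z \<otimes> r \<in> Z" using right_idealD(4)[OF Zr] z by metis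
    then obtain d where d: "d \<in> carrier R" "(\<one> \<ominus> z \<otimes> r) \<otimes> d = \<one>" using unit by metis
    have "x \<otimes> (\<one> \<ominus> z \<otimes> r) = x \<ominus> x \<otimes> z \<otimes> r" using xc zc r(1) by (simp add: ring_expand)
    also have "\<dots> = \<zero>" unfolding r(2)[symmetric] using xc by (simp add: a_minus_def r_neg)
    finally have "x \<otimes> ((\<one> \<ominus> z \<otimes> r) \<otimes> d) = \<zero>" using xc zc r(1) d(1) by (simp add: m_assoc[symmetric])
    then have "x = \<zero>" using d xc by simp
    then show False using x Bc[of n] by (auto simp: lann_def)
  qed
  then have "B n \<subseteq> {\<zero>}" using Bc[of n] by (auto simp: lann_def subset_iff)
  then show ?thesis using Bp by (auto simp: nilpotent_def)
qed

end

lemma (in right_module) maximal_submodule_avoiding: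
  assumes D0: "submodule D0 R M" "D0 \<inter> A = {}"
  obtains D where "submodule D R M" "D0 \<subseteq> D" "D \<inter> A = {}"
    "\<And>E. submodule E R M \<Longrightarrow> D \<subseteq> E \<Longrightarrow> E \<inter> A = {} \<Longrightarrow> E = D"
proof -
  let ?\<A> = "{D. submodule D R M \<and> D0 \<subseteq> D \<and> D \<inter> A = {}}"
  have "\<exists>D\<in>?\<A>. \<forall>E\<in>?\<A>. D \<subseteq> E \<longrightarrow> E = D"
  proof (rule subset_Zorn_nonempty)
    show "?\<A> \<noteq> {}" using D0 by blast
    show "\<Union>\<C> \<in> ?\<A>" if ne: "\<C> \<noteq> {}" and ch: "subset.chain ?\<A> \<C>" for \<C>
    proof -
      have C: "\<And>D. D \<in> \<C> \<Longrightarrow> submodule D R M \<and> D0 \<subseteq> D \<and> D \<inter> A = {}"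
        and lin: "\<And>D E. D \<in> \<C> \<Longrightarrow> E \<in> \<C> \<Longrightarrow> D \<subseteq> E \<or> E \<subseteq> D"
        using ch by (auto simp: subset_chain_def)
      have Cs: "\<And>D. D \<in> \<C> \<Longrightarrow> D \<subseteq> carrier M \<and> \<zero>\<^bsub>M\<^esub> \<in> D \<and> (\<forall>x\<in>D. \<forall>y\<in>D. x \<oplus>\<^bsub>M\<^esub> y \<in> D) \<and>
     (\<forall>x\<in>D. \<forall>r\<in>carrier R. r \<odot>\<^bsub>M\<^esub> x \<in> D)" using C submodule_iff by metis
      have "x \<oplus>\<^bsub>M\<^esub> y \<in> \<Union>\<C>" if xy: "x \<in> \<Union>\<C>" "y \<in> \<Union>\<C>" for x y
      proof -
        obtain D E where "D \<in> \<C>" "E \<in> \<C>" "x \<in> D" "y \<in> E" using xy by blast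
        then have "(x \<in> E \<and> y \<in> E) \<or> (x \<in> D \<and> y \<in> D)" using lin by blast
        then show ?thesis using Cs \<open>D \<in> \<C>\<close> \<open>E \<in> \<C>\<close> by blast
      qed
      moreover have "\<Union>\<C> \<subseteq> carrier M" "\<forall>x\<in>\<Union>\<C>. \<forall>r\<in>carrier R. r \<odot>\<^bsub>M\<^esub> x \<in> \<Union>\<C>" using Cs by blast+
      moreover have "\<zero>\<^bsub>M\<^esub> \<in> \<Union>\<C>" using ne Cs by blast
      ultimately have "submodule (\<Union>\<C>) R M" unfolding submodule_iff by blast
      moreover have "D0 \<subseteq> \<Union>\<C>" using ne C by blast
      moreover have "\<Union>\<C> \<inter> A = {}" using C by blast
      ultimately show ?thesis by blast
    qed
  qed
  then obtain D where "D \<in> ?\<A>" and m: "\<forall>E\<in>?\<A>. D \<subseteq> E \<longrightarrow> E = D" by blast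
  then have D: "submodule D R M" "D0 \<subseteq> D" "D \<inter> A = {}" by auto
  have "E = D" if "submodule E R M" "D \<subseteq> E" "E \<inter> A = {}" for E
    using m that D(2) by blast
  then show thesis using that D by metis
qed

text \<open>
  The quotient by \<open>Z\<close> is von Neumann regular, expressed by elements of \<open>R\<close>.
\<close>

definition regular_mod :: "('a, 'r) ring_scheme \<Rightarrow> 'a set \<Rightarrow> bool" where
  "regular_mod R Z \<longleftrightarrow> (\<forall>a\<in>carrier R. \<exists>b\<in>carrier R. a \<ominus>\<^bsub>R\<^esub> a \<otimes>\<^bsub>R\<^esub> b \<otimes>\<^bsub>R\<^esub> a \<in> Z)"

section \<open>Baer's condition for right ideals\<close>

context ring
begin

lemma maximal_right_ideal_avoiding:
  assumes D0: "right_ideal R D0" "D0 \<inter> A = {}"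
  obtains D where "right_ideal R D" "D0 \<subseteq> D" "D \<inter> A = {}"
    "\<And>E. right_ideal R E \<Longrightarrow> D \<subseteq> E \<Longrightarrow> E \<inter> A = {} \<Longrightarrow> E = D"
proof -
  interpret rr: right_module R "right_regular R" by (rule right_module_right_regular[OF ring_axioms])
  show thesis
    using rr.maximal_submodule_avoiding[unfolded submodule_right_regular[OF ring_axioms], OF D0] that
    by metis
qed

text \<open>
  Homomorphisms on right ideals are given here by their graphs, which arise naturally as parametrized sets of
  pairs; no preimages have to be chosen.
\<close>

lemma right_baer_relation:
  assumes baer: "right_baer R" and S: "S \<subseteq> carrier R \<times> carrier R" and zero: "(\<zero>, \<zero>) \<in> S"
    and add: "\<And>x y x' y'. (x, y) \<in> S \<Longrightarrow> (x', y') \<in> S \<Longrightarrow> (x \<oplus> x', y \<oplus> y') \<in> S"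
    and mult: "\<And>x y r. (x, y) \<in> S \<Longrightarrow> r \<in> carrier R \<Longrightarrow> (x \<otimes> r, y \<otimes> r) \<in> S"
    and func: "\<And>y. (\<zero>, y) \<in> S \<Longrightarrow> y = \<zero>"
  obtains c where "c \<in> carrier R" "\<And>x y. (x, y) \<in> S \<Longrightarrow> y = c \<otimes> x"
proof -
  have uniq: "y = y'" if xy: "(x, y) \<in> S" "(x, y') \<in> S" for x y y'
  proof -
    have c: "x \<in> carrier R" "y \<in> carrier R" "y' \<in> carrier R" using xy S by auto
    have "(x \<oplus> x \<otimes> \<ominus> \<one>, y \<oplus> y' \<otimes> \<ominus> \<one>) \<in> S" by (intro add mult xy) simp
    then have "(\<zero>, y \<ominus> y') \<in> S" using c by (simp add: r_minus r_neg a_minus_def)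
    then have "y \<ominus> y' = \<zero>" by (rule func)
    then show ?thesis using c by simp
  qed
  define f where "f x = (SOME y. (x, y) \<in> S)" for x
  have f: "f x = y" if "(x, y) \<in> S" for x y
    unfolding f_def using that uniq by blast
  have ri: "right_ideal R (fst ` S)"
  proof (rule right_idealI)
    show "\<zero> \<in> fst ` S" using zero by force
    show "x \<oplus> y \<in> fst ` S" if xy: "x \<in> fst ` S" "y \<in> fst ` S" for x y
    proof -
      obtain u v where "(x, u) \<in> S" "(y, v) \<in> S" using xy by auto
      from add[OF this] show ?thesis by (force simp: image_iff)
    qed
    show "x \<otimes> r \<in> fst ` S" if xr: "x \<in> fst ` S" "r \<in> carrier R" for x r
    proof -
      obtain u where "(x, u) \<in> S" using xr by auto
      from mult[OF this xr(2)] show ?thesis by (force simp: image_iff)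
    qed
  qed (use S in auto)
  have "\<exists>c\<in>carrier R. \<forall>x\<in>fst ` S. f x = c \<otimes> x"
  proof (rule baer[unfolded right_baer_def, THEN spec, THEN spec, THEN mp], intro conjI ri ballI)
    show "f \<in> fst ` S \<rightarrow> carrier R" using S f by auto
    show "f (x \<oplus> y) = f x \<oplus> f y" if xy: "x \<in> fst ` S" "y \<in> fst ` S" for x y
    proof -
      obtain u v where "(x, u) \<in> S" "(y, v) \<in> S" using xy by auto
      then show ?thesis using add f by metis
    qed
    show "f (x \<otimes> r) = f x \<otimes> r" if xr: "x \<in> fst ` S" "r \<in> carrier R" for x r
    proof -
      obtain u where "(x, u) \<in> S" using xr by auto
      then show ?thesis using mult xr f by metis
    qed
  qed
  then obtain c where "c \<in> carrier R" "\<forall>x\<in>fst ` S. f x = c \<otimes> x" by auto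
  then show thesis using that[of c] f by force
qed

text \<open>
  The assignment \<open>a + b r \<mapsto> c r\<close> on \<open>A + b R\<close> is well defined by the last hypothesis.
\<close>

lemma right_baer_extension:
  assumes baer: "right_baer R" and A: "right_ideal R A" and b: "b \<in> carrier R" and c: "c \<in> carrier R"
    and zero: "\<And>r. r \<in> carrier R \<Longrightarrow> b \<otimes> r \<in> A \<Longrightarrow> c \<otimes> r = \<zero>"
  obtains d where "d \<in> carrier R" "\<And>a. a \<in> A \<Longrightarrow> d \<otimes> a = \<zero>" "d \<otimes> b = c"
proof -
  note cA = right_idealD(5)[OF A]
  let ?S = "{(a \<oplus> b \<otimes> r, c \<otimes> r) | a r. a \<in> A \<and> r \<in> carrier R}"
  obtain d where d: "d \<in> carrier R" "\<And>u v. (u, v) \<in> ?S \<Longrightarrow> v = d \<otimes> u"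
  proof (rule right_baer_relation[OF baer, of ?S])
    show "?S \<subseteq> carrier R \<times> carrier R" using cA b c by auto
    have "(\<zero> \<oplus> b \<otimes> \<zero>, c \<otimes> \<zero>) \<in> ?S" using right_idealD(2)[OF A] by blast
    then show "(\<zero>, \<zero>) \<in> ?S" using b c by simp
    show "(u \<oplus> u', v \<oplus> v') \<in> ?S" if uv: "(u, v) \<in> ?S" "(u', v') \<in> ?S" for u v u' v'
    proof -
      from uv obtain a r a' r' where e: "a \<in> A" "a' \<in> A" "r \<in> carrier R" "r' \<in> carrier R"
        "u = a \<oplus> b \<otimes> r" "v = c \<otimes> r" "u' = a' \<oplus> b \<otimes> r'" "v' = c \<otimes> r'" by auto
      then have "u \<oplus> u' = (a \<oplus> a') \<oplus> b \<otimes> (r \<oplus> r')" "v \<oplus> v' = c \<otimes> (r \<oplus> r')"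
        using cA b c by (simp_all add: a_ac r_distr)
      then show ?thesis using e right_idealD(3)[OF A] by blast
    qed
    show "(u \<otimes> s, v \<otimes> s) \<in> ?S" if uv: "(u, v) \<in> ?S" "s \<in> carrier R" for u v s
    proof -
      from uv obtain a r where e: "a \<in> A" "r \<in> carrier R" "u = a \<oplus> b \<otimes> r" "v = c \<otimes> r" by auto
      then have "u \<otimes> s = a \<otimes> s \<oplus> b \<otimes> (r \<otimes> s)" "v \<otimes> s = c \<otimes> (r \<otimes> s)"
        using cA b c uv(2) by (simp_all add: l_distr m_assoc)
      then show ?thesis using e uv(2) right_idealD(4)[OF A] by blast
    qed
    show "v = \<zero>" if "(\<zero>, v) \<in> ?S" for v
    proof -
      from that obtain a r where e: "a \<in> A" "r \<in> carrier R" "\<zero> = a \<oplus> b \<otimes> r" "v = c \<otimes> r" by auto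
      then have "b \<otimes> r = \<ominus> a" using cA b minus_equality[of "b \<otimes> r" a] by (simp add: a_comm)
      then show ?thesis using zero[OF e(2)] e right_ideal_minus[OF A] by simp
    qed
  qed (rule that)
  have "d \<otimes> a = \<zero>" if a: "a \<in> A" for a
  proof -
    have "(a \<oplus> b \<otimes> \<zero>, c \<otimes> \<zero>) \<in> ?S" using a by blast
    then have "c \<otimes> \<zero> = d \<otimes> (a \<oplus> b \<otimes> \<zero>)" by (rule d(2))
    then show ?thesis using b c cA[OF a] by simp
  qed
  moreover have "(\<zero> \<oplus> b \<otimes> \<one>, c \<otimes> \<one>) \<in> ?S" using right_idealD(2)[OF A] by blast
  then have "c \<otimes> \<one> = d \<otimes> (\<zero> \<oplus> b \<otimes> \<one>)" by (rule d(2))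
  then have "d \<otimes> b = c" using b c by simp
  ultimately show thesis using that d(1) by blast
qed

lemma right_baer_principal:
  assumes baer: "right_baer R" and a: "a \<in> carrier R" and y: "y \<in> carrier R"
    and sub: "rann R {a} \<subseteq> rann R {y}"
  obtains c where "c \<in> carrier R" "y = c \<otimes> a"
proof -
  have "y \<otimes> r = \<zero>" if "r \<in> carrier R" "a \<otimes> r \<in> {\<zero>}" for r
    using that sub by (auto simp: rann_def)
  then obtain c where "c \<in> carrier R" "c \<otimes> a = y"
    by (rule right_baer_extension[OF baer right_ideal_zero a y]) blast
  then show thesis using that by blast
qed

text \<open>
  If \<open>x\<close> kills \<open>A \<inter> B\<close>, then \<open>a + b \<mapsto> x a\<close> is well defined on \<open>A + B\<close>, hence left multiplication by some \<open>c\<close>. So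
  \<open>x - c\<close> kills \<open>A\<close> and \<open>c\<close> kills \<open>B\<close>.
\<close>

lemma right_baer_lann_Int:
  assumes baer: "right_baer R" and A: "right_ideal R A" and B: "right_ideal R B"
    and x: "x \<in> lann R (A \<inter> B)"
  obtains u v where "u \<in> lann R A" "v \<in> lann R B" "x = u \<oplus> v"
proof -
  note cA = right_idealD(5)[OF A] and cB = right_idealD(5)[OF B]
  have xc: "x \<in> carrier R" using x by (simp add: lann_def)
  let ?S = "{(a \<oplus> b, x \<otimes> a) | a b. a \<in> A \<and> b \<in> B}"
  obtain c where c: "c \<in> carrier R" "\<And>u v. (u, v) \<in> ?S \<Longrightarrow> v = c \<otimes> u"
  proof (rule right_baer_relation[OF baer, of ?S])
    show "?S \<subseteq> carrier R \<times> carrier R" using cA cB xc by auto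
    show "(\<zero>, \<zero>) \<in> ?S" using right_idealD(2)[OF A] right_idealD(2)[OF B] xc
      by (auto intro!: exI[of _ \<zero>])
    show "(u \<oplus> u', v \<oplus> v') \<in> ?S" if uv: "(u, v) \<in> ?S" "(u', v') \<in> ?S" for u v u' v'
    proof -
      from uv obtain a b a' b' where e: "a \<in> A" "a' \<in> A" "b \<in> B" "b' \<in> B"
        "u = a \<oplus> b" "v = x \<otimes> a" "u' = a' \<oplus> b'" "v' = x \<otimes> a'" by auto
      then have "u \<oplus> u' = (a \<oplus> a') \<oplus> (b \<oplus> b')" "v \<oplus> v' = x \<otimes> (a \<oplus> a')"
        using cA cB xc by (simp_all add: a_ac r_distr)
      then show ?thesis using e right_idealD(3)[OF A] right_idealD(3)[OF B] by blast
    qed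
    show "(u \<otimes> r, v \<otimes> r) \<in> ?S" if uv: "(u, v) \<in> ?S" "r \<in> carrier R" for u v r
    proof -
      from uv obtain a b where e: "a \<in> A" "b \<in> B" "u = a \<oplus> b" "v = x \<otimes> a" by auto
      then have "u \<otimes> r = a \<otimes> r \<oplus> b \<otimes> r" "v \<otimes> r = x \<otimes> (a \<otimes> r)"
        using cA cB xc uv(2) by (simp_all add: l_distr m_assoc)
      then show ?thesis using e uv(2) right_idealD(4)[OF A] right_idealD(4)[OF B] by blast
    qed
    show "v = \<zero>" if "(\<zero>, v) \<in> ?S" for v
    proof -
      from that obtain a b where e: "a \<in> A" "b \<in> B" "\<zero> = a \<oplus> b" "v = x \<otimes> a" by auto
      then have "a = \<ominus> b" using cA cB minus_equality by metis
      then have "a \<in> A \<inter> B" using e right_ideal_minus[OF B] by simp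
      then show ?thesis using x e by (simp add: lann_def)
    qed
  qed (rule that)
  have "c \<otimes> b = \<zero>" if b: "b \<in> B" for b
  proof -
    have "(\<zero> \<oplus> b, x \<otimes> \<zero>) \<in> ?S" using b right_idealD(2)[OF A] by blast
    then have "x \<otimes> \<zero> = c \<otimes> (\<zero> \<oplus> b)" by (rule c(2))
    then show ?thesis using xc cB[OF b] by simp
  qed
  then have "c \<in> lann R B" using c by (simp add: lann_def)
  moreover have "x \<otimes> a = c \<otimes> a" if a: "a \<in> A" for a
  proof -
    have "(a \<oplus> \<zero>, x \<otimes> a) \<in> ?S" using a right_idealD(2)[OF B] by blast
    then have "x \<otimes> a = c \<otimes> (a \<oplus> \<zero>)" by (rule c(2))
    then show ?thesis using cA[OF a] by simp
  qed
  then have "x \<ominus> c \<in> lann R A" using c(1) xc cA by (auto simp: lann_def a_minus_def l_distr l_minus r_neg)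
  moreover have "x = (x \<ominus> c) \<oplus> c" using xc c(1) by (simp add: a_minus_def a_assoc l_neg)
  ultimately show thesis using that by blast
qed

text \<open>
  Let \<open>K\<close> be a right ideal maximal with \<open>K \<inter> r(a) = 0\<close>. Left multiplication by \<open>a\<close> is injective on \<open>K\<close>, and its
  inverse \<open>a K \<rightarrow> K\<close> is left multiplication by some \<open>b\<close>. Then \<open>a - a b a\<close> kills \<open>K + r(a)\<close>, which is essential by the
  maximality of \<open>K\<close>.
\<close>

lemma right_baer_regular:
  assumes baer: "right_baer R" and a: "a \<in> carrier R"
  shows "\<exists>b\<in>carrier R. a \<ominus> a \<otimes> b \<otimes> a \<in> right_singular R"
proof -
  let ?L = "rann R {a}"
  have L: "right_ideal R ?L" using right_ideal_rann[of "{a}"] a by simp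
  obtain K where K: "right_ideal R K" "K \<inter> (?L - {\<zero>}) = {}"
    "\<And>E. right_ideal R E \<Longrightarrow> K \<subseteq> E \<Longrightarrow> E \<inter> (?L - {\<zero>}) = {} \<Longrightarrow> E = K"
    by (rule maximal_right_ideal_avoiding[OF right_ideal_zero, of "?L - {\<zero>}"]) auto
  note cK = right_idealD(5)[OF K(1)]
  let ?S = "{(a \<otimes> k, k) | k. k \<in> K}"
  obtain b where b: "b \<in> carrier R" "\<And>u v. (u, v) \<in> ?S \<Longrightarrow> v = b \<otimes> u"
  proof (rule right_baer_relation[OF baer, of ?S])
    show "?S \<subseteq> carrier R \<times> carrier R" using cK a by auto
    show "(\<zero>, \<zero>) \<in> ?S" using right_idealD(2)[OF K(1)] a by (auto intro!: exI[of _ \<zero>])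
    show "(u \<oplus> u', v \<oplus> v') \<in> ?S" if "(u, v) \<in> ?S" "(u', v') \<in> ?S" for u v u' v'
      using that right_idealD(3)[OF K(1)] cK a by (auto simp: r_distr)
    show "(u \<otimes> r, v \<otimes> r) \<in> ?S" if "(u, v) \<in> ?S" "r \<in> carrier R" for u v r
      using that right_idealD(4)[OF K(1)] cK a by (auto simp: m_assoc)
    show "v = \<zero>" if "(\<zero>, v) \<in> ?S" for v
    proof -
      have v: "v \<in> K" "a \<otimes> v = \<zero>" using that by auto
      then have "v \<in> ?L" using cK by (auto simp: rann_def)
      then show ?thesis using v K(2) by blast
    qed
  qed (rule that)
  have bk: "b \<otimes> (a \<otimes> k) = k" if "k \<in> K" for k
    using that b(2)[of "a \<otimes> k" k] by auto
  let ?d = "a \<ominus> a \<otimes> b \<otimes> a"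
  have dk: "?d \<otimes> y = \<zero>" if y: "y \<in> K <+>\<^bsub>R\<^esub> ?L" for y
  proof -
    obtain k l where kl: "k \<in> K" "l \<in> ?L" "y = k \<oplus> l" using y by (auto simp: set_add_iff)
    then have c: "k \<in> carrier R" "l \<in> carrier R" "a \<otimes> l = \<zero>" using cK by (auto simp: rann_def)
    have "a \<otimes> b \<otimes> a \<otimes> k = a \<otimes> k" using bk[OF kl(1)] a b c by (simp add: m_assoc)
    moreover have "a \<otimes> b \<otimes> a \<otimes> l = \<zero>" using a b c by (simp add: m_assoc)
    ultimately have "?d \<otimes> k = \<zero>" "?d \<otimes> l = \<zero>" using a b c
      by (simp_all add: a_minus_def l_distr l_minus r_neg)
    then show ?thesis using a b c kl by (simp add: r_distr)
  qed
  have "\<exists>r\<in>carrier R. x \<otimes> r \<noteq> \<zero> \<and> ?d \<otimes> (x \<otimes> r) = \<zero>" if x: "x \<in> carrier R" "x \<noteq> \<zero>" for x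
  proof (rule ccontr)
    assume no: "\<not> ?thesis"
    have KL: "right_ideal R (K <+>\<^bsub>R\<^esub> ?L)" by (rule right_ideal_sum[OF K(1) L])
    let ?X = "(\<lambda>r. x \<otimes> r) ` carrier R"
    have X: "right_ideal R ?X" by (rule right_ideal_principal[OF x(1)])
    have "(K <+>\<^bsub>R\<^esub> ?X) \<inter> (?L - {\<zero>}) = {}"
    proof (rule ccontr)
      assume "(K <+>\<^bsub>R\<^esub> ?X) \<inter> (?L - {\<zero>}) \<noteq> {}"
      then obtain w where w: "w \<in> K <+>\<^bsub>R\<^esub> ?X" "w \<in> ?L" "w \<noteq> \<zero>" by blast
      from w(1) obtain k r where "k \<in> K" "r \<in> carrier R" "w = k \<oplus> x \<otimes> r"
        unfolding set_add_iff by blast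
      then have kr: "k \<in> K" "r \<in> carrier R" "k \<oplus> x \<otimes> r \<in> ?L" "k \<oplus> x \<otimes> r \<noteq> \<zero>"
        using w by auto
      have c: "k \<in> carrier R" "x \<otimes> r \<in> carrier R" using kr x cK by auto
      have "x \<otimes> r = \<ominus> k \<oplus> (k \<oplus> x \<otimes> r)" using c by (simp add: a_assoc[symmetric] l_neg)
      moreover have "\<ominus> k \<oplus> (k \<oplus> x \<otimes> r) \<in> K <+>\<^bsub>R\<^esub> ?L"
        using kr right_ideal_minus[OF K(1)] unfolding set_add_iff by blast
      ultimately have "?d \<otimes> (x \<otimes> r) = \<zero>" using dk by simp
      then have "x \<otimes> r = \<zero>" using no kr by blast
      then show False using kr c K(2) by auto
    qed
    then have "K <+>\<^bsub>R\<^esub> ?X = K"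
      using K(3)[OF right_ideal_sum[OF K(1) X] right_ideal_sum_upper(1)[OF K(1) X]] by blast
    then have "x \<in> K" using right_ideal_sum_upper(2)[OF K(1) X] principal_self[OF x(1)] by blast
    then have "x \<in> K <+>\<^bsub>R\<^esub> ?L" using right_ideal_sum_upper(1)[OF K(1) L] by blast
    then have "?d \<otimes> (x \<otimes> \<one>) = \<zero>" using dk x by simp
    then show False using no x by (metis one_closed r_one)
  qed
  then show ?thesis using b a by (intro bexI[of _ b]) (auto simp: right_singular_def)
qed

text \<open>
  The annihilators \<open>r(z)\<close> and \<open>r(\<one> - z)\<close> have zero intersection and \<open>r(z)\<close> is essential, so \<open>r(\<one> - z) = 0\<close> and
  \<open>\<one> - z\<close> has a left inverse \<open>d\<close>. Now \<open>d = \<one> + d z\<close> is of the same form and has a left inverse itself.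
\<close>

lemma right_baer_unit:
  assumes baer: "right_baer R" and z: "z \<in> right_singular R"
  obtains d where "d \<in> carrier R" "d \<otimes> (\<one> \<ominus> z) = \<one>" "(\<one> \<ominus> z) \<otimes> d = \<one>"
proof -
  have Zt: "right_ideal R (right_singular R)" "left_ideal R (right_singular R)"
    using two_sided_right_singular by (auto simp: two_sided_def)
  have left: "\<exists>d\<in>carrier R. d \<otimes> (\<one> \<ominus> w) = \<one>" if w: "w \<in> right_singular R" for w
  proof -
    have wc: "w \<in> carrier R" using w by (simp add: right_singular_def)
    have "rann R {\<one> \<ominus> w} \<subseteq> rann R {\<one>}"
    proof
      fix y assume "y \<in> rann R {\<one> \<ominus> w}"
      then have y: "y \<in> carrier R" "(\<one> \<ominus> w) \<otimes> y = \<zero>" by (auto simp: rann_def)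
      have wy: "w \<otimes> y = y" using y wc by (simp add: a_minus_def l_distr l_minus) (metis a_minus_def m_closed r_right_minus_eq)
      have "y = \<zero>"
      proof (rule ccontr)
        assume "y \<noteq> \<zero>"
        then obtain r where "r \<in> carrier R" "y \<otimes> r \<noteq> \<zero>" "w \<otimes> (y \<otimes> r) = \<zero>"
          using w y by (auto simp: right_singular_def)
        then show False using wy y wc by (simp add: m_assoc[symmetric])
      qed
      then show "y \<in> rann R {\<one>}" by (simp add: rann_def)
    qed
    then show ?thesis using right_baer_principal[OF baer, of "\<one> \<ominus> w" \<one>] wc by (metis minus_closed one_closed)
  qed
  have zc: "z \<in> carrier R" using z by (simp add: right_singular_def)
  obtain d where d: "d \<in> carrier R" "d \<otimes> (\<one> \<ominus> z) = \<one>" using left z by blast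
  have "d \<otimes> z \<in> right_singular R" using left_idealD(4)[OF Zt(2) z d(1)] .
  then have "\<ominus> (d \<otimes> z) \<in> right_singular R" by (rule right_ideal_minus[OF Zt(1)])
  then obtain e where e: "e \<in> carrier R" "e \<otimes> (\<one> \<ominus> \<ominus> (d \<otimes> z)) = \<one>" using left by blast
  have "d = \<one> \<oplus> d \<otimes> z"
  proof -
    have "d \<otimes> (\<one> \<ominus> z) \<oplus> d \<otimes> z = d" using d(1) zc by (simp add: a_minus_def r_distr r_minus a_assoc l_neg)
    then show ?thesis using d by simp
  qed
  then have "e \<otimes> d = \<one>" using e zc d by (simp add: a_minus_def)
  then have "e = \<one> \<ominus> z" using d e zc by (metis l_one m_assoc minus_closed one_closed r_one)
  then show thesis using that d \<open>e \<otimes> d = \<one>\<close> by blast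
qed

end

section \<open>Rings that are semisimple modulo a nilpotent ideal\<close>

text \<open>
  Every right ideal of \<open>R/Z\<close> has a left identity, hence is a direct summand: this is semisimplicity of \<open>R/Z\<close>,
  again expressed by elements of \<open>R\<close>.
\<close>

definition right_semisimple_mod :: "('a, 'r) ring_scheme \<Rightarrow> 'a set \<Rightarrow> bool" where
  "right_semisimple_mod R Z \<longleftrightarrow> (\<forall>T. right_ideal R T \<and> Z \<subseteq> T \<longrightarrow>
     (\<exists>e\<in>T. \<forall>t\<in>T. (\<one>\<^bsub>R\<^esub> \<ominus>\<^bsub>R\<^esub> e) \<otimes>\<^bsub>R\<^esub> t \<in> Z))"

lemma regular_mod_opposite:
  fixes R :: "('a, 'r) ring_scheme" (structure)
  assumes "ring R"
  shows "regular_mod (opposite_ring R) Z \<longleftrightarrow> regular_mod R Z"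
proof -
  interpret ring R by fact
  have "b \<in> carrier R \<Longrightarrow> a \<in> carrier R \<Longrightarrow> a \<otimes> (b \<otimes> a) = a \<otimes> b \<otimes> a" for a b by (simp add: m_assoc)
  then show ?thesis by (simp add: regular_mod_def cong: bex_cong ball_cong)
qed

context ring
begin

text \<open>
  How to improve an approximate left identity \<open>e\<close> of \<open>T\<close>: let \<open>u = (\<one> - e) t\<close>, choose \<open>b\<close> with \<open>u - u b u \<in> Z\<close> and put
  \<open>w = u b\<close>. The factor \<open>\<one> - w\<close> kills \<open>u\<close> modulo \<open>Z\<close> and preserves everything that \<open>\<one> - e\<close> already kills. Each chain
  condition below stops this process, through a different ideal attached to \<open>\<one> - e\<close>.
\<close>

lemma regular_step:
  assumes reg: "regular_mod R Z" and Z: "two_sided R Z" and T: "right_ideal R T"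
    and e: "e \<in> T" and t: "t \<in> T"
  obtains w e' s where "w \<in> carrier R" "e' \<in> T" "\<one> \<ominus> e' = (\<one> \<ominus> w) \<otimes> (\<one> \<ominus> e)"
    "s \<in> T" "w = (\<one> \<ominus> e) \<otimes> s" "(\<one> \<ominus> w) \<otimes> ((\<one> \<ominus> e) \<otimes> t) \<in> Z" "w \<otimes> (\<one> \<ominus> w) \<in> Z"
proof -
  have c: "e \<in> carrier R" "t \<in> carrier R" using e t right_idealD(5)[OF T] by auto
  have Zr: "right_ideal R Z" using Z by (simp add: two_sided_def)
  define u where "u = (\<one> \<ominus> e) \<otimes> t"
  have uc: "u \<in> carrier R" using c by (simp add: u_def)
  have uT: "u \<in> T"
  proof -
    have "u = t \<ominus> e \<otimes> t" using c by (simp add: u_def ring_expand)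
    then show ?thesis using right_ideal_diff[OF T t] right_idealD(4)[OF T e] c by simp
  qed
  obtain b where b: "b \<in> carrier R" "u \<ominus> u \<otimes> b \<otimes> u \<in> Z"
    using reg uc unfolding regular_mod_def by blast
  define w where "w = u \<otimes> b"
  have wc: "w \<in> carrier R" using uc b by (simp add: w_def)
  have wT: "w \<in> T" unfolding w_def using right_idealD(4)[OF T uT] b by simp
  define e' where "e' = e \<oplus> w \<ominus> w \<otimes> e"
  have e'T: "e' \<in> T" unfolding e'_def
    using right_ideal_diff[OF T right_idealD(3)[OF T e wT] right_idealD(4)[OF T wT]] c by simp
  have e1: "\<one> \<ominus> e' = (\<one> \<ominus> w) \<otimes> (\<one> \<ominus> e)"
    using c wc by (simp add: e'_def ring_expand)
  have u1: "(\<one> \<ominus> w) \<otimes> u = u \<ominus> u \<otimes> b \<otimes> u" using uc b by (simp add: w_def ring_expand)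
  have w1: "w \<otimes> (\<one> \<ominus> w) = (u \<ominus> u \<otimes> b \<otimes> u) \<otimes> b" using uc b by (simp add: w_def ring_expand)
  have w2: "w = (\<one> \<ominus> e) \<otimes> (t \<otimes> b)" using c b by (simp add: w_def u_def m_assoc)
  show thesis
    using that[OF wc e'T e1 _ w2] right_idealD(4)[OF T t b(1)] b u1 w1 right_idealD(4)[OF Zr b(2) b(1)]
    by (simp add: u_def)
qed

text \<open>
  The right ideal of all \<open>r\<close> with \<open>(\<one> - e) r \<in> Z\<close> grows in each step, so \<open>e\<close> is chosen to make it maximal.
\<close>

lemma noetherian_right_semisimple_mod:
  assumes reg: "regular_mod R Z" and Z: "two_sided R Z" and noeth: "right_noetherian R"
  shows "right_semisimple_mod R Z"
  unfolding right_semisimple_mod_def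
proof (intro allI impI, elim conjE)
  fix T assume T: "right_ideal R T" "Z \<subseteq> T"
  have Zr: "right_ideal R Z" and Zl: "left_ideal R Z" using Z by (auto simp: two_sided_def)
  note cT = right_idealD(5)[OF T(1)]
  let ?P = "\<lambda>I. \<exists>e\<in>T. I = {r \<in> carrier R. (\<one> \<ominus> e) \<otimes> r \<in> Z}"
  have P0: "?P {r \<in> carrier R. (\<one> \<ominus> \<zero>) \<otimes> r \<in> Z}" using right_idealD(2)[OF T(1)] by blast
  have Pr: "right_ideal R I" if "?P I" for I
  proof -
    from that obtain e where "e \<in> T" "I = {r \<in> carrier R. (\<one> \<ominus> e) \<otimes> r \<in> Z}" by blast
    then show ?thesis using right_ideal_colon[OF Zr, of "\<one> \<ominus> e"] cT by simp
  qed
  obtain M where M: "?P M" "\<And>I. ?P I \<Longrightarrow> M \<subseteq> I \<Longrightarrow> I = M"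
    by (rule right_noetherian_maximal[OF ring_axioms noeth, of ?P, OF Pr P0]) simp_all
  from M(1) obtain e where e: "e \<in> T" "M = {r \<in> carrier R. (\<one> \<ominus> e) \<otimes> r \<in> Z}" by blast
  have "(\<one> \<ominus> e) \<otimes> t \<in> Z" if t: "t \<in> T" for t
  proof -
    obtain w e' where w: "w \<in> carrier R" "e' \<in> T" "\<one> \<ominus> e' = (\<one> \<ominus> w) \<otimes> (\<one> \<ominus> e)"
      "(\<one> \<ominus> w) \<otimes> ((\<one> \<ominus> e) \<otimes> t) \<in> Z"
      by (rule regular_step[OF reg Z T(1) e(1) t])
    let ?I = "{r \<in> carrier R. (\<one> \<ominus> e') \<otimes> r \<in> Z}"
    have "M \<subseteq> ?I"
    proof
      fix r assume "r \<in> M"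
      then have r: "r \<in> carrier R" "(\<one> \<ominus> e) \<otimes> r \<in> Z" using e by auto
      then have "(\<one> \<ominus> w) \<otimes> ((\<one> \<ominus> e) \<otimes> r) \<in> Z" using left_idealD(4)[OF Zl] w by simp
      then show "r \<in> ?I" using r w cT e by (simp add: m_assoc)
    qed
    moreover have "?P ?I" using w by blast
    ultimately have "?I = M" using M(2) by blast
    moreover have "t \<in> ?I" using w cT t e by (simp add: m_assoc)
    ultimately show ?thesis using e by blast
  qed
  then show "\<exists>e\<in>T. \<forall>t\<in>T. (\<one> \<ominus> e) \<otimes> t \<in> Z" using e by blast
qed

text \<open>
  The left ideal \<open>R (\<one> - e) + Z\<close> shrinks in each step, so \<open>e\<close> is chosen to make it minimal. If it does not shrink,
  then \<open>\<one> - e\<close> is a left multiple of \<open>\<one> - e'\<close> modulo \<open>Z\<close>, so it also sends \<open>t\<close> into \<open>Z\<close>.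
\<close>

lemma left_artinian_right_semisimple_mod:
  assumes reg: "regular_mod R Z" and Z: "two_sided R Z" and art: "left_artinian R"
  shows "right_semisimple_mod R Z"
  unfolding right_semisimple_mod_def
proof (intro allI impI, elim conjE)
  fix T assume T: "right_ideal R T" "Z \<subseteq> T"
  have Zr: "right_ideal R Z" and Zl: "left_ideal R Z" using Z by (auto simp: two_sided_def)
  note cT = right_idealD(5)[OF T(1)]
  interpret op: ring "opposite_ring R" by (rule ring_opposite_ring[OF ring_axioms])
  let ?I = "\<lambda>e. ((\<lambda>r. r \<otimes> (\<one> \<ominus> e)) ` carrier R) <+>\<^bsub>R\<^esub> Z"
  let ?P = "\<lambda>I. \<exists>e\<in>T. I = ?I e"
  have P0: "?P (?I \<zero>)" using right_idealD(2)[OF T(1)] by blast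
  have li: "left_ideal R ((\<lambda>r. r \<otimes> (\<one> \<ominus> e)) ` carrier R)" if "e \<in> T" for e
    using op.right_ideal_principal[of "\<one> \<ominus> e"] cT[OF that] by simp
  have Il: "left_ideal R (?I e)" if "e \<in> T" for e
    using op.right_ideal_sum[of "(\<lambda>r. r \<otimes> (\<one> \<ominus> e)) ` carrier R" Z] li[OF that] Zl by simp
  then have Pr: "right_ideal (opposite_ring R) I" if "?P I" for I
    using that by auto
  obtain M where M: "?P M" "\<And>I. ?P I \<Longrightarrow> I \<subseteq> M \<Longrightarrow> I = M"
    by (rule right_artinian_minimal[OF op.ring_axioms art[unfolded left_artinian_def], of ?P, OF Pr P0]) simp_all
  from M(1) obtain e where e: "e \<in> T" "M = ?I e" by blast
  have "(\<one> \<ominus> e) \<otimes> t \<in> Z" if t: "t \<in> T" for t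
  proof -
    obtain w e' where w: "w \<in> carrier R" "e' \<in> T" "\<one> \<ominus> e' = (\<one> \<ominus> w) \<otimes> (\<one> \<ominus> e)"
      "(\<one> \<ominus> w) \<otimes> ((\<one> \<ominus> e) \<otimes> t) \<in> Z"
      by (rule regular_step[OF reg Z T(1) e(1) t])
    have "?I e' \<subseteq> M"
    proof
      fix y assume "y \<in> ?I e'"
      then obtain r z where r: "r \<in> carrier R" "z \<in> Z" "y = r \<otimes> (\<one> \<ominus> e') \<oplus> z" by (auto simp: set_add_iff)
      then have "y = (r \<otimes> (\<one> \<ominus> w)) \<otimes> (\<one> \<ominus> e) \<oplus> z" using w cT[OF e(1)] by (simp add: m_assoc)
      then show "y \<in> M" unfolding e(2) using r w by (simp add: set_addI)
    qed
    moreover have "?P (?I e')" using w by blast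
    ultimately have "?I e' = M" using M(2) by blast
    moreover have "\<one> \<otimes> (\<one> \<ominus> e) \<oplus> \<zero> \<in> M" unfolding e(2) using right_idealD(2)[OF Zr] by (intro set_addI imageI) auto
    ultimately have "\<one> \<ominus> e \<in> ?I e'" using cT[OF e(1)] by simp
    then obtain r z where r: "r \<in> carrier R" "z \<in> Z" "\<one> \<ominus> e = r \<otimes> (\<one> \<ominus> e') \<oplus> z" by (auto simp: set_add_iff)
    have c: "e \<in> carrier R" "e' \<in> carrier R" "z \<in> carrier R" "t \<in> carrier R"
      using cT[OF e(1)] cT[OF w(2)] cT[OF t] right_idealD(5)[OF Zr r(2)] by auto
    have e't: "(\<one> \<ominus> e') \<otimes> t \<in> Z" using w c by (simp add: m_assoc)
    have "(\<one> \<ominus> e) \<otimes> t = r \<otimes> ((\<one> \<ominus> e') \<otimes> t) \<oplus> z \<otimes> t"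
      unfolding r(3) using c r(1) by (simp add: l_distr m_assoc)
    then show ?thesis
      using right_idealD(3)[OF Zr left_idealD(4)[OF Zl e't r(1)] right_idealD(4)[OF Zr r(2) c(4)]] by simp
  qed
  then show "\<exists>e\<in>T. \<forall>t\<in>T. (\<one> \<ominus> e) \<otimes> t \<in> Z" using e by blast
qed

lemma right_ideal_left_image:
  assumes x: "x \<in> carrier R" and T: "right_ideal R T"
  shows "right_ideal R ((\<lambda>t. x \<otimes> t) ` T)"
proof (rule right_idealI)
  note cT = right_idealD(5)[OF T]
  show "\<zero> \<in> (\<lambda>t. x \<otimes> t) ` T" using right_idealD(2)[OF T] x by (force intro: image_eqI[of _ _ \<zero>])
  show "u \<oplus> v \<in> (\<lambda>t. x \<otimes> t) ` T" if uv: "u \<in> (\<lambda>t. x \<otimes> t) ` T" "v \<in> (\<lambda>t. x \<otimes> t) ` T" for u v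
  proof -
    obtain s t where "s \<in> T" "t \<in> T" "u = x \<otimes> s" "v = x \<otimes> t" using uv by auto
    then show ?thesis using right_idealD(3)[OF T] cT x by (intro image_eqI[of _ _ "s \<oplus> t"]) (auto simp: r_distr)
  qed
  show "u \<otimes> r \<in> (\<lambda>t. x \<otimes> t) ` T" if u: "u \<in> (\<lambda>t. x \<otimes> t) ` T" "r \<in> carrier R" for u r
  proof -
    obtain s where "s \<in> T" "u = x \<otimes> s" using u by auto
    then show ?thesis using right_idealD(4)[OF T] cT x u(2) by (intro image_eqI[of _ _ "s \<otimes> r"]) (auto simp: m_assoc)
  qed
qed (use x right_idealD(5)[OF T] in auto)

text \<open>
  The right ideal \<open>(\<one> - e) T + Z\<close> shrinks in each step, so \<open>e\<close> is chosen to make it minimal. It really loses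
  \<open>u = (\<one> - e) t\<close>: modulo \<open>Z\<close>, left multiplication by \<open>w\<close> kills \<open>(\<one> - e') T\<close> but fixes \<open>u\<close>.
\<close>

lemma artinian_right_semisimple_mod:
  assumes reg: "regular_mod R Z" and Z: "two_sided R Z" and art: "right_artinian R"
  shows "right_semisimple_mod R Z"
  unfolding right_semisimple_mod_def
proof (intro allI impI, elim conjE)
  fix T assume T: "right_ideal R T" "Z \<subseteq> T"
  have Zr: "right_ideal R Z" and Zl: "left_ideal R Z" using Z by (auto simp: two_sided_def)
  note cT = right_idealD(5)[OF T(1)]
  let ?I = "\<lambda>e. ((\<lambda>t. (\<one> \<ominus> e) \<otimes> t) ` T) <+>\<^bsub>R\<^esub> Z"
  let ?P = "\<lambda>I. \<exists>e\<in>T. I = ?I e"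
  have P0: "?P (?I \<zero>)" using right_idealD(2)[OF T(1)] by blast
  have ri: "right_ideal R ((\<lambda>t. (\<one> \<ominus> e) \<otimes> t) ` T)" if "e \<in> T" for e
    using right_ideal_left_image[OF _ T(1)] cT[OF that] by simp
  then have Pr: "right_ideal R I" if "?P I" for I
    using that right_ideal_sum[OF _ Zr] by auto
  obtain M where M: "?P M" "\<And>I. ?P I \<Longrightarrow> I \<subseteq> M \<Longrightarrow> I = M"
    by (rule right_artinian_minimal[OF ring_axioms art, of ?P, OF Pr P0]) simp_all
  from M(1) obtain e where e: "e \<in> T" "M = ?I e" by blast
  have "(\<one> \<ominus> e) \<otimes> t \<in> Z" if t: "t \<in> T" for t
  proof -
    obtain w e' s where w: "w \<in> carrier R" "e' \<in> T" "\<one> \<ominus> e' = (\<one> \<ominus> w) \<otimes> (\<one> \<ominus> e)"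
      "s \<in> T" "w = (\<one> \<ominus> e) \<otimes> s"
      "(\<one> \<ominus> w) \<otimes> ((\<one> \<ominus> e) \<otimes> t) \<in> Z" "w \<otimes> (\<one> \<ominus> w) \<in> Z"
      by (rule regular_step[OF reg Z T(1) e(1) t])
    have c: "e \<in> carrier R" "e' \<in> carrier R" "t \<in> carrier R" "s \<in> carrier R"
      using cT[OF e(1)] cT[OF w(2)] cT[OF t] cT[OF w(4)] by auto
    have "?I e' \<subseteq> M"
    proof
      fix y assume "y \<in> ?I e'"
      then obtain r z where r: "r \<in> T" "z \<in> Z" "y = (\<one> \<ominus> e') \<otimes> r \<oplus> z" by (auto simp: set_add_iff)
      have rc: "r \<in> carrier R" using r cT by simp
      define q where "q = r \<ominus> s \<otimes> ((\<one> \<ominus> e) \<otimes> r)"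
      have "q \<in> T" unfolding q_def
        using right_ideal_diff[OF T(1) r(1) right_idealD(4)[OF T(1) w(4)]] c rc by simp
      moreover have "(\<one> \<ominus> e') \<otimes> r = (\<one> \<ominus> e) \<otimes> q"
      proof -
        have "(\<one> \<ominus> e') \<otimes> r = (\<one> \<ominus> e) \<otimes> r \<ominus> w \<otimes> ((\<one> \<ominus> e) \<otimes> r)"
          unfolding w(3) using c rc w(1) by (simp add: a_minus_def[of R \<one> w] m_assoc l_distr l_minus) (simp add: a_minus_def)
        also have "\<dots> = (\<one> \<ominus> e) \<otimes> q"
          unfolding q_def w(5) using c rc by (simp add: a_minus_def[of R r] m_assoc r_distr r_minus) (simp add: a_minus_def)
        finally show ?thesis .
      qed
      ultimately show "y \<in> M" unfolding e(2) r(3) using r(2) by (simp add: set_addI)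
    qed
    moreover have "?P (?I e')" using w by blast
    ultimately have "?I e' = M" using M(2) by blast
    moreover have "(\<one> \<ominus> e) \<otimes> t \<oplus> \<zero> \<in> M" unfolding e(2) using t right_idealD(2)[OF Zr] by (intro set_addI imageI)
    ultimately have "(\<one> \<ominus> e) \<otimes> t \<in> ?I e'" using c by simp
    then obtain r z where r: "r \<in> T" "z \<in> Z" "(\<one> \<ominus> e) \<otimes> t = (\<one> \<ominus> e') \<otimes> r \<oplus> z" by (auto simp: set_add_iff)
    have rc: "r \<in> carrier R" "z \<in> carrier R" using r cT right_idealD(5)[OF Zr] by auto
    have "w \<otimes> ((\<one> \<ominus> e) \<otimes> t) = (w \<otimes> (\<one> \<ominus> w)) \<otimes> ((\<one> \<ominus> e) \<otimes> r) \<oplus> w \<otimes> z"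
      unfolding r(3) w(3) using c rc w(1) by (simp add: r_distr m_assoc)
    moreover have "(w \<otimes> (\<one> \<ominus> w)) \<otimes> ((\<one> \<ominus> e) \<otimes> r) \<in> Z"
      using right_idealD(4)[OF Zr w(7)] c rc by simp
    ultimately have "w \<otimes> ((\<one> \<ominus> e) \<otimes> t) \<in> Z"
      using right_idealD(3)[OF Zr] left_idealD(4)[OF Zl r(2) w(1)] by simp
    moreover have "(\<one> \<ominus> w) \<otimes> ((\<one> \<ominus> e) \<otimes> t) \<oplus> w \<otimes> ((\<one> \<ominus> e) \<otimes> t) = (\<one> \<ominus> e) \<otimes> t"
      using c w(1) by (simp add: a_minus_def[of R \<one> w] l_distr l_minus a_assoc l_neg)
    ultimately show ?thesis using right_idealD(3)[OF Zr w(6)] by metis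
  qed
  then show "\<exists>e\<in>T. \<forall>t\<in>T. (\<one> \<ominus> e) \<otimes> t \<in> Z" using e by blast
qed

end

section \<open>Chain conditions modulo a nilpotent ideal\<close>

context ring
begin

text \<open>
  Otherwise every \<open>a \<in> A\<close> outside \<open>W\<close> could be multiplied by elements of \<open>Z\<close> without end and stay outside \<open>W\<close>.
\<close>

lemma nilpotent_annihilated_element:
  assumes Z: "two_sided R Z" and nil: "nilpotent R Z"
    and W: "right_ideal R W" and A: "right_ideal R A" and AW: "\<not> A \<subseteq> W"
  obtains a where "a \<in> A" "a \<notin> W" "\<And>z. z \<in> Z \<Longrightarrow> a \<otimes> z \<in> W"
proof (rule ccontr)
  note found = that
  assume no: "\<not> thesis"
  have up: "\<exists>z\<in>Z. a \<otimes> z \<notin> W" if a: "a \<in> A" "a \<notin> W" for a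
    using no a found[of a] by blast
  have Zc: "Z \<subseteq> carrier R" using Z by (auto simp: two_sided_def right_ideal_def)
  note cA = right_idealD(5)[OF A]
  have main: "a \<in> W" if "a \<in> A" "\<forall>p\<in>products R Z n. a \<otimes> p = \<zero>" for n a
    using that
  proof (induction n arbitrary: a)
    case 0
    then have "a \<otimes> \<one> = \<zero>" by (auto simp: products_def)
    then show ?case using cA 0 right_idealD(2)[OF W] by simp
  next
    case (Suc n)
    show ?case
    proof (rule ccontr)
      assume "a \<notin> W"
      then obtain z where z: "z \<in> Z" "a \<otimes> z \<notin> W" using up Suc.prems by blast
      have zc: "z \<in> carrier R" using z Zc by blast
      have "(a \<otimes> z) \<otimes> q = \<zero>" if q: "q \<in> products R Z n" for q
      proof -
        have "q \<in> carrier R" using products_carrier[OF Zc] q by blast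
        moreover have "a \<otimes> (z \<otimes> q) = \<zero>" using Suc.prems(2) products_Suc_left[OF z(1) q] by blast
        ultimately show ?thesis using zc cA[OF Suc.prems(1)] by (simp add: m_assoc)
      qed
      then have "a \<otimes> z \<in> W" using Suc.IH right_idealD(4)[OF A Suc.prems(1) zc] by blast
      then show False using z by blast
    qed
  qed
  obtain n where n: "products R Z n \<subseteq> {\<zero>}" using nil by (auto simp: nilpotent_def)
  have "A \<subseteq> W"
  proof
    fix a assume a: "a \<in> A"
    have "\<forall>p\<in>products R Z n. a \<otimes> p = \<zero>" using n cA[OF a] by auto
    then show "a \<in> W" using main a by blast
  qed
  then show False using AW by blast
qed

text \<open>
  Take \<open>a \<in> A\<close> outside \<open>W\<close> with \<open>a Z \<subseteq> W\<close>, a maximal right ideal \<open>M\<close> containing all \<open>r\<close> with \<open>a r \<in> W\<close>, and a left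
  identity \<open>e\<close> of \<open>M\<close> modulo \<open>Z\<close>. Then \<open>a (\<one> - e)\<close> is outside \<open>W\<close> and \<open>a (\<one> - e) M \<subseteq> W\<close>. The conclusion
  says that this element generates a simple submodule of \<open>A + W\<close> modulo \<open>W\<close>.
\<close>

lemma simple_over_right_ideal:
  assumes ss: "right_semisimple_mod R Z" and Z: "two_sided R Z" and nil: "nilpotent R Z"
    and W: "right_ideal R W" and A: "right_ideal R A" and AW: "\<not> A \<subseteq> W"
  obtains a where "a \<in> A" "a \<notin> W"
    "\<And>r. r \<in> carrier R \<Longrightarrow> a \<otimes> r \<notin> W \<Longrightarrow> \<exists>s\<in>carrier R. a \<ominus> a \<otimes> r \<otimes> s \<in> W"
proof -
  obtain a where a: "a \<in> A" "a \<notin> W" "\<And>z. z \<in> Z \<Longrightarrow> a \<otimes> z \<in> W"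
    by (rule nilpotent_annihilated_element[OF Z nil W A AW]) blast
  have ac: "a \<in> carrier R" by (rule right_idealD(5)[OF A a(1)])
  have Zc: "Z \<subseteq> carrier R" using Z by (auto simp: two_sided_def right_ideal_def)
  let ?T = "{r \<in> carrier R. a \<otimes> r \<in> W}"
  have T: "right_ideal R ?T" by (rule right_ideal_colon[OF W ac])
  have "?T \<inter> {\<one>} = {}" using a ac by auto
  then obtain M where M: "right_ideal R M" "?T \<subseteq> M" "M \<inter> {\<one>} = {}"
    "\<And>E. right_ideal R E \<Longrightarrow> M \<subseteq> E \<Longrightarrow> E \<inter> {\<one>} = {} \<Longrightarrow> E = M"
    by (rule maximal_right_ideal_avoiding[OF T]) blast
  have "Z \<subseteq> M" using a(3) Zc M(2) by blast
  then obtain e where e: "e \<in> M" "\<And>m. m \<in> M \<Longrightarrow> (\<one> \<ominus> e) \<otimes> m \<in> Z"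
    using ss M(1) unfolding right_semisimple_mod_def by blast
  note cM = right_idealD(5)[OF M(1)]
  have ec: "e \<in> carrier R" using cM e by blast
  let ?a = "a \<otimes> (\<one> \<ominus> e)"
  have "?a \<in> A" using right_idealD(4)[OF A a(1)] ec by simp
  moreover have "?a \<notin> W"
  proof
    assume "?a \<in> W"
    then have "\<one> \<ominus> e \<in> M" using M(2) ec by auto
    then have "\<one> \<in> M" using right_ideal_cancel[OF M(1) _ e(1)] by simp
    then show False using M(3) by blast
  qed
  moreover have "\<exists>s\<in>carrier R. ?a \<ominus> ?a \<otimes> r \<otimes> s \<in> W" if r: "r \<in> carrier R" "?a \<otimes> r \<notin> W" for r
  proof -
    have aM: "?a \<otimes> m \<in> W" if "m \<in> M" for m
      using a(3)[OF e(2)[OF that]] ac ec cM[OF that] by (simp add: m_assoc)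
    let ?X = "(\<lambda>s. r \<otimes> s) ` carrier R"
    have X: "right_ideal R ?X" by (rule right_ideal_principal[OF r(1)])
    have "\<one> \<in> M <+>\<^bsub>R\<^esub> ?X"
    proof (rule ccontr)
      assume "\<one> \<notin> M <+>\<^bsub>R\<^esub> ?X"
      then have "M <+>\<^bsub>R\<^esub> ?X = M"
        using M(4)[OF right_ideal_sum[OF M(1) X] right_ideal_sum_upper(1)[OF M(1) X]] by blast
      then have "r \<in> M" using right_ideal_sum_upper(2)[OF M(1) X] principal_self[OF r(1)] by blast
      then show False using aM r by blast
    qed
    then obtain m s where ms: "m \<in> M" "s \<in> carrier R" "\<one> = m \<oplus> r \<otimes> s" by (auto simp: set_add_iff)
    have "?a = ?a \<otimes> (m \<oplus> r \<otimes> s)" using ms(3)[symmetric] ac ec by simp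
    also have "\<dots> = ?a \<otimes> m \<oplus> ?a \<otimes> r \<otimes> s"
      using ac ec cM[OF ms(1)] ms(2) r(1) by (simp add: r_distr m_assoc)
    finally have "?a \<ominus> ?a \<otimes> r \<otimes> s = ?a \<otimes> m \<oplus> ?a \<otimes> r \<otimes> s \<ominus> ?a \<otimes> r \<otimes> s" by simp
    also have "\<dots> = ?a \<otimes> m" using ac ec cM[OF ms(1)] ms(2) r(1) by (simp add: a_minus_def a_assoc r_neg)
    finally have "?a \<ominus> ?a \<otimes> r \<otimes> s \<in> W" using aM[OF ms(1)] by simp
    then show ?thesis using ms by blast
  qed
  ultimately show thesis by (rule that)
qed

text \<open>
  By nilpotence \<open>W Z \<noteq> W\<close>, so some \<open>x \<in> W\<close> lies outside a right ideal that contains \<open>W Z\<close>. Among the right subideals of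
  \<open>W\<close> that contain \<open>W Z\<close> and avoid \<open>x\<close>, a maximal one \<open>C\<close> will do: since \<open>W / W Z\<close> is semisimple, any \<open>B\<close>
  strictly between \<open>C\<close> and \<open>W\<close> would leave room for a right ideal larger than \<open>C\<close> that meets \<open>B\<close> in \<open>C\<close> only,
  although both contain \<open>x\<close> by the choice of \<open>C\<close>.
\<close>

lemma maximal_right_subideal:
  assumes ss: "right_semisimple_mod R Z" and Z: "two_sided R Z" and nil: "nilpotent R Z"
    and W: "right_ideal R W" and W0: "W \<noteq> {\<zero>}"
  obtains C where "right_ideal R C" "C \<subset> W"
    "\<And>B. right_ideal R B \<Longrightarrow> C \<subseteq> B \<Longrightarrow> B \<subseteq> W \<Longrightarrow> B = C \<or> B = W"
proof -
  have Zc: "Z \<subseteq> carrier R" and Zr: "right_ideal R Z" using Z by (auto simp: two_sided_def right_ideal_def)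
  note cW = right_idealD(5)[OF W]
  have "\<exists>C. right_ideal R C \<and> (\<forall>w\<in>W. \<forall>z\<in>Z. w \<otimes> z \<in> C) \<and> \<not> W \<subseteq> C"
  proof (rule ccontr)
    assume no: "\<not> ?thesis"
    \<comment> \<open>If every right ideal containing \<open>W Z\<close> contains \<open>W\<close>, then \<open>W\<close> kills the right annihilators of all powers of \<open>Z\<close>. The factor \<open>r\<close> makes the condition on \<open>w\<close> define a right ideal.\<close>
    have main: "\<forall>w\<in>W. \<forall>r\<in>carrier R. \<forall>y\<in>rann R (products R Z n). w \<otimes> r \<otimes> y = \<zero>" for n
    proof (induction n)
      case 0
      then show ?case using cW by (auto simp: products_def rann_def)
    next
      case (Suc n)
      let ?Y = "rann R (products R Z (Suc n))"
      let ?C = "{x \<in> carrier R. \<forall>r\<in>carrier R. \<forall>y\<in>?Y. x \<otimes> r \<otimes> y = \<zero>}"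
      have yc: "y \<in> ?Y \<Longrightarrow> y \<in> carrier R" for y by (simp add: rann_def)
      have C: "right_ideal R ?C"
      proof (rule right_idealI)
        show "x \<otimes> s \<in> ?C" if "x \<in> ?C" "s \<in> carrier R" for x s
          using that by (auto simp: m_assoc yc) (metis m_assoc m_closed yc)
      qed (auto simp: l_distr yc)
      have "w \<otimes> z \<in> ?C" if wz: "w \<in> W" "z \<in> Z" for w z
      proof -
        have c: "w \<in> carrier R" "z \<in> carrier R" using wz cW Zc by auto
        have "(w \<otimes> z) \<otimes> r \<otimes> y = \<zero>" if ry: "r \<in> carrier R" "y \<in> ?Y" for r y
        proof -
          have ycc: "y \<in> carrier R" by (rule yc[OF ry(2)])
          have zr: "z \<otimes> r \<in> Z" using right_idealD(4)[OF Zr wz(2) ry(1)] .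
          have "z \<otimes> r \<otimes> y \<in> rann R (products R Z n)"
          proof -
            have "q \<otimes> (z \<otimes> r \<otimes> y) = \<zero>" if q: "q \<in> products R Z n" for q
            proof -
              have "q \<in> carrier R" using q products_carrier[OF Zc] by blast
              moreover have "q \<otimes> (z \<otimes> r) \<otimes> y = \<zero>"
                using products_Suc_right[OF Zc zr q] ry(2) by (simp add: rann_def)
              ultimately show ?thesis using c(2) ry(1) ycc by (simp add: m_assoc)
            qed
            then show ?thesis using c(2) ry(1) ycc by (simp add: rann_def)
          qed
          then have "w \<otimes> \<one> \<otimes> (z \<otimes> r \<otimes> y) = \<zero>" using Suc.IH wz(1) by blast
          then show ?thesis using c ry(1) ycc by (simp add: m_assoc)
        qed
        then show ?thesis using c by simp
      qed
      then have "W \<subseteq> ?C" using no C by blast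
      then show ?case by blast
    qed
    obtain n where n: "products R Z n \<subseteq> {\<zero>}" using nil by (auto simp: nilpotent_def)
    have "\<one> \<in> rann R (products R Z n)" using n by (auto simp: rann_def)
    then have "w \<otimes> \<one> \<otimes> \<one> = \<zero>" if "w \<in> W" for w
      using main[of n] that one_closed by blast
    moreover have "w \<otimes> \<one> \<otimes> \<one> = w" if "w \<in> W" for w using cW[OF that] by simp
    ultimately have "w = \<zero>" if "w \<in> W" for w using that by metis
    then show False using W0 right_idealD(2)[OF W] by blast
  qed
  then obtain C0 x where C0: "right_ideal R C0" "\<And>w z. w \<in> W \<Longrightarrow> z \<in> Z \<Longrightarrow> w \<otimes> z \<in> C0"
    and x: "x \<in> W" "x \<notin> C0" by blast
  \<comment> \<open>Avoiding the complement of \<open>W\<close> as well keeps the maximal right ideal inside \<open>W\<close>.\<close>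
  let ?A = "insert x (- W)"
  have "(C0 \<inter> W) \<inter> ?A = {}" using x by blast
  then obtain C where C: "right_ideal R C" "C0 \<inter> W \<subseteq> C" "C \<inter> ?A = {}"
    "\<And>E. right_ideal R E \<Longrightarrow> C \<subseteq> E \<Longrightarrow> E \<inter> ?A = {} \<Longrightarrow> E = C"
    by (rule maximal_right_ideal_avoiding[OF right_ideal_Int[OF C0(1) W]]) blast
  have xC: "x \<notin> C" and CW: "C \<subseteq> W" using C(3) by auto
  have WZ: "w \<otimes> z \<in> C" if "w \<in> W" "z \<in> Z" for w z
    using C0(2)[OF that] right_idealD(4)[OF W] that Zc C(2) by blast
  have "B = C \<or> B = W" if B: "right_ideal R B" "C \<subseteq> B" "B \<subseteq> W" for B
  proof (rule ccontr)
    assume no: "\<not> ?thesis"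
    then have xB: "x \<in> B" using C(4)[OF B(1,2)] B(3) by blast
    obtain y where y: "y \<in> W" "y \<notin> B" using no B(3) by blast
    have yc: "y \<in> carrier R" using cW y by blast
    let ?T = "{r \<in> carrier R. y \<otimes> r \<in> B}"
    have T: "right_ideal R ?T" by (rule right_ideal_colon[OF B(1) yc])
    have "Z \<subseteq> ?T" using WZ[OF y(1)] Zc B(2) by blast
    then obtain e where e: "e \<in> ?T" "\<And>t. t \<in> ?T \<Longrightarrow> (\<one> \<ominus> e) \<otimes> t \<in> Z"
      using ss T unfolding right_semisimple_mod_def by blast
    have ec: "e \<in> carrier R" using e by simp
    let ?y = "y \<otimes> (\<one> \<ominus> e)"
    have yW: "?y \<in> W" using right_idealD(4)[OF W y(1)] ec by simp
    have yB: "?y \<notin> B"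
    proof
      assume "?y \<in> B"
      moreover have "?y = y \<ominus> y \<otimes> e" using yc ec by (simp add: a_minus_def r_distr r_minus)
      ultimately have "y \<in> B" using right_ideal_cancel[OF B(1), of y "y \<otimes> e"] e(1) yc by simp
      then show False using y by blast
    qed
    let ?Y = "(\<lambda>r. ?y \<otimes> r) ` carrier R"
    have Y: "right_ideal R ?Y" using right_ideal_principal[of ?y] yc ec by simp
    have D: "right_ideal R (C <+>\<^bsub>R\<^esub> ?Y)" by (rule right_ideal_sum[OF C(1) Y])
    have "?Y \<subseteq> W" using right_idealD(4)[OF W yW] by blast
    then have DW: "C <+>\<^bsub>R\<^esub> ?Y \<subseteq> W" using right_ideal_sum_least[OF W CW] by blast
    have "?y \<in> C <+>\<^bsub>R\<^esub> ?Y"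
      using right_ideal_sum_upper(2)[OF C(1) Y] principal_self[of ?y] yc ec by auto
    then have "C <+>\<^bsub>R\<^esub> ?Y \<noteq> C" using yB B(2) by blast
    then have "x \<in> C <+>\<^bsub>R\<^esub> ?Y"
      using C(4)[OF D right_ideal_sum_upper(1)[OF C(1) Y]] DW by blast
    then obtain c r where cr: "c \<in> C" "r \<in> carrier R" "x = c \<oplus> ?y \<otimes> r" by (auto simp: set_add_iff)
    have cc: "c \<in> carrier R" using right_idealD(5)[OF C(1) cr(1)] .
    have "x \<ominus> c = ?y \<otimes> r" using cr(2,3) cc yc ec
      by (simp add: a_minus_def a_comm[of c] a_assoc r_neg)
    then have "?y \<otimes> r \<in> B" using right_ideal_diff[OF B(1) xB] cr(1) B(2) by (metis subsetD)
    then have "(\<one> \<ominus> e) \<otimes> r \<in> ?T" using yc ec cr(2) by (simp add: m_assoc)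
    then have 1: "(\<one> \<ominus> e) \<otimes> ((\<one> \<ominus> e) \<otimes> r) \<in> Z" by (rule e(2))
    have "(\<one> \<ominus> e) \<otimes> e \<in> Z" using e by blast
    then have 2: "(\<one> \<ominus> e) \<otimes> e \<otimes> r \<in> Z" using right_idealD(4)[OF Zr _ cr(2)] by blast
    have "(\<one> \<ominus> e) \<otimes> ((\<one> \<ominus> e) \<otimes> r) \<oplus> (\<one> \<ominus> e) \<otimes> e \<otimes> r = (\<one> \<ominus> e) \<otimes> ((\<one> \<ominus> e \<oplus> e) \<otimes> r)"
      using ec cr(2) by (simp add: m_assoc r_distr l_distr)
    also have "\<dots> = (\<one> \<ominus> e) \<otimes> r" using ec cr(2) by (simp add: a_minus_def a_assoc l_neg)
    finally have "(\<one> \<ominus> e) \<otimes> r \<in> Z" using right_idealD(3)[OF Zr 1 2] by simp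
    then have "?y \<otimes> r \<in> C" using WZ[OF y(1)] yc ec cr(2) by (simp add: m_assoc)
    then have "x \<in> C" using cr right_idealD(3)[OF C(1)] by simp
    then show False using xC by blast
  qed
  moreover have "C \<subset> W" using CW xC x by blast
  ultimately show thesis using that C(1) by blast
qed

text \<open>
  Let \<open>M\<close> be maximal among the right ideals below which the descending chain condition holds. If \<open>M \<noteq> R\<close>, a simple
  submodule of \<open>R/M\<close> enlarges \<open>M\<close> by one step, and the chain condition survives the step.
\<close>

theorem noetherian_imp_artinian:
  assumes ss: "right_semisimple_mod R Z" and Z: "two_sided R Z" and nil: "nilpotent R Z"
    and noeth: "right_noetherian R"
  shows "right_artinian R"
proof -
  let ?dcc = "\<lambda>W. \<forall>I::nat \<Rightarrow> 'a set. (\<forall>n. right_ideal R (I n) \<and> I (Suc n) \<subseteq> I n \<and> I n \<subseteq> W) \<longrightarrow> (\<exists>n. \<forall>m\<ge>n. I m = I n)"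
  let ?P = "\<lambda>W. right_ideal R W \<and> ?dcc W"
  have P0: "?P {\<zero>}"
  proof (intro conjI allI impI right_ideal_zero)
    fix I :: "nat \<Rightarrow> 'a set"
    assume I: "\<forall>n. right_ideal R (I n) \<and> I (Suc n) \<subseteq> I n \<and> I n \<subseteq> {\<zero>}"
    then have "I n = {\<zero>}" for n using right_idealD(2)[of R "I n"] by blast
    then show "\<exists>n. \<forall>m\<ge>n. I m = I n" by simp
  qed
  have Pr: "right_ideal R W" if "?P W" for W using that by blast
  obtain M where M: "?P M" "\<And>I. ?P I \<Longrightarrow> M \<subseteq> I \<Longrightarrow> I = M"
    by (rule right_noetherian_maximal[OF ring_axioms noeth, of ?P, OF Pr P0]) simp_all
  then have Mr: "right_ideal R M" and Mdcc: "?dcc M" by auto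
  have "M = carrier R"
  proof (rule ccontr)
    assume "M \<noteq> carrier R"
    then have "\<not> carrier R \<subseteq> M" using right_idealD(1)[OF Mr] by blast
    then obtain a where a: "a \<in> carrier R" "a \<notin> M"
      "\<And>r. r \<in> carrier R \<Longrightarrow> a \<otimes> r \<notin> M \<Longrightarrow> \<exists>s\<in>carrier R. a \<ominus> a \<otimes> r \<otimes> s \<in> M"
      by (rule simple_over_right_ideal[OF ss Z nil Mr right_ideal_carrier]) blast
    let ?X = "(\<lambda>r. a \<otimes> r) ` carrier R"
    have X: "right_ideal R ?X" by (rule right_ideal_principal[OF a(1)])
    let ?W = "M <+>\<^bsub>R\<^esub> ?X"
    have W: "right_ideal R ?W" by (rule right_ideal_sum[OF Mr X])
    have between: "B = M \<or> B = ?W" if B: "right_ideal R B" "M \<subseteq> B" "B \<subseteq> ?W" for B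
    proof (rule ccontr)
      assume no: "\<not> ?thesis"
      then obtain b where b: "b \<in> B" "b \<notin> M" using B by blast
      obtain m r where mr: "m \<in> M" "r \<in> carrier R" "b = m \<oplus> a \<otimes> r"
        using subsetD[OF B(3) b(1)] by (auto simp: set_add_iff)
      have mc: "m \<in> carrier R" using right_idealD(5)[OF Mr mr(1)] .
      have ar: "a \<otimes> r \<notin> M" using b mr right_idealD(3)[OF Mr] by blast
      have "b \<ominus> m = a \<otimes> r" using mr mc a(1)
        by (simp add: a_minus_def a_comm[of m] a_assoc r_neg)
      then have arB: "a \<otimes> r \<in> B" using right_ideal_diff[OF B(1) b(1)] mr(1) B(2) by (metis subsetD)
      obtain s where s: "s \<in> carrier R" "a \<ominus> a \<otimes> r \<otimes> s \<in> M" using a(3)[OF mr(2) ar] by blast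
      have "a \<in> B"
        using right_ideal_cancel[OF B(1), of a "a \<otimes> r \<otimes> s"] s B(2) right_idealD(4)[OF B(1) arB s(1)] a(1) by blast
      then have "?X \<subseteq> B" using right_idealD(4)[OF B(1)] by blast
      then show False using no right_ideal_sum_least[OF B(1,2)] B(3) by blast
    qed
    have "?dcc ?W"
    proof (intro allI impI)
      fix I :: "nat \<Rightarrow> 'a set"
      assume I: "\<forall>n. right_ideal R (I n) \<and> I (Suc n) \<subseteq> I n \<and> I n \<subseteq> ?W"
      then have Ir: "\<And>n. right_ideal R (I n)" and Id: "\<And>n. I (Suc n) \<subseteq> I n" and IW: "\<And>n. I n \<subseteq> ?W" by auto
      have anti: "I m \<subseteq> I n" if "n \<le> m" for n m using lift_Suc_antimono_le[of I, OF Id that] .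
      have Int: "\<exists>n. \<forall>m\<ge>n. I m \<inter> M = I n \<inter> M"
        using Mdcc[THEN spec[of _ "\<lambda>n. I n \<inter> M"]] right_ideal_Int[OF Ir Mr] Id by blast
      have or: "I n <+>\<^bsub>R\<^esub> M = M \<or> I n <+>\<^bsub>R\<^esub> M = ?W" for n
        using between[OF right_ideal_sum[OF Ir Mr] right_ideal_sum_upper(2)[OF Ir Mr]]
          right_ideal_sum_least[OF W IW right_ideal_sum_upper(1)[OF Mr X]] .
      have smono: "I m <+>\<^bsub>R\<^esub> M \<subseteq> I n <+>\<^bsub>R\<^esub> M" if "n \<le> m" for n m
        using set_add_mono[OF anti[OF that]] .
      have "\<exists>n. \<forall>m\<ge>n. I m <+>\<^bsub>R\<^esub> M = I n <+>\<^bsub>R\<^esub> M"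
      proof (cases "\<exists>n. I n <+>\<^bsub>R\<^esub> M = M")
        case True
        then obtain n where n: "I n <+>\<^bsub>R\<^esub> M = M" by blast
        have "I m <+>\<^bsub>R\<^esub> M = M" if "m \<ge> n" for m
          using smono[OF that] n right_ideal_sum_upper(2)[OF Ir Mr] by (metis subset_antisym)
        then show ?thesis using n by metis
      next
        case False
        then show ?thesis using or by metis
      qed
      then show "\<exists>n. \<forall>m\<ge>n. I m = I n"
        using right_ideal_chain_stable[OF Ir Mr _ Int] anti by blast
    qed
    then have "?W = M" using M(2)[of ?W] W right_ideal_sum_upper(1)[OF Mr X] by blast
    then show False using a(2) right_ideal_sum_upper(2)[OF Mr X] principal_self[OF a(1)] by blast
  qed
  then have d: "?dcc (carrier R)" using Mdcc by simp
  show ?thesis unfolding right_artinian_iff[OF ring_axioms]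
  proof (intro allI impI)
    fix I :: "nat \<Rightarrow> 'a set"
    assume I: "\<forall>n. right_ideal R (I n) \<and> I (Suc n) \<subseteq> I n"
    then have "\<forall>n. right_ideal R (I n) \<and> I (Suc n) \<subseteq> I n \<and> I n \<subseteq> carrier R" using right_idealD(1) by blast
    then show "\<exists>n. \<forall>m\<ge>n. I m = I n" by (rule d[THEN spec, THEN mp])
  qed
qed

text \<open>
  Dually, let \<open>M\<close> be minimal among the right ideals above which the ascending chain condition holds and pass from
  \<open>M\<close> to a maximal right subideal.
\<close>

theorem artinian_imp_noetherian:
  assumes ss: "right_semisimple_mod R Z" and Z: "two_sided R Z" and nil: "nilpotent R Z"
    and art: "right_artinian R"
  shows "right_noetherian R"
proof -
  let ?acc = "\<lambda>W. \<forall>I::nat \<Rightarrow> 'a set. (\<forall>n. right_ideal R (I n) \<and> I n \<subseteq> I (Suc n) \<and> W \<subseteq> I n) \<longrightarrow> (\<exists>n. \<forall>m\<ge>n. I m = I n)"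
  let ?P = "\<lambda>W. right_ideal R W \<and> ?acc W"
  have P0: "?P (carrier R)"
  proof (intro conjI allI impI right_ideal_carrier)
    fix I :: "nat \<Rightarrow> 'a set"
    assume I: "\<forall>n. right_ideal R (I n) \<and> I n \<subseteq> I (Suc n) \<and> carrier R \<subseteq> I n"
    then have "I n = carrier R" for n using right_idealD(1)[of R "I n"] by blast
    then show "\<exists>n. \<forall>m\<ge>n. I m = I n" by simp
  qed
  have Pr: "right_ideal R W" if "?P W" for W using that by blast
  obtain M where M: "?P M" "\<And>I. ?P I \<Longrightarrow> I \<subseteq> M \<Longrightarrow> I = M"
    by (rule right_artinian_minimal[OF ring_axioms art, of ?P, OF Pr P0]) simp_all
  then have Mr: "right_ideal R M" and Macc: "?acc M" by auto
  have "M = {\<zero>}"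
  proof (rule ccontr)
    assume "M \<noteq> {\<zero>}"
    then obtain C where C: "right_ideal R C" "C \<subset> M"
      "\<And>B. right_ideal R B \<Longrightarrow> C \<subseteq> B \<Longrightarrow> B \<subseteq> M \<Longrightarrow> B = C \<or> B = M"
      by (rule maximal_right_subideal[OF ss Z nil Mr]) blast
    have "?acc C"
    proof (intro allI impI)
      fix I :: "nat \<Rightarrow> 'a set"
      assume I: "\<forall>n. right_ideal R (I n) \<and> I n \<subseteq> I (Suc n) \<and> C \<subseteq> I n"
      then have Ir: "\<And>n. right_ideal R (I n)" and Id: "\<And>n. I n \<subseteq> I (Suc n)" and CI: "\<And>n. C \<subseteq> I n" by auto
      have mono: "I n \<subseteq> I m" if "n \<le> m" for n m using lift_Suc_mono_le[of I, OF Id that] .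
      have "\<forall>n. right_ideal R (I n <+>\<^bsub>R\<^esub> M) \<and> I n <+>\<^bsub>R\<^esub> M \<subseteq> I (Suc n) <+>\<^bsub>R\<^esub> M \<and> M \<subseteq> I n <+>\<^bsub>R\<^esub> M"
      proof (intro allI conjI)
        fix n
        show "I n <+>\<^bsub>R\<^esub> M \<subseteq> I (Suc n) <+>\<^bsub>R\<^esub> M" using set_add_mono[OF Id] .
      qed (use right_ideal_sum[OF Ir Mr] right_ideal_sum_upper(2)[OF Ir Mr] in auto)
      then have sum: "\<exists>n. \<forall>m\<ge>n. I m <+>\<^bsub>R\<^esub> M = I n <+>\<^bsub>R\<^esub> M"
        by (rule Macc[THEN spec[of _ "\<lambda>n. I n <+>\<^bsub>R\<^esub> M"], THEN mp])
      have or: "I n \<inter> M = C \<or> I n \<inter> M = M" for n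
        using C(3)[OF right_ideal_Int[OF Ir Mr]] CI C(2) by blast
      have "\<exists>n. \<forall>m\<ge>n. I m \<inter> M = I n \<inter> M"
      proof (cases "\<exists>n. I n \<inter> M = M")
        case True
        then obtain n where n: "I n \<inter> M = M" by blast
        have "I m \<inter> M = M" if "m \<ge> n" for m using mono[OF that] n by blast
        then show ?thesis using n by metis
      next
        case False
        then show ?thesis using or by metis
      qed
      then show "\<exists>n. \<forall>m\<ge>n. I m = I n"
        using right_ideal_chain_stable[OF Ir Mr _ _ sum] mono by blast
    qed
    then have "C = M" using M(2)[of C] C by blast
    then show False using C(2) by blast
  qed
  then have d: "?acc {\<zero>}" using Macc by simp
  show ?thesis unfolding right_noetherian_iff[OF ring_axioms]
  proof (intro allI impI)
    fix I :: "nat \<Rightarrow> 'a set"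
    assume I: "\<forall>n. right_ideal R (I n) \<and> I n \<subseteq> I (Suc n)"
    then have "\<forall>n. right_ideal R (I n) \<and> I n \<subseteq> I (Suc n) \<and> {\<zero>} \<subseteq> I n" using right_idealD(2) by blast
    then show "\<exists>n. \<forall>m\<ge>n. I m = I n" by (rule d[THEN spec, THEN mp])
  qed
qed

end

section \<open>Double annihilators\<close>

text \<open>
  Generators are added one at a time, which is the induction that the arguments about finitely generated left
  ideals follow.
\<close>

inductive fg_left_ideal :: "('a, 'r) ring_scheme \<Rightarrow> 'a set \<Rightarrow> bool" for R where
  zero: "fg_left_ideal R {\<zero>\<^bsub>R\<^esub>}"
| add: "fg_left_ideal R L \<Longrightarrow> a \<in> carrier R \<Longrightarrow>
    fg_left_ideal R (L <+>\<^bsub>R\<^esub> ((\<lambda>r. r \<otimes>\<^bsub>R\<^esub> a) ` carrier R))"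

context ring
begin

lemma left_ideal_principal: "a \<in> carrier R \<Longrightarrow> left_ideal R ((\<lambda>r. r \<otimes> a) ` carrier R)"
  using ring.right_ideal_principal[OF opposite, of a] by simp

lemma left_ideal_sum: "left_ideal R A \<Longrightarrow> left_ideal R B \<Longrightarrow> left_ideal R (A <+>\<^bsub>R\<^esub> B)"
  using ring.right_ideal_sum[OF opposite, of A B] by simp

lemma left_ideal_sum_upper:
  "left_ideal R A \<Longrightarrow> left_ideal R B \<Longrightarrow> A \<subseteq> A <+>\<^bsub>R\<^esub> B"
  "left_ideal R A \<Longrightarrow> left_ideal R B \<Longrightarrow> B \<subseteq> A <+>\<^bsub>R\<^esub> B"
  using ring.right_ideal_sum_upper[OF opposite, of A B] by simp_all

lemma left_ideal_sum_least:
  "left_ideal R C \<Longrightarrow> A \<subseteq> C \<Longrightarrow> B \<subseteq> C \<Longrightarrow> A <+>\<^bsub>R\<^esub> B \<subseteq> C"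
  using ring.right_ideal_sum_least[OF opposite, of C A B] by simp

lemma fg_left_ideal_left_ideal: "fg_left_ideal R L \<Longrightarrow> left_ideal R L"
proof (induction rule: fg_left_ideal.induct)
  case zero
  show ?case by (auto simp: left_ideal_def)
next
  case (add L a)
  then show ?case using left_ideal_sum left_ideal_principal by simp
qed

lemma noetherian_fg_left_ideal:
  assumes ln: "right_noetherian (opposite_ring R)" and L: "left_ideal R L"
  shows "fg_left_ideal R L"
proof -
  let ?P = "\<lambda>F. fg_left_ideal R F \<and> F \<subseteq> L"
  have P0: "?P {\<zero>}" using left_idealD(2)[OF L] by (simp add: fg_left_ideal.zero)
  have Pr: "right_ideal (opposite_ring R) F" if "?P F" for F
    using that fg_left_ideal_left_ideal by simp
  obtain F where F: "?P F" "\<And>G. ?P G \<Longrightarrow> F \<subseteq> G \<Longrightarrow> G = F"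
    by (rule right_noetherian_maximal[OF opposite ln, of ?P, OF Pr P0]) simp_all
  have Fl: "left_ideal R F" using F(1) fg_left_ideal_left_ideal by blast
  have "L \<subseteq> F"
  proof
    fix a assume a: "a \<in> L"
    have ac: "a \<in> carrier R" by (rule left_idealD(5)[OF L a])
    let ?A = "(\<lambda>r. r \<otimes> a) ` carrier R"
    have "?A \<subseteq> L" using left_idealD(4)[OF L a] by blast
    then have "?P (F <+>\<^bsub>R\<^esub> ?A)"
      using F(1) ac left_ideal_sum_least[OF L] by (simp add: fg_left_ideal.add)
    then have "F <+>\<^bsub>R\<^esub> ?A = F"
      using F(2) left_ideal_sum_upper(1)[OF Fl left_ideal_principal[OF ac]] by blast
    moreover have "\<one> \<otimes> a \<in> ?A" by (rule imageI) simp
    ultimately show "a \<in> F"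
      using left_ideal_sum_upper(2)[OF Fl left_ideal_principal[OF ac]] ac by auto
  qed
  then show ?thesis using F(1) by (metis subset_antisym)
qed

lemma subset_lann_rann: "L \<subseteq> carrier R \<Longrightarrow> L \<subseteq> lann R (rann R L)"
  by (auto simp: lann_def rann_def)

text \<open>
  For \<open>L + R a\<close> the right annihilator is \<open>r(L) \<inter> r(a)\<close>, whose left annihilator is \<open>l(r(L)) + l(r(a)) = L + R a\<close>.
\<close>

lemma lann_rann_fg:
  assumes baer: "right_baer R" and L: "fg_left_ideal R L"
  shows "lann R (rann R L) = L"
  using L
proof (induction rule: fg_left_ideal.induct)
  case zero
  have "rann R {\<zero>} = carrier R" by (auto simp: rann_def)
  moreover have "x \<otimes> \<one> = \<zero> \<Longrightarrow> x \<in> carrier R \<Longrightarrow> x = \<zero>" for x by simp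
  ultimately show ?case by (auto simp: lann_def dest: bspec[OF _ one_closed])
next
  case (add L a)
  have Ll: "left_ideal R L" by (rule fg_left_ideal_left_ideal[OF add(1)])
  let ?A = "(\<lambda>r. r \<otimes> a) ` carrier R"
  have A: "left_ideal R ?A" by (rule left_ideal_principal[OF add(2)])
  have Lc: "L \<subseteq> carrier R" by (rule left_idealD(1)[OF Ll])
  have sub: "rann R L \<inter> rann R {a} \<subseteq> rann R (L <+>\<^bsub>R\<^esub> ?A)"
  proof
    fix x assume x: "x \<in> rann R L \<inter> rann R {a}"
    then have xc: "x \<in> carrier R" "a \<otimes> x = \<zero>" by (auto simp: rann_def)
    have "y \<otimes> x = \<zero>" if y: "y \<in> L <+>\<^bsub>R\<^esub> ?A" for y
    proof -
      obtain l r where lr: "l \<in> L" "r \<in> carrier R" "y = l \<oplus> r \<otimes> a" using y by (auto simp: set_add_iff)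
      have "l \<otimes> x = \<zero>" "l \<in> carrier R" using x lr(1) Lc by (auto simp: rann_def)
      then show ?thesis using lr xc add(2) by (simp add: l_distr m_assoc)
    qed
    then show "x \<in> rann R (L <+>\<^bsub>R\<^esub> ?A)" using xc by (simp add: rann_def)
  qed
  show ?case
  proof
    show "L <+>\<^bsub>R\<^esub> ?A \<subseteq> lann R (rann R (L <+>\<^bsub>R\<^esub> ?A))"
      by (rule subset_lann_rann[OF left_idealD(1)[OF left_ideal_sum[OF Ll A]]])
    show "lann R (rann R (L <+>\<^bsub>R\<^esub> ?A)) \<subseteq> L <+>\<^bsub>R\<^esub> ?A"
    proof
      fix x assume "x \<in> lann R (rann R (L <+>\<^bsub>R\<^esub> ?A))"
      then have x: "x \<in> lann R (rann R L \<inter> rann R {a})" using sub by (auto simp: lann_def)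
      obtain u v where uv: "u \<in> lann R (rann R L)" "v \<in> lann R (rann R {a})" "x = u \<oplus> v"
        by (rule right_baer_lann_Int[OF baer right_ideal_rann[OF Lc] right_ideal_rann[of "{a}"] x])
          (use add(2) in auto)
      have vc: "v \<in> carrier R" using uv(2) by (simp add: lann_def)
      have "rann R {a} \<subseteq> rann R {v}" using uv(2) by (auto simp: lann_def rann_def)
      then obtain c where "c \<in> carrier R" "v = c \<otimes> a" by (rule right_baer_principal[OF baer add(2) vc])
      then show "x \<in> L <+>\<^bsub>R\<^esub> ?A" unfolding uv(3) using uv(1) add(3) by (intro set_addI) auto
    qed
  qed
qed

lemma fg_left_ideal_chain:
  assumes F: "fg_left_ideal R F" and I: "\<And>n::nat. left_ideal R (I n)" "\<And>n. I n \<subseteq> I (Suc n)"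
  shows "F \<subseteq> (\<Union>n. I n) \<Longrightarrow> \<exists>n. F \<subseteq> I n"
  using F
proof (induction rule: fg_left_ideal.induct)
  case zero
  then show ?case by auto
next
  case (add L a)
  let ?A = "(\<lambda>r. r \<otimes> a) ` carrier R"
  have Ll: "left_ideal R L" by (rule fg_left_ideal_left_ideal[OF add(1)])
  have A: "left_ideal R ?A" by (rule left_ideal_principal[OF add(2)])
  have mono: "I n \<subseteq> I m" if "n \<le> m" for n m using lift_Suc_mono_le[of I, OF I(2) that] .
  obtain n where n: "L \<subseteq> I n" using add left_ideal_sum_upper(1)[OF Ll A] by blast
  have "\<one> \<otimes> a \<in> ?A" by (rule imageI) simp
  then have "a \<in> ?A" using add(2) by simp
  then have "a \<in> (\<Union>n. I n)" using add.prems left_ideal_sum_upper(2)[OF Ll A] by blast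
  then obtain m where m: "a \<in> I m" by blast
  let ?k = "max n m"
  have "L \<subseteq> I ?k" "a \<in> I ?k" using mono[of n ?k] mono[of m ?k] n m by auto
  moreover from this have "?A \<subseteq> I ?k" using left_idealD(4)[OF I(1)] by blast
  ultimately have "L <+>\<^bsub>R\<^esub> ?A \<subseteq> I ?k" using left_ideal_sum_least[OF I(1)] by blast
  then show ?case by blast
qed

lemma rann_antimono: "A \<subseteq> B \<Longrightarrow> rann R B \<subseteq> rann R A"
  by (auto simp: rann_def)

text \<open>
  For finitely generated \<open>F \<subseteq> L\<close> with \<open>r(F)\<close> minimal, adding a generator does not change \<open>r(F)\<close>, hence by the
  double annihilator law it does not change \<open>F\<close>. So \<open>F = L\<close>, and every left ideal is finitely generated.
\<close>

lemma right_baer_artinian_left_noetherian: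
  assumes baer: "right_baer R" and art: "right_artinian R"
  shows "right_noetherian (opposite_ring R)"
proof -
  have fg: "fg_left_ideal R L" if L: "left_ideal R L" for L
  proof -
    let ?P = "\<lambda>I. \<exists>F. fg_left_ideal R F \<and> F \<subseteq> L \<and> I = rann R F"
    have P0: "?P (rann R {\<zero>})" using left_idealD(2)[OF L] fg_left_ideal.zero by blast
    have Pr: "right_ideal R I" if "?P I" for I
      using that right_ideal_rann left_idealD(1)[OF fg_left_ideal_left_ideal] by blast
    obtain M where M: "?P M" "\<And>I. ?P I \<Longrightarrow> I \<subseteq> M \<Longrightarrow> I = M"
      by (rule right_artinian_minimal[OF ring_axioms art, of ?P, OF Pr P0]) simp_all
    then obtain F where F: "fg_left_ideal R F" "F \<subseteq> L" "M = rann R F" by blast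
    have Fl: "left_ideal R F" using F(1) fg_left_ideal_left_ideal by blast
    have "L \<subseteq> F"
    proof
      fix a assume a: "a \<in> L"
      have ac: "a \<in> carrier R" by (rule left_idealD(5)[OF L a])
      let ?A = "(\<lambda>r. r \<otimes> a) ` carrier R"
      let ?G = "F <+>\<^bsub>R\<^esub> ?A"
      have "?A \<subseteq> L" using left_idealD(4)[OF L a] by blast
      then have G: "fg_left_ideal R ?G" "?G \<subseteq> L"
        using F ac left_ideal_sum_least[OF L] by (simp_all add: fg_left_ideal.add)
      have FG: "F \<subseteq> ?G" by (rule left_ideal_sum_upper(1)[OF Fl left_ideal_principal[OF ac]])
      have "rann R ?G = M" using M(2) G rann_antimono[OF FG] F(3) by blast
      then have "?G = F" using lann_rann_fg[OF baer G(1)] lann_rann_fg[OF baer F(1)] F(3) by simp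
      moreover have "\<one> \<otimes> a \<in> ?A" by (rule imageI) simp
      ultimately show "a \<in> F"
        using left_ideal_sum_upper(2)[OF Fl left_ideal_principal[OF ac]] ac by auto
    qed
    then show ?thesis using F by (metis subset_antisym)
  qed
  show ?thesis unfolding right_noetherian_iff[OF opposite] ideals_opposite
  proof (intro allI impI)
    fix I :: "nat \<Rightarrow> 'a set"
    assume I: "\<forall>n. left_ideal R (I n) \<and> I n \<subseteq> I (Suc n)"
    then have Il: "\<And>n. left_ideal R (I n)" and Is: "\<And>n. I n \<subseteq> I (Suc n)" by auto
    have mono: "I n \<subseteq> I m" if "n \<le> m" for n m using lift_Suc_mono_le[of I, OF Is that] .
    have "left_ideal R (\<Union>n. I n)"
    proof (rule left_idealI)
      show "x \<oplus> y \<in> (\<Union>n. I n)" if xy: "x \<in> (\<Union>n. I n)" "y \<in> (\<Union>n. I n)" for x y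
      proof -
        obtain n m where "x \<in> I n" "y \<in> I m" using xy by blast
        then have "x \<in> I (max n m)" "y \<in> I (max n m)" using mono[of n "max n m"] mono[of m "max n m"] by auto
        then show ?thesis using left_idealD(3)[OF Il] by blast
      qed
      show "(\<Union>n. I n) \<subseteq> carrier R" using left_idealD(1)[OF Il] by blast
      show "\<zero> \<in> (\<Union>n. I n)" using left_idealD(2)[OF Il] by blast
      show "r \<otimes> x \<in> (\<Union>n. I n)" if "x \<in> (\<Union>n. I n)" "r \<in> carrier R" for x r
        using that left_idealD(4)[OF Il] by auto
    qed
    then have "\<exists>n. (\<Union>n. I n) \<subseteq> I n" using fg_left_ideal_chain[of _ I, OF fg Il Is] by blast
    then obtain n where "(\<Union>n. I n) \<subseteq> I n" by blast
    then have "I m = I n" if "m \<ge> n" for m using mono[OF that] by blast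
    then show "\<exists>n. \<forall>m\<ge>n. I m = I n" by blast
  qed
qed

text \<open>
  Let \<open>S = l(Z)\<close>; it is the right socle of \<open>R\<close>, and it is essential because \<open>Z\<close> is nilpotent. For two-sided ideals
  \<open>W \<supseteq> Z\<close> let \<open>\<Theta>(W) = r(r(W) \<inter> S)\<close>. This is again a two-sided ideal containing \<open>Z\<close>, and \<open>\<Theta>\<close> is monotone and
  injective: \<open>r(W) \<inter> S\<close> is a left ideal, hence equal to \<open>l(\<Theta>(W))\<close>, and its left annihilator is
  \<open>l(r(W)) + l(S) = W\<close>. So the chain \<open>Z \<subseteq> \<Theta>(Z) \<subseteq> \<Theta>(\<Theta>(Z)) \<subseteq> \<dots>\<close> cannot become constant unless \<open>\<Theta>(Z) = Z\<close>, and over a left noetherian ring it does. This gives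
  \<open>r(S) \<subseteq> \<Theta>(Z) = Z\<close>. The usual argument counts the simple right modules; iterating an injective monotone map until
  it becomes constant replaces the counting.
\<close>

lemma rann_lann_singular:
  assumes baer: "right_baer R" and nil: "nilpotent R (right_singular R)"
    and ln: "right_noetherian (opposite_ring R)"
  shows "rann R (lann R (right_singular R)) \<subseteq> right_singular R"
proof -
  let ?Z = "right_singular R"
  let ?S = "lann R ?Z"
  have Z: "two_sided R ?Z" by (rule two_sided_right_singular)
  then have Zr: "right_ideal R ?Z" and Zl: "left_ideal R ?Z" by (auto simp: two_sided_def)
  have S: "two_sided R ?S" by (rule two_sided_lann[OF Zl])
  then have Sr: "right_ideal R ?S" and Sl: "left_ideal R ?S" by (auto simp: two_sided_def)
  have double: "lann R (rann R L) = L" if "left_ideal R L" for L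
    using lann_rann_fg[OF baer noetherian_fg_left_ideal[OF ln that]] .
  have SZ: "lann R ?S \<subseteq> ?Z"
  proof
    fix a assume a: "a \<in> lann R ?S"
    have "\<exists>r\<in>carrier R. x \<otimes> r \<noteq> \<zero> \<and> a \<otimes> (x \<otimes> r) = \<zero>" if x: "x \<in> carrier R" "x \<noteq> \<zero>" for x
    proof -
      let ?X = "(\<lambda>r. x \<otimes> r) ` carrier R"
      have "\<not> ?X \<subseteq> {\<zero>}" using principal_self[OF x(1)] x by blast
      then obtain y where y: "y \<in> ?X" "y \<notin> {\<zero>}" "\<And>z. z \<in> ?Z \<Longrightarrow> y \<otimes> z \<in> {\<zero>}"
        by (rule nilpotent_annihilated_element[OF Z nil right_ideal_zero right_ideal_principal[OF x(1)]]) blast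
      have "y \<in> ?S" using y x by (auto simp: lann_def)
      then have "a \<otimes> y = \<zero>" using a by (simp add: lann_def)
      then show ?thesis using y by auto
    qed
    then show "a \<in> ?Z" using a by (simp add: right_singular_def lann_def)
  qed
  define T where "T W = rann R W \<inter> ?S" for W
  define \<Theta> where "\<Theta> W = rann R (T W)" for W
  let ?ok = "\<lambda>W. two_sided R W \<and> ?Z \<subseteq> W"
  have T: "right_ideal R (T W)" "left_ideal R (T W)" if "?ok W" for W
    using that two_sided_rann[of W] Sr Sl right_ideal_Int ring.right_ideal_Int[OF opposite]
    by (auto simp: T_def two_sided_def)
  have lT: "lann R (T W) = W" if W: "?ok W" for W
  proof
    have Xr: "right_ideal R W" and Xl: "left_ideal R W" using W by (auto simp: two_sided_def)
    have Xc: "W \<subseteq> carrier R" by (rule right_idealD(1)[OF Xr])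
    show "W \<subseteq> lann R (T W)" using Xc by (auto simp: lann_def T_def rann_def)
    show "lann R (T W) \<subseteq> W"
    proof
      fix y assume "y \<in> lann R (T W)"
      then obtain u v where uv: "u \<in> lann R (rann R W)" "v \<in> lann R ?S" "y = u \<oplus> v"
        unfolding T_def by (rule right_baer_lann_Int[OF baer right_ideal_rann[OF Xc] Sr])
      then have "u \<in> W" "v \<in> W" using double[OF Xl] SZ W by auto
      then show "y \<in> W" using uv right_idealD(3)[OF Xr] by simp
    qed
  qed
  have ok: "?ok (\<Theta> W)" if W: "?ok W" for W
  proof
    show "two_sided R (\<Theta> W)" unfolding \<Theta>_def by (rule two_sided_rann[OF T(1)[OF W]])
    show "?Z \<subseteq> \<Theta> W" unfolding \<Theta>_def T_def using right_idealD(5)[OF Zr] by (auto simp: rann_def lann_def)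
  qed
  have rec: "lann R (lann R (\<Theta> W)) = W" if W: "?ok W" for W
    unfolding \<Theta>_def using double[OF T(2)[OF W]] lT[OF W] by simp
  have mono: "\<Theta> W \<subseteq> \<Theta> Y" if "W \<subseteq> Y" for W Y
    unfolding \<Theta>_def T_def using that by (auto simp: rann_def)
  define I where "I n = (\<Theta> ^^ n) ?Z" for n
  have I0: "I 0 = ?Z" and IS: "I (Suc n) = \<Theta> (I n)" for n by (simp_all add: I_def)
  have Iok: "?ok (I n)" for n
    by (induction n) (use Z ok in \<open>auto simp: I0 IS\<close>)
  have up: "I n \<subseteq> I (Suc n)" for n
  proof (induction n)
    case 0
    show ?case using Iok[of 1] by (simp add: I0)
  next
    case (Suc n)
    then show ?case using mono by (simp add: IS)
  qed
  have "\<forall>n. right_ideal (opposite_ring R) (I n) \<and> I n \<subseteq> I (Suc n)"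
    using Iok up by (auto simp: two_sided_def)
  then have "\<exists>n. \<forall>m\<ge>n. I m = I n"
    by (rule ln[unfolded right_noetherian_iff[OF opposite], THEN spec, THEN mp])
  then obtain n where "I (Suc n) = I n" by (meson le_SucI order_refl)
  then have "I (Suc 0) = I 0"
  proof (induction n)
    case (Suc n)
    then have "\<Theta> (I (Suc n)) = \<Theta> (I n)" by (simp add: IS)
    then have "I (Suc n) = I n" using rec[OF Iok] by metis
    then show ?case by (rule Suc.IH)
  qed simp
  then have "\<Theta> ?Z = ?Z" by (simp add: IS I0)
  then show ?thesis unfolding \<Theta>_def T_def using rann_antimono[of "rann R ?Z \<inter> ?S" ?S] by blast
qed

text \<open>
  This says that every simple right module embeds in \<open>R\<close>. Let \<open>M\<close> be a maximal right ideal with left identity \<open>e\<close> modulo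
  \<open>Z\<close>. As \<open>\<one> - e \<notin> Z\<close>, the element \<open>\<one> - e\<close> is not killed by \<open>S = l(Z)\<close>. So \<open>s (\<one> - e) \<noteq> \<zero>\<close> for some \<open>s \<in> S\<close>, while
  \<open>s (\<one> - e) M \<subseteq> s Z = 0\<close>.
\<close>

lemma proper_right_ideal_annihilated:
  assumes baer: "right_baer R" and nil: "nilpotent R (right_singular R)"
    and ln: "right_noetherian (opposite_ring R)"
    and ss: "right_semisimple_mod R (right_singular R)"
    and M0: "right_ideal R M0" "\<one> \<notin> M0"
  obtains c where "c \<in> carrier R" "c \<noteq> \<zero>" "\<And>m. m \<in> M0 \<Longrightarrow> c \<otimes> m = \<zero>"
proof -
  let ?Z = "right_singular R"
  let ?S = "lann R ?Z"
  have Z: "right_ideal R ?Z" using two_sided_right_singular by (simp add: two_sided_def)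
  have "M0 \<inter> {\<one>} = {}" using M0 by blast
  then obtain M where M: "right_ideal R M" "M0 \<subseteq> M" "M \<inter> {\<one>} = {}"
    "\<And>E. right_ideal R E \<Longrightarrow> M \<subseteq> E \<Longrightarrow> E \<inter> {\<one>} = {} \<Longrightarrow> E = M"
    by (rule maximal_right_ideal_avoiding[OF M0(1)]) blast
  note cM = right_idealD(5)[OF M(1)]
  have "?Z \<subseteq> M"
  proof (rule ccontr)
    assume "\<not> ?Z \<subseteq> M"
    then have "M <+>\<^bsub>R\<^esub> ?Z \<noteq> M" using right_ideal_sum_upper(2)[OF M(1) Z] by blast
    then have "\<one> \<in> M <+>\<^bsub>R\<^esub> ?Z"
      using M(4)[OF right_ideal_sum[OF M(1) Z] right_ideal_sum_upper(1)[OF M(1) Z]] by blast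
    then obtain m z where mz: "m \<in> M" "z \<in> ?Z" "\<one> = m \<oplus> z" by (auto simp: set_add_iff)
    obtain d where d: "d \<in> carrier R" "d \<otimes> (\<one> \<ominus> z) = \<one>" "(\<one> \<ominus> z) \<otimes> d = \<one>"
      by (rule right_baer_unit[OF baer mz(2)])
    have "m \<oplus> z \<ominus> z = m" using cM[OF mz(1)] right_idealD(5)[OF Z mz(2)]
      by (simp add: a_minus_def a_assoc r_neg)
    then have "\<one> \<ominus> z = m" using mz(3) by simp
    then have "\<one> \<in> M" using right_idealD(4)[OF M(1) mz(1) d(1)] d(3) by simp
    then show False using M(3) by blast
  qed
  then obtain e where e: "e \<in> M" "\<And>m. m \<in> M \<Longrightarrow> (\<one> \<ominus> e) \<otimes> m \<in> ?Z"
    using ss M(1) unfolding right_semisimple_mod_def by blast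
  have ec: "e \<in> carrier R" using cM e by blast
  have "\<one> \<ominus> e \<notin> ?Z"
  proof
    assume "\<one> \<ominus> e \<in> ?Z"
    then have "\<one> \<in> M" using right_ideal_cancel[OF M(1) _ e(1) one_closed] \<open>?Z \<subseteq> M\<close> by blast
    then show False using M(3) by blast
  qed
  then have "\<one> \<ominus> e \<notin> rann R ?S" using rann_lann_singular[OF baer nil ln] by blast
  then obtain s where s: "s \<in> ?S" "s \<otimes> (\<one> \<ominus> e) \<noteq> \<zero>" using ec by (auto simp: rann_def)
  have sc: "s \<in> carrier R" using s by (simp add: lann_def)
  have "s \<otimes> (\<one> \<ominus> e) \<otimes> m = \<zero>" if "m \<in> M0" for m
  proof -
    have m: "m \<in> M" using that M(2) by blast
    have "s \<otimes> ((\<one> \<ominus> e) \<otimes> m) = \<zero>" using s(1) e(2)[OF m] by (simp add: lann_def)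
    then show ?thesis using sc ec cM[OF m] by (simp add: m_assoc)
  qed
  then show thesis using that[of "s \<otimes> (\<one> \<ominus> e)"] s sc ec by simp
qed

text \<open>
  If \<open>b \<in> r(l(A))\<close> is not in \<open>A\<close>, some \<open>c \<noteq> \<zero>\<close> kills all \<open>r\<close> with \<open>b r \<in> A\<close>, and \<open>a + b r \<mapsto> c r\<close> is left
  multiplication by some \<open>d\<close>. Then \<open>d \<in> l(A)\<close> but \<open>d b = c \<noteq> \<zero>\<close>.
\<close>

lemma rann_lann_right_ideal:
  assumes baer: "right_baer R" and nil: "nilpotent R (right_singular R)"
    and ln: "right_noetherian (opposite_ring R)"
    and ss: "right_semisimple_mod R (right_singular R)"
    and A: "right_ideal R A"
  shows "rann R (lann R A) = A"
proof
  note cA = right_idealD(5)[OF A]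
  show "A \<subseteq> rann R (lann R A)" using cA by (auto simp: lann_def rann_def)
  show "rann R (lann R A) \<subseteq> A"
  proof (rule subsetI, rule ccontr)
    fix b assume b: "b \<in> rann R (lann R A)" "b \<notin> A"
    have bc: "b \<in> carrier R" using b by (simp add: rann_def)
    let ?M = "{r \<in> carrier R. b \<otimes> r \<in> A}"
    have M: "right_ideal R ?M" by (rule right_ideal_colon[OF A bc])
    have "\<one> \<notin> ?M" using b bc by simp
    then obtain c where c: "c \<in> carrier R" "c \<noteq> \<zero>" "\<And>m. m \<in> ?M \<Longrightarrow> c \<otimes> m = \<zero>"
      by (rule proper_right_ideal_annihilated[OF baer nil ln ss M]) blast
    obtain d where d: "d \<in> carrier R" "\<And>a. a \<in> A \<Longrightarrow> d \<otimes> a = \<zero>" "d \<otimes> b = c"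
    proof (rule right_baer_extension[OF baer A bc c(1)])
      show "c \<otimes> r = \<zero>" if "r \<in> carrier R" "b \<otimes> r \<in> A" for r using c(3) that by simp
    qed (rule that)
    have "d \<in> lann R A" using d(1,2) by (simp add: lann_def)
    then have "d \<otimes> b = \<zero>" using b by (simp add: rann_def)
    then show False using d(3) c(2) by simp
  qed
qed

text \<open>
  Induction over the generators of the domain. On \<open>L\<close> the map is right multiplication by some \<open>c1\<close>. On \<open>R a\<close> it is right
  multiplication by some \<open>c2\<close>, since \<open>f a\<close> is killed by \<open>l(a)\<close> and \<open>r(l(a)) = a R\<close>. The difference \<open>c1 - c2\<close> kills
  \<open>L \<inter> R a\<close>, whose right annihilator is \<open>r(L) + r(a)\<close> by duality, so that \<open>c1\<close> and \<open>c2\<close> can be corrected to agree.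
\<close>

lemma double_annihilators_left_baer:
  assumes fg: "\<And>L. left_ideal R L \<Longrightarrow> fg_left_ideal R L"
    and left: "\<And>L. left_ideal R L \<Longrightarrow> lann R (rann R L) = L"
    and right: "\<And>A. right_ideal R A \<Longrightarrow> rann R (lann R A) = A"
  shows "right_baer (opposite_ring R)"
proof -
  have main: "\<exists>c\<in>carrier R. \<forall>x\<in>L. f x = x \<otimes> c"
    if "fg_left_ideal R L" "f \<in> L \<rightarrow> carrier R" "\<forall>x\<in>L. \<forall>y\<in>L. f (x \<oplus> y) = f x \<oplus> f y"
      "\<forall>x\<in>L. \<forall>r\<in>carrier R. f (r \<otimes> x) = r \<otimes> f x" for L f
    using that
  proof (induction rule: fg_left_ideal.induct)
    case zero
    then have "f (\<zero> \<otimes> \<zero>) = \<zero> \<otimes> f \<zero>" by blast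
    then have "f \<zero> = \<zero>" using zero(1) by simp
    then show ?case by auto
  next
    case (add L a)
    have Ll: "left_ideal R L" by (rule fg_left_ideal_left_ideal[OF add(1)])
    let ?A = "(\<lambda>r. r \<otimes> a) ` carrier R"
    have A: "left_ideal R ?A" by (rule left_ideal_principal[OF add(2)])
    note up = left_ideal_sum_upper[OF Ll A]
    note cL = left_idealD(5)[OF Ll] and cA = left_idealD(5)[OF A]
    have "\<exists>c\<in>carrier R. \<forall>x\<in>L. f x = x \<otimes> c"
    proof (rule add.IH)
      show "f \<in> L \<rightarrow> carrier R" using add.prems(1) up(1) by blast
    qed (use add.prems(2,3) up(1) in blast)+
    then obtain c1 where c1: "c1 \<in> carrier R" "\<And>x. x \<in> L \<Longrightarrow> f x = x \<otimes> c1" by blast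
    have aA: "a \<in> ?A" using imageI[of \<one> "carrier R" "\<lambda>r. r \<otimes> a"] add(2) by simp
    then have aS: "a \<in> L <+>\<^bsub>R\<^esub> ?A" using up by blast
    have fa: "f a \<in> carrier R" using aS add.prems(1) by blast
    have fr: "f (r \<otimes> a) = r \<otimes> f a" if "r \<in> carrier R" for r using add.prems(3) aS that by blast
    let ?aR = "(\<lambda>r. a \<otimes> r) ` carrier R"
    have "f a \<in> rann R (lann R ?aR)"
    proof -
      have "r \<otimes> f a = \<zero>" if r: "r \<in> lann R ?aR" for r
      proof -
        have rc: "r \<in> carrier R" "r \<otimes> a = \<zero>" using r principal_self[OF add(2)] by (auto simp: lann_def)
        have "f (\<zero> \<otimes> a) = \<zero> \<otimes> f a" by (rule fr) simp
        then have "f \<zero> = \<zero>" using fa add(2) by simp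
        then show ?thesis using fr[OF rc(1)] rc by simp
      qed
      then show ?thesis using fa by (simp add: rann_def)
    qed
    then have "f a \<in> ?aR" using right[OF right_ideal_principal[OF add(2)]] by simp
    then obtain c2 where c2: "c2 \<in> carrier R" "f a = a \<otimes> c2" by blast
    let ?B = "rann R L" and ?C = "rann R ?A"
    have B: "right_ideal R ?B" and C: "right_ideal R ?C"
      using right_ideal_rann left_idealD(1)[OF Ll] left_idealD(1)[OF A] by blast+
    have lBC: "lann R (?B <+>\<^bsub>R\<^esub> ?C) \<subseteq> L \<inter> ?A"
    proof
      fix x assume "x \<in> lann R (?B <+>\<^bsub>R\<^esub> ?C)"
      then have "x \<in> lann R ?B" "x \<in> lann R ?C"
        using right_ideal_sum_upper[OF B C] by (auto simp: lann_def)
      then show "x \<in> L \<inter> ?A" using left[OF Ll] left[OF A] by simp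
    qed
    have "c1 \<ominus> c2 \<in> rann R (lann R (?B <+>\<^bsub>R\<^esub> ?C))"
    proof -
      have "x \<otimes> (c1 \<ominus> c2) = \<zero>" if "x \<in> lann R (?B <+>\<^bsub>R\<^esub> ?C)" for x
      proof -
        have x: "x \<in> L" "x \<in> ?A" using lBC that by auto
        then obtain r where r: "r \<in> carrier R" "x = r \<otimes> a" by blast
        have "x \<otimes> c1 = f (r \<otimes> a)" using c1(2)[OF x(1)] r(2) by simp
        also have "\<dots> = x \<otimes> c2" using fr[OF r(1)] c2 r add(2) by (simp add: m_assoc)
        finally show ?thesis using cL[OF x(1)] c1(1) c2(1) by (simp add: a_minus_def r_distr r_minus r_neg)
      qed
      then show ?thesis using c1(1) c2(1) by (simp add: rann_def)
    qed
    then have "c1 \<ominus> c2 \<in> ?B <+>\<^bsub>R\<^esub> ?C" using right[OF right_ideal_sum[OF B C]] by simp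
    then obtain u v where uv: "u \<in> ?B" "v \<in> ?C" "c1 \<ominus> c2 = u \<oplus> v" by (auto simp: set_add_iff)
    have uvc: "u \<in> carrier R" "v \<in> carrier R" using uv by (auto simp: rann_def)
    define c where "c = c2 \<oplus> v"
    have cc: "c \<in> carrier R" using c2 uvc by (simp add: c_def)
    have "c1 = c1 \<ominus> c2 \<oplus> c2" using c1(1) c2(1) by (simp add: a_minus_def a_assoc l_neg)
    then have c1': "c1 = u \<oplus> c" unfolding uv(3) c_def using uvc c2(1) by (simp add: a_ac)
    have fL: "f x = x \<otimes> c" if x: "x \<in> L" for x
    proof -
      have "x \<otimes> u = \<zero>" using uv(1) x by (simp add: rann_def)
      then show ?thesis using c1(2)[OF x] cL[OF x] uvc cc unfolding c1' by (simp add: r_distr)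
    qed
    have fA: "f (r \<otimes> a) = (r \<otimes> a) \<otimes> c" if r: "r \<in> carrier R" for r
    proof -
      have "r \<otimes> a \<otimes> v = \<zero>" using uv(2) r by (auto simp: rann_def)
      then show ?thesis using fr[OF r] c2 r add(2) uvc by (simp add: c_def r_distr m_assoc)
    qed
    have "f x = x \<otimes> c" if x: "x \<in> L <+>\<^bsub>R\<^esub> ?A" for x
    proof -
      obtain l r where lr: "l \<in> L" "r \<in> carrier R" "x = l \<oplus> r \<otimes> a" using x by (auto simp: set_add_iff)
      have "f x = f l \<oplus> f (r \<otimes> a)" unfolding lr(3) using add.prems(2) up lr(1,2) by blast
      also have "\<dots> = x \<otimes> c" using fL[OF lr(1)] fA[OF lr(2)] cL[OF lr(1)] lr(2) add(2) cc
        unfolding lr(3) by (simp add: l_distr)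
      finally show ?thesis .
    qed
    then show ?case using cc by blast
  qed
  show ?thesis unfolding right_baer_def ideals_opposite opposite_simps
    using main[OF fg] by blast
qed

text \<open>
  The case of left artinian rings carries the whole symmetry: the chain conditions on left ideals provide the double
  annihilator laws, and through these the descending chain condition on left ideals becomes the ascending one
  on right ideals.
\<close>

theorem right_baer_left_artinian:
  assumes baer: "right_baer R" and art: "left_artinian R"
  shows "right_noetherian R" "right_artinian R" "right_baer (opposite_ring R)"
    "nilpotent R (right_singular R)" "right_semisimple_mod R (right_singular R)"
proof -
  let ?Z = "right_singular R"
  interpret op: ring "opposite_ring R" by (rule opposite)
  have Z: "two_sided R ?Z" by (rule two_sided_right_singular)
  then have Zc: "?Z \<subseteq> carrier R" by (auto simp: two_sided_def right_ideal_def)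
  have oart: "right_artinian (opposite_ring R)" using art by (simp add: left_artinian_def)
  have reg: "regular_mod R ?Z" using right_baer_regular[OF baer] by (simp add: regular_mod_def)
  then have oreg: "regular_mod (opposite_ring R) ?Z" using regular_mod_opposite[OF ring_axioms] by simp
  have onil: "nilpotent (opposite_ring R) ?Z"
  proof (rule op.artinian_nilpotent[OF oart])
    show "\<exists>d\<in>carrier (opposite_ring R). (\<one>\<^bsub>opposite_ring R\<^esub> \<ominus>\<^bsub>opposite_ring R\<^esub> z) \<otimes>\<^bsub>opposite_ring R\<^esub> d = \<one>\<^bsub>opposite_ring R\<^esub>"
      if "z \<in> ?Z" for z
      using right_baer_unit[OF baer that] by (metis opposite_simps(1,3,5,7))
  qed (simp add: Z)
  then show nil: "nilpotent R ?Z" using nilpotent_opposite[OF Zc] by simp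
  have oZ: "two_sided (opposite_ring R) ?Z" using Z by simp
  have ln: "right_noetherian (opposite_ring R)"
    by (rule op.artinian_imp_noetherian[OF op.artinian_right_semisimple_mod[OF oreg oZ oart] oZ onil oart])
  show ss: "right_semisimple_mod R ?Z" by (rule left_artinian_right_semisimple_mod[OF reg Z art])
  have fg: "fg_left_ideal R L" if "left_ideal R L" for L by (rule noetherian_fg_left_ideal[OF ln that])
  have right: "rann R (lann R A) = A" if "right_ideal R A" for A
    by (rule rann_lann_right_ideal[OF baer nil ln ss that])
  show "right_baer (opposite_ring R)"
    by (rule double_annihilators_left_baer[OF fg lann_rann_fg[OF baer fg] right])
  show rn: "right_noetherian R" unfolding right_noetherian_iff[OF ring_axioms]
  proof (intro allI impI)
    fix I :: "nat \<Rightarrow> 'a set"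
    assume I: "\<forall>n. right_ideal R (I n) \<and> I n \<subseteq> I (Suc n)"
    have "\<forall>n. right_ideal (opposite_ring R) (lann R (I n)) \<and> lann R (I (Suc n)) \<subseteq> lann R (I n)"
    proof (intro allI conjI)
      fix n
      have "I n \<subseteq> carrier R" "I n \<subseteq> I (Suc n)" using I right_idealD(1) by blast+
      then show "right_ideal (opposite_ring R) (lann R (I n))" "lann R (I (Suc n)) \<subseteq> lann R (I n)"
        using left_ideal_lann by (auto simp: lann_def)
    qed
    then have "\<exists>n. \<forall>m\<ge>n. lann R (I m) = lann R (I n)"
      by (rule oart[unfolded right_artinian_iff[OF opposite], THEN spec, THEN mp])
    then show "\<exists>n. \<forall>m\<ge>n. I m = I n" using right I by metis
  qed
  show "right_artinian R" by (rule noetherian_imp_artinian[OF ss Z nil rn])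
qed

text \<open>
  The left noetherian condition comes from the double annihilators of finitely generated left ideals; the rest is the
  equivalence of the chain conditions over the opposite ring.
\<close>

theorem right_baer_right_artinian:
  assumes baer: "right_baer R" and art: "right_artinian R"
  shows "left_artinian R"
proof -
  let ?Z = "right_singular R"
  interpret op: ring "opposite_ring R" by (rule opposite)
  have Z: "two_sided R ?Z" by (rule two_sided_right_singular)
  then have Zc: "?Z \<subseteq> carrier R" by (auto simp: two_sided_def right_ideal_def)
  have oZ: "two_sided (opposite_ring R) ?Z" using Z by simp
  have reg: "regular_mod R ?Z" using right_baer_regular[OF baer] by (simp add: regular_mod_def)
  then have oreg: "regular_mod (opposite_ring R) ?Z" using regular_mod_opposite[OF ring_axioms] by simp
  have "nilpotent R ?Z"
    using artinian_nilpotent[OF art Z] right_baer_unit[OF baer] by metis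
  then have onil: "nilpotent (opposite_ring R) ?Z" using nilpotent_opposite[OF Zc] by simp
  have ln: "right_noetherian (opposite_ring R)" by (rule right_baer_artinian_left_noetherian[OF baer art])
  show ?thesis unfolding left_artinian_def
    by (rule op.noetherian_imp_artinian[OF op.noetherian_right_semisimple_mod[OF oreg oZ ln] oZ onil ln])
qed

end

section \<open>Homomorphisms, simple and small submodules\<close>

lemma rmod_homD:
  assumes "f \<in> rmod_hom R M N"
  shows "\<And>x. x \<in> carrier M \<Longrightarrow> f x \<in> carrier N"
    "\<And>x y. x \<in> carrier M \<Longrightarrow> y \<in> carrier M \<Longrightarrow> f (x \<oplus>\<^bsub>M\<^esub> y) = f x \<oplus>\<^bsub>N\<^esub> f y"
    "\<And>r x. r \<in> carrier R \<Longrightarrow> x \<in> carrier M \<Longrightarrow> f (r \<odot>\<^bsub>M\<^esub> x) = r \<odot>\<^bsub>N\<^esub> f x"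
  using assms by (auto simp: rmod_hom_def)

lemma rmod_homI:
  assumes "\<And>x. x \<in> carrier M \<Longrightarrow> f x \<in> carrier N"
    "\<And>x y. x \<in> carrier M \<Longrightarrow> y \<in> carrier M \<Longrightarrow> f (x \<oplus>\<^bsub>M\<^esub> y) = f x \<oplus>\<^bsub>N\<^esub> f y"
    "\<And>r x. r \<in> carrier R \<Longrightarrow> x \<in> carrier M \<Longrightarrow> f (r \<odot>\<^bsub>M\<^esub> x) = r \<odot>\<^bsub>N\<^esub> f x"
  shows "f \<in> rmod_hom R M N"
  using assms by (auto simp: rmod_hom_def)

lemma rmod_hom_compose:
  assumes "f \<in> rmod_hom R M N" "g \<in> rmod_hom R N P"
  shows "(\<lambda>x. g (f x)) \<in> rmod_hom R M P"
  by (rule rmod_homI) (simp_all add: rmod_homD[OF assms(1)] rmod_homD[OF assms(2)])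

context right_module
begin

lemma hom_zero:
  assumes "right_module R N" "f \<in> rmod_hom R M N"
  shows "f \<zero>\<^bsub>M\<^esub> = \<zero>\<^bsub>N\<^esub>"
proof -
  interpret N: right_module R N by fact
  have "f (\<zero> \<odot>\<^bsub>M\<^esub> \<zero>\<^bsub>M\<^esub>) = \<zero> \<odot>\<^bsub>N\<^esub> f \<zero>\<^bsub>M\<^esub>" using rmod_homD(3)[OF assms(2)] by simp
  then show ?thesis using smult_zero N.smult_zero rmod_homD(1)[OF assms(2)] by simp
qed

lemma hom_minus:
  assumes "right_module R N" "f \<in> rmod_hom R M N" "x \<in> carrier M"
  shows "f (\<ominus>\<^bsub>M\<^esub> x) = \<ominus>\<^bsub>N\<^esub> f x"
proof -
  interpret N: right_module R N by fact
  have "f ((\<ominus> \<one>) \<odot>\<^bsub>M\<^esub> x) = (\<ominus> \<one>) \<odot>\<^bsub>N\<^esub> f x" using rmod_homD(3)[OF assms(2)] assms(3) by simp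
  then show ?thesis using smult_minus_one N.smult_minus_one rmod_homD(1)[OF assms(2)] assms(3) by simp
qed

lemma hom_diff:
  assumes "right_module R N" "f \<in> rmod_hom R M N" "x \<in> carrier M" "y \<in> carrier M"
  shows "f (x \<ominus>\<^bsub>M\<^esub> y) = f x \<ominus>\<^bsub>N\<^esub> f y"
  using assms by (simp add: a_minus_def hom_minus rmod_homD(2))

lemma rmod_hom_add:
  assumes "right_module R N" and f: "f \<in> rmod_hom R M N" and g: "g \<in> rmod_hom R M N"
  shows "(\<lambda>x. f x \<oplus>\<^bsub>N\<^esub> g x) \<in> rmod_hom R M N"
proof -
  interpret N: right_module R N by fact
  note h = rmod_homD[OF f] rmod_homD[OF g]
  show ?thesis
    by (rule rmod_homI) (simp_all add: h N.smult_r_distr N.M.a_ac)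
qed

lemma rmod_hom_id: "(\<lambda>x. x) \<in> rmod_hom R M M"
  by (rule rmod_homI) auto

lemma rmod_hom_uminus:
  assumes "right_module R N" and f: "f \<in> rmod_hom R M N"
  shows "(\<lambda>x. \<ominus>\<^bsub>N\<^esub> f x) \<in> rmod_hom R M N"
proof -
  interpret N: right_module R N by fact
  note h = rmod_homD[OF f]
  show ?thesis
    by (rule rmod_homI) (simp_all add: h N.smult_minus N.M.minus_add)
qed

lemma rmod_hom_diff:
  assumes "right_module R N" and f: "f \<in> rmod_hom R M N" and g: "g \<in> rmod_hom R M N"
  shows "(\<lambda>x. f x \<ominus>\<^bsub>N\<^esub> g x) \<in> rmod_hom R M N"
  unfolding a_minus_def by (rule rmod_hom_add[OF assms(1) f rmod_hom_uminus[OF assms(1) g]])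

lemma submodule_image:
  assumes "right_module R N" and f: "f \<in> rmod_hom R M N" and V: "submodule V R M"
  shows "submodule (f ` V) R N"
proof -
  interpret N: right_module R N by fact
  note v = submoduleD[OF V] and h = rmod_homD[OF f]
  show ?thesis
  proof (rule N.submoduleI)
    show "f ` V \<subseteq> carrier N" using v(5) h(1) by blast
    show "\<zero>\<^bsub>N\<^esub> \<in> f ` V" using v(2) hom_zero[OF assms(1) f] by (metis imageI)
    show "x \<oplus>\<^bsub>N\<^esub> y \<in> f ` V" if xy: "x \<in> f ` V" "y \<in> f ` V" for x y
    proof -
      obtain a b where "a \<in> V" "b \<in> V" "x = f a" "y = f b" using xy by blast
      then show ?thesis using v h(2)[of a b] by (metis imageI)
    qed
    show "r \<odot>\<^bsub>N\<^esub> x \<in> f ` V" if xr: "x \<in> f ` V" "r \<in> carrier R" for x r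
    proof -
      obtain a where "a \<in> V" "x = f a" using xr by blast
      then show ?thesis using v h(3)[of r a] xr(2) by (metis imageI)
    qed
  qed
qed

lemma submodule_preimage:
  assumes "right_module R N" and f: "f \<in> rmod_hom R M N" and V: "submodule V R N"
  shows "submodule {x \<in> carrier M. f x \<in> V} R M"
proof -
  interpret N: right_module R N by fact
  note v = N.submoduleD[OF V] and h = rmod_homD[OF f]
  show ?thesis
    by (rule submoduleI) (use hom_zero[OF assms(1) f] v smult_closed in \<open>auto simp: h\<close>)
qed

lemma simple_submoduleD:
  assumes "simple_submodule R M V"
  shows "submodule V R M" "V \<noteq> {\<zero>\<^bsub>M\<^esub>}" "\<And>L. submodule L R M \<Longrightarrow> L \<subseteq> V \<Longrightarrow> L = {\<zero>\<^bsub>M\<^esub>} \<or> L = V"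
  using assms by (auto simp: simple_submodule_def)

lemma simple_submodule_image:
  assumes "right_module R N" and f: "f \<in> rmod_hom R M N" and V: "simple_submodule R M V"
  shows "f ` V = {\<zero>\<^bsub>N\<^esub>} \<or> simple_submodule R N (f ` V)"
proof (rule disjCI)
  interpret N: right_module R N by fact
  note v = simple_submoduleD[OF V]
  assume "\<not> simple_submodule R N (f ` V)"
  show "f ` V = {\<zero>\<^bsub>N\<^esub>}"
  proof (rule ccontr)
    assume ne: "f ` V \<noteq> {\<zero>\<^bsub>N\<^esub>}"
    have im: "submodule (f ` V) R N" by (rule submodule_image[OF assms(1) f v(1)])
    have "L = {\<zero>\<^bsub>N\<^esub>} \<or> L = f ` V" if L: "submodule L R N" "L \<subseteq> f ` V" for L
    proof -
      let ?P = "{x \<in> carrier M. f x \<in> L} \<inter> V"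
      have "submodule ?P R M" by (rule submodule_Int[OF submodule_preimage[OF assms(1) f L(1)] v(1)])
      then have "?P = {\<zero>\<^bsub>M\<^esub>} \<or> ?P = V" using v(3) by blast
      moreover have L': "L = f ` ?P" using L(2) submoduleD(5)[OF v(1)] by auto
      ultimately show ?thesis using hom_zero[OF assms(1) f] by auto
    qed
    then have "simple_submodule R N (f ` V)" using im ne by (simp add: simple_submodule_def)
    then show False using \<open>\<not> simple_submodule R N (f ` V)\<close> by blast
  qed
qed

lemma simple_Int:
  assumes V: "simple_submodule R M V" and L: "submodule L R M" and "\<not> V \<subseteq> L"
  shows "V \<inter> L = {\<zero>\<^bsub>M\<^esub>}"
  using simple_submoduleD(3)[OF V submodule_Int[OF simple_submoduleD(1)[OF V] L]] assms(3) by blast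

lemma submodule_socle: "submodule (socle R M) R M"
proof -
  let ?U = "\<Union>{S. simple_submodule R M S}"
  have U: "?U \<subseteq> carrier M" using submoduleD(1)[OF simple_submoduleD(1)] by blast
  note g = M.a_group
  have sg: "subgroup (generate (add_monoid M) ?U) (add_monoid M)"
    by (rule group.generate_is_subgroup[OF g]) (use U in simp)
  have sm: "r \<odot>\<^bsub>M\<^esub> x \<in> generate (add_monoid M) ?U"
    if "x \<in> generate (add_monoid M) ?U" "r \<in> carrier R" for x r
    using that
  proof (induction rule: generate.induct)
    case one
    have "r \<odot>\<^bsub>M\<^esub> \<zero>\<^bsub>M\<^esub> = \<zero>\<^bsub>M\<^esub>" using submoduleD(4)[OF submodule_zero] one by blast
    then show ?case using generate.one[of "add_monoid M" ?U] by simp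
  next
    case (incl h)
    then obtain S where "simple_submodule R M S" "h \<in> S" by blast
    then have "r \<odot>\<^bsub>M\<^esub> h \<in> ?U" using submoduleD(4)[OF simple_submoduleD(1)] incl by blast
    then show ?case by (rule generate.incl)
  next
    case (inv h)
    then obtain S where S: "simple_submodule R M S" "h \<in> S" by blast
    then have "\<ominus>\<^bsub>M\<^esub> h \<in> S" using submoduleD(6)[OF simple_submoduleD(1)] by blast
    then have "inv\<^bsub>add_monoid M\<^esub> h \<in> S" by (simp add: a_inv_def)
    then have "r \<odot>\<^bsub>M\<^esub> (inv\<^bsub>add_monoid M\<^esub> h) \<in> ?U" using submoduleD(4)[OF simple_submoduleD(1)] S inv by blast
    then show ?case by (rule generate.incl)
  next
    case (eng h1 h2)
    have "h1 \<in> carrier M" "h2 \<in> carrier M" using eng(1,2) subgroup.subset[OF sg] by auto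
    then have "r \<odot>\<^bsub>M\<^esub> (h1 \<otimes>\<^bsub>add_monoid M\<^esub> h2) = (r \<odot>\<^bsub>M\<^esub> h1) \<otimes>\<^bsub>add_monoid M\<^esub> (r \<odot>\<^bsub>M\<^esub> h2)"
      using eng by (simp add: smult_r_distr)
    then show ?case using generate.eng[OF eng(3,4)] eng(5) by simp
  qed
  show ?thesis unfolding socle_def
    using subgroup.subset[OF sg] subgroup.one_closed[OF sg] subgroup.m_closed[OF sg] sm
    by (intro submoduleI) auto
qed

lemma simple_subset_socle: "simple_submodule R M V \<Longrightarrow> V \<subseteq> socle R M"
  unfolding socle_def by (auto intro: generate.incl)

lemma socle_least:
  assumes L: "submodule L R M" and "\<And>V. simple_submodule R M V \<Longrightarrow> V \<subseteq> L"
  shows "socle R M \<subseteq> L"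
proof -
  note g = M.a_group
  show ?thesis unfolding socle_def
    by (rule group.generate_subgroup_incl[OF g]) (use assms submodule.axioms(1) in blast)+
qed

lemma right_module_restrict:
  assumes K: "submodule K R M"
  shows "right_module R (M\<lparr>carrier := K\<rparr>)"
proof -
  note k = submoduleD[OF K]
  have "abelian_group (M\<lparr>carrier := K\<rparr>)"
  proof (rule abelian_groupI)
    show "\<exists>y\<in>carrier (M\<lparr>carrier := K\<rparr>). y \<oplus>\<^bsub>M\<lparr>carrier := K\<rparr>\<^esub> x = \<zero>\<^bsub>M\<lparr>carrier := K\<rparr>\<^esub>"
      if "x \<in> carrier (M\<lparr>carrier := K\<rparr>)" for x
      using that k(5,6) M.l_neg by (intro bexI[of _ "\<ominus>\<^bsub>M\<^esub> x"]) simp_all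
  qed (use k(2,3,5) in \<open>simp_all add: M.a_ac\<close>)
  then show ?thesis
    using k(4,5)
    by (intro right_module.intro right_module_axioms.intro R.ring_axioms)
      (auto simp: smult_l_distr smult_r_distr smult_assoc smult_one)
qed

lemma submodule_restrict:
  assumes K: "submodule K R M"
  shows "submodule L R (M\<lparr>carrier := K\<rparr>) \<longleftrightarrow> submodule L R M \<and> L \<subseteq> K"
  using submoduleD(1)[OF K]
  by (auto simp: right_module.submodule_iff[OF right_module_restrict[OF K]] submodule_iff)

lemma simple_restrict:
  assumes K: "submodule K R M"
  shows "simple_submodule R (M\<lparr>carrier := K\<rparr>) V \<longleftrightarrow> simple_submodule R M V \<and> V \<subseteq> K"
  by (auto simp: simple_submodule_def submodule_restrict[OF K])

text \<open>
  Semisimple submodules are tested by containment of their simple submodules, which keeps the argument inside one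
  ambient module.
\<close>

lemma semisimple_restrict:
  assumes K: "submodule K R M"
  shows "semisimple_module R (M\<lparr>carrier := K\<rparr>) \<longleftrightarrow>
    (\<forall>L. submodule L R M \<and> (\<forall>V. simple_submodule R M V \<and> V \<subseteq> K \<longrightarrow> V \<subseteq> L) \<longrightarrow> K \<subseteq> L)" (is "?l \<longleftrightarrow> ?r")
proof -
  interpret K: right_module R "M\<lparr>carrier := K\<rparr>" by (rule right_module_restrict[OF K])
  let ?S = "socle R (M\<lparr>carrier := K\<rparr>)"
  have S: "submodule ?S R M" "?S \<subseteq> K" using K.submodule_socle submodule_restrict[OF K] by auto
  show ?thesis
  proof
    assume l: ?l
    show ?r
    proof (intro allI impI, elim conjE)
      fix L assume L: "submodule L R M" "\<forall>V. simple_submodule R M V \<and> V \<subseteq> K \<longrightarrow> V \<subseteq> L"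
      have "?S \<subseteq> L \<inter> K"
        by (rule K.socle_least)
          (use L submodule_Int[OF L(1) K] in \<open>auto simp: submodule_restrict[OF K] simple_restrict[OF K]\<close>)
      then show "K \<subseteq> L" using l by (auto simp: semisimple_module_def)
    qed
  next
    assume r: ?r
    have "K \<subseteq> ?S" using r[rule_format, of ?S] S K.simple_subset_socle simple_restrict[OF K] by blast
    then show ?l using S K.right_module_axioms by (auto simp: semisimple_module_def)
  qed
qed

lemma small_submoduleI:
  assumes "submodule K R M"
    "\<And>L. submodule L R M \<Longrightarrow> L \<noteq> carrier M \<Longrightarrow> K <+>\<^bsub>M\<^esub> L \<noteq> carrier M"
  shows "small_submodule R M K"
  using assms by (simp add: small_submodule_def)

text \<open>
  If \<open>f K + L = M\<close>, then \<open>K\<close> together with the preimage of \<open>L\<close> is also all of \<open>M\<close>, so the preimage of \<open>L\<close> is \<open>M\<close> and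
  \<open>f K \<subseteq> L\<close>.
\<close>

lemma small_image:
  assumes f: "f \<in> rmod_hom R M M" and K: "small_submodule R M K"
  shows "small_submodule R M (f ` K)"
proof (rule small_submoduleI)
  have Ks: "submodule K R M" using K by (simp add: small_submodule_def)
  show im: "submodule (f ` K) R M" by (rule submodule_image[OF right_module_axioms f Ks])
  fix L assume L: "submodule L R M" "L \<noteq> carrier M"
  show "f ` K <+>\<^bsub>M\<^esub> L \<noteq> carrier M"
  proof
    assume eq: "f ` K <+>\<^bsub>M\<^esub> L = carrier M"
    let ?P = "{x \<in> carrier M. f x \<in> L}"
    have P: "submodule ?P R M" by (rule submodule_preimage[OF right_module_axioms f L(1)])
    have "K <+>\<^bsub>M\<^esub> ?P = carrier M"
    proof
      show "K <+>\<^bsub>M\<^esub> ?P \<subseteq> carrier M" by (rule submoduleD(1)[OF submodule_sum[OF Ks P]])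
      show "carrier M \<subseteq> K <+>\<^bsub>M\<^esub> ?P"
      proof
        fix x assume x: "x \<in> carrier M"
        then have "f x \<in> f ` K <+>\<^bsub>M\<^esub> L" using eq rmod_homD(1)[OF f] by simp
        then obtain k l where kl: "k \<in> K" "l \<in> L" "f x = f k \<oplus>\<^bsub>M\<^esub> l" by (auto simp: set_add_iff)
        have c: "k \<in> carrier M" "l \<in> carrier M" "f k \<in> carrier M"
          using submoduleD(5)[OF Ks] submoduleD(5)[OF L(1)] kl rmod_homD(1)[OF f] by auto
        have "f (x \<ominus>\<^bsub>M\<^esub> k) = (f k \<oplus>\<^bsub>M\<^esub> l) \<ominus>\<^bsub>M\<^esub> f k"
          using hom_diff[OF right_module_axioms f x c(1)] kl(3) by simp
        also have "\<dots> = l" using c by (simp add: a_minus_def M.a_comm[of "f k" l] M.a_assoc M.r_neg)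
        finally have "f (x \<ominus>\<^bsub>M\<^esub> k) = l" .
        then have "x \<ominus>\<^bsub>M\<^esub> k \<in> ?P" using kl x c by simp
        moreover have "x = k \<oplus>\<^bsub>M\<^esub> (x \<ominus>\<^bsub>M\<^esub> k)" using x c by (simp add: a_minus_def M.a_comm[of x] M.r_neg2)
        ultimately show "x \<in> K <+>\<^bsub>M\<^esub> ?P" using set_addI[OF kl(1)] by metis
      qed
    qed
    then have "?P = carrier M" using K P by (auto simp: small_submodule_def)
    then have "f ` K \<subseteq> L" using submoduleD(5)[OF Ks] by blast
    then have "f ` K <+>\<^bsub>M\<^esub> L \<subseteq> L" using submodule_sum_least[OF L(1)] by blast
    then show False using eq L submoduleD(1)[OF L(1)] by blast
  qed
qed

lemma small_subset:
  assumes K: "small_submodule R M K" and L: "submodule L R M" "L \<subseteq> K"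
  shows "small_submodule R M L"
proof (rule small_submoduleI[OF L(1)])
  fix P assume P: "submodule P R M" "P \<noteq> carrier M"
  have Ks: "submodule K R M" using K by (simp add: small_submodule_def)
  have "L <+>\<^bsub>M\<^esub> P \<subseteq> K <+>\<^bsub>M\<^esub> P" by (rule set_add_mono[OF L(2)])
  moreover have "K <+>\<^bsub>M\<^esub> P \<subseteq> carrier M" by (rule submoduleD(1)[OF submodule_sum[OF Ks P(1)]])
  moreover have "K <+>\<^bsub>M\<^esub> P \<noteq> carrier M" using K P by (simp add: small_submodule_def)
  ultimately show "L <+>\<^bsub>M\<^esub> P \<noteq> carrier M" by blast
qed

lemma small_sum:
  assumes K: "small_submodule R M K" and L: "small_submodule R M L"
  shows "small_submodule R M (K <+>\<^bsub>M\<^esub> L)"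
proof (rule small_submoduleI)
  have Ks: "submodule K R M" and Ls: "submodule L R M" using K L by (auto simp: small_submodule_def)
  show "submodule (K <+>\<^bsub>M\<^esub> L) R M" by (rule submodule_sum[OF Ks Ls])
  fix P assume P: "submodule P R M" "P \<noteq> carrier M"
  have LP: "submodule (L <+>\<^bsub>M\<^esub> P) R M" by (rule submodule_sum[OF Ls P(1)])
  have "L <+>\<^bsub>M\<^esub> P \<noteq> carrier M" using L P by (simp add: small_submodule_def)
  then have "K <+>\<^bsub>M\<^esub> (L <+>\<^bsub>M\<^esub> P) \<noteq> carrier M" using K LP by (simp add: small_submodule_def)
  moreover have "K <+>\<^bsub>M\<^esub> L <+>\<^bsub>M\<^esub> P \<subseteq> K <+>\<^bsub>M\<^esub> (L <+>\<^bsub>M\<^esub> P)"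
  proof
    fix x assume "x \<in> K <+>\<^bsub>M\<^esub> L <+>\<^bsub>M\<^esub> P"
    then obtain k l p where e: "k \<in> K" "l \<in> L" "p \<in> P" "x = k \<oplus>\<^bsub>M\<^esub> l \<oplus>\<^bsub>M\<^esub> p" by (auto simp: set_add_iff)
    then have "x = k \<oplus>\<^bsub>M\<^esub> (l \<oplus>\<^bsub>M\<^esub> p)"
      using submoduleD(5)[OF Ks] submoduleD(5)[OF Ls] submoduleD(5)[OF P(1)] by (simp add: M.a_assoc)
    then show "x \<in> K <+>\<^bsub>M\<^esub> (L <+>\<^bsub>M\<^esub> P)" using e by (simp add: set_addI)
  qed
  ultimately show "K <+>\<^bsub>M\<^esub> L <+>\<^bsub>M\<^esub> P \<noteq> carrier M"
    using submoduleD(1)[OF submodule_sum[OF Ks LP]] by blast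
qed

lemma small_zero: "small_submodule R M {\<zero>\<^bsub>M\<^esub>}"
proof (rule small_submoduleI[OF submodule_zero])
  fix P assume P: "submodule P R M" "P \<noteq> carrier M"
  have "{\<zero>\<^bsub>M\<^esub>} <+>\<^bsub>M\<^esub> P \<subseteq> P" using submodule_sum_least[OF P(1)] submoduleD(2)[OF P(1)] by blast
  then show "{\<zero>\<^bsub>M\<^esub>} <+>\<^bsub>M\<^esub> P \<noteq> carrier M" using P submoduleD(1)[OF P(1)] by blast
qed

lemma complement_projection:
  assumes V: "submodule V R M" and L: "submodule L R M"
    and VL: "V \<inter> L = {\<zero>\<^bsub>M\<^esub>}" "V <+>\<^bsub>M\<^esub> L = carrier M"
  obtains \<rho> where "\<rho> \<in> rmod_hom R M M" "\<And>x. x \<in> carrier M \<Longrightarrow> \<rho> x \<in> V" "\<And>v. v \<in> V \<Longrightarrow> \<rho> v = v"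
proof -
  note v = submoduleD[OF V] and l = submoduleD[OF L]
  have uniq: "a = a'" if e: "a \<in> V" "b \<in> L" "a' \<in> V" "b' \<in> L" "a \<oplus>\<^bsub>M\<^esub> b = a' \<oplus>\<^bsub>M\<^esub> b'" for a b a' b'
  proof -
    have c: "a \<in> carrier M" "b \<in> carrier M" "a' \<in> carrier M" "b' \<in> carrier M" using e v(5) l(5) by auto
    have "a \<ominus>\<^bsub>M\<^esub> a' = (a \<oplus>\<^bsub>M\<^esub> b) \<ominus>\<^bsub>M\<^esub> b \<ominus>\<^bsub>M\<^esub> a'" using c by (simp add: a_minus_def M.a_assoc M.r_neg)
    also have "\<dots> = b' \<ominus>\<^bsub>M\<^esub> b" unfolding e(5) using c
      by (simp add: a_minus_def M.a_assoc M.a_comm[of "\<ominus>\<^bsub>M\<^esub> b"])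
        (simp add: M.a_lcomm[of a' b'] M.r_neg1 M.r_neg2)
    finally have "a \<ominus>\<^bsub>M\<^esub> a' \<in> V \<inter> L" using v(7)[OF e(1,3)] l(7)[OF e(4,2)] by simp
    then have z: "a \<ominus>\<^bsub>M\<^esub> a' = \<zero>\<^bsub>M\<^esub>" using VL(1) by blast
    have "a = (a \<ominus>\<^bsub>M\<^esub> a') \<oplus>\<^bsub>M\<^esub> a'" using c by (simp add: a_minus_def M.a_assoc M.l_neg)
    then show ?thesis unfolding z using c by simp
  qed
  define \<rho> where "\<rho> x = (THE a. a \<in> V \<and> (\<exists>b\<in>L. x = a \<oplus>\<^bsub>M\<^esub> b))" for x
  have \<rho>: "\<rho> (a \<oplus>\<^bsub>M\<^esub> b) = a" if "a \<in> V" "b \<in> L" for a b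
    unfolding \<rho>_def using that uniq by blast
  have ex: "\<exists>a\<in>V. \<exists>b\<in>L. x = a \<oplus>\<^bsub>M\<^esub> b" if "x \<in> carrier M" for x
    using that unfolding VL(2)[symmetric] set_add_iff .
  have "\<rho> \<in> rmod_hom R M M"
  proof (rule rmod_homI)
    show "\<rho> x \<in> carrier M" if x: "x \<in> carrier M" for x
      using ex[OF x] \<rho> v(5) by auto
    show "\<rho> (x \<oplus>\<^bsub>M\<^esub> y) = \<rho> x \<oplus>\<^bsub>M\<^esub> \<rho> y" if xy: "x \<in> carrier M" "y \<in> carrier M" for x y
    proof -
      obtain a b a' b' where e: "a\<in>V" "b\<in>L" "a'\<in>V" "b'\<in>L" "x = a \<oplus>\<^bsub>M\<^esub> b" "y = a' \<oplus>\<^bsub>M\<^esub> b'"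
        using ex[OF xy(1)] ex[OF xy(2)] by blast
      then have "x \<oplus>\<^bsub>M\<^esub> y = (a \<oplus>\<^bsub>M\<^esub> a') \<oplus>\<^bsub>M\<^esub> (b \<oplus>\<^bsub>M\<^esub> b')" using v(5) l(5) by (simp add: M.a_ac)
      then show ?thesis using \<rho>[OF v(3)[OF e(1,3)] l(3)[OF e(2,4)]] \<rho>[OF e(1,2)] \<rho>[OF e(3,4)] e(5,6) by simp
    qed
    show "\<rho> (r \<odot>\<^bsub>M\<^esub> x) = r \<odot>\<^bsub>M\<^esub> \<rho> x" if rx: "r \<in> carrier R" "x \<in> carrier M" for r x
    proof -
      obtain a b where e: "a\<in>V" "b\<in>L" "x = a \<oplus>\<^bsub>M\<^esub> b" using ex[OF rx(2)] by blast
      then have "r \<odot>\<^bsub>M\<^esub> x = r \<odot>\<^bsub>M\<^esub> a \<oplus>\<^bsub>M\<^esub> r \<odot>\<^bsub>M\<^esub> b" using v(5) l(5) rx by (simp add: smult_r_distr)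
      then show ?thesis using \<rho>[OF v(4)[OF e(1) rx(1)] l(4)[OF e(2) rx(1)]] \<rho>[OF e(1,2)] e(3) by simp
    qed
  qed
  moreover have "\<rho> x \<in> V" if x: "x \<in> carrier M" for x using ex[OF x] \<rho> by auto
  moreover have "\<rho> a = a" if a: "a \<in> V" for a using \<rho>[OF a l(2)] v(5)[OF a] by simp
  ultimately show thesis by (rule that)
qed

end

section \<open>Products, quotients and Baer's criterion\<close>

definition prod_module :: "('a, 'm, 'c) module_scheme \<Rightarrow> ('a, 'n, 'd) module_scheme \<Rightarrow> ('a, 'm \<times> 'n) module" where
  "prod_module M N = \<lparr>carrier = carrier M \<times> carrier N, monoid.mult = (\<lambda>x y. x),
     one = (\<zero>\<^bsub>M\<^esub>, \<zero>\<^bsub>N\<^esub>), ring.zero = (\<zero>\<^bsub>M\<^esub>, \<zero>\<^bsub>N\<^esub>),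
     ring.add = (\<lambda>x y. (fst x \<oplus>\<^bsub>M\<^esub> fst y, snd x \<oplus>\<^bsub>N\<^esub> snd y)),
     smult = (\<lambda>r x. (r \<odot>\<^bsub>M\<^esub> fst x, r \<odot>\<^bsub>N\<^esub> snd x))\<rparr>"

lemma prod_module_simps [simp]:
  "carrier (prod_module M N) = carrier M \<times> carrier N"
  "\<zero>\<^bsub>prod_module M N\<^esub> = (\<zero>\<^bsub>M\<^esub>, \<zero>\<^bsub>N\<^esub>)"
  "x \<oplus>\<^bsub>prod_module M N\<^esub> y = (fst x \<oplus>\<^bsub>M\<^esub> fst y, snd x \<oplus>\<^bsub>N\<^esub> snd y)"
  "r \<odot>\<^bsub>prod_module M N\<^esub> x = (r \<odot>\<^bsub>M\<^esub> fst x, r \<odot>\<^bsub>N\<^esub> snd x)"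
  by (simp_all add: prod_module_def)

lemma right_module_prod:
  assumes "right_module R M" "right_module R N"
  shows "right_module R (prod_module M N)"
proof -
  interpret M: right_module R M by fact
  interpret N: right_module R N by fact
  have "abelian_group (prod_module M N)"
  proof (rule abelian_groupI)
    show "\<exists>y\<in>carrier (prod_module M N). y \<oplus>\<^bsub>prod_module M N\<^esub> x = \<zero>\<^bsub>prod_module M N\<^esub>"
      if "x \<in> carrier (prod_module M N)" for x
      using that M.M.l_neg N.M.l_neg by (intro bexI[of _ "(\<ominus>\<^bsub>M\<^esub> fst x, \<ominus>\<^bsub>N\<^esub> snd x)"]) auto
  qed (auto simp: M.M.a_ac N.M.a_ac)
  then show ?thesis
    by (intro right_module.intro right_module_axioms.intro M.R.ring_axioms)
      (auto simp: M.smult_closed N.smult_closed M.smult_l_distr N.smult_l_distr M.smult_r_distr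
        N.smult_r_distr M.smult_assoc N.smult_assoc M.smult_one N.smult_one)
qed

lemma (in right_module) submodule_cyclic:
  assumes "x \<in> carrier M"
  shows "submodule ((\<lambda>r. r \<odot>\<^bsub>M\<^esub> x) ` carrier R) R M"
proof (rule submoduleI)
  show "\<zero>\<^bsub>M\<^esub> \<in> (\<lambda>r. r \<odot>\<^bsub>M\<^esub> x) ` carrier R"
    using smult_zero[OF assms] by (metis R.zero_closed imageI)
  show "u \<oplus>\<^bsub>M\<^esub> v \<in> (\<lambda>r. r \<odot>\<^bsub>M\<^esub> x) ` carrier R"
    if "u \<in> (\<lambda>r. r \<odot>\<^bsub>M\<^esub> x) ` carrier R" "v \<in> (\<lambda>r. r \<odot>\<^bsub>M\<^esub> x) ` carrier R" for u v
    using that assms by (auto simp: smult_l_distr[symmetric])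
  show "r \<odot>\<^bsub>M\<^esub> u \<in> (\<lambda>r. r \<odot>\<^bsub>M\<^esub> x) ` carrier R"
    if "u \<in> (\<lambda>r. r \<odot>\<^bsub>M\<^esub> x) ` carrier R" "r \<in> carrier R" for u r
    using that assms by (auto simp: smult_assoc[symmetric])
qed (use assms smult_closed in auto)

text \<open>
  The quotient is built from one representative of each coset, transported along \<open>e\<close>. So it can live in every type
  with room for \<open>M\<close>, and \<open>D = 0\<close> gives an isomorphic copy of \<open>M\<close> there.
\<close>

lemma (in right_module) quotient_module:
  fixes e :: "'m \<Rightarrow> 'n"
  assumes D: "submodule D R M" and e: "inj_on e (carrier M)"
  obtains N :: "('a, 'n) module" and q where "right_module R N" "q \<in> rmod_hom R M N"
    "q ` carrier M = carrier N" "\<And>x. x \<in> carrier M \<Longrightarrow> q x = \<zero>\<^bsub>N\<^esub> \<longleftrightarrow> x \<in> D"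
proof -
  note d = submoduleD[OF D]
  define rep where "rep x = (SOME y. y \<in> carrier M \<and> y \<ominus>\<^bsub>M\<^esub> x \<in> D)" for x
  have rep: "rep x \<in> carrier M \<and> rep x \<ominus>\<^bsub>M\<^esub> x \<in> D" if "x \<in> carrier M" for x
    unfolding rep_def by (rule someI[of _ x]) (use that d(2) in \<open>simp add: a_minus_def M.r_neg\<close>)
  have trans: "x \<ominus>\<^bsub>M\<^esub> z \<in> D" if c: "x \<in> carrier M" "y \<in> carrier M" "z \<in> carrier M"
    and xy: "x \<ominus>\<^bsub>M\<^esub> y \<in> D" "y \<ominus>\<^bsub>M\<^esub> z \<in> D" for x y z
  proof -
    have "(x \<ominus>\<^bsub>M\<^esub> y) \<oplus>\<^bsub>M\<^esub> (y \<ominus>\<^bsub>M\<^esub> z) = x \<ominus>\<^bsub>M\<^esub> z"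
      using c by (simp add: a_minus_def M.a_assoc M.r_neg1)
    then show ?thesis using d(3)[OF xy] by simp
  qed
  have sym: "y \<ominus>\<^bsub>M\<^esub> x \<in> D" if c: "x \<in> carrier M" "y \<in> carrier M" and xy: "x \<ominus>\<^bsub>M\<^esub> y \<in> D" for x y
    using d(6)[OF xy] c by (simp add: a_minus_def M.minus_add M.a_comm)
  have rep_eq: "rep x = rep y \<longleftrightarrow> x \<ominus>\<^bsub>M\<^esub> y \<in> D" if c: "x \<in> carrier M" "y \<in> carrier M" for x y
  proof
    assume "rep x = rep y"
    then show "x \<ominus>\<^bsub>M\<^esub> y \<in> D" using trans[of x "rep x" y] sym[of "rep x" x] rep[OF c(1)] rep[OF c(2)] c by simp
  next
    assume xy: "x \<ominus>\<^bsub>M\<^esub> y \<in> D"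
    have "z \<in> carrier M \<and> z \<ominus>\<^bsub>M\<^esub> x \<in> D \<longleftrightarrow> z \<in> carrier M \<and> z \<ominus>\<^bsub>M\<^esub> y \<in> D" for z
      using trans[of z x y] trans[of z y x] sym[OF c xy] xy c by blast
    then show "rep x = rep y" unfolding rep_def by simp
  qed
  define q where "q x = e (rep x)" for x
  have q_eq: "q x = q y \<longleftrightarrow> x \<ominus>\<^bsub>M\<^esub> y \<in> D" if c: "x \<in> carrier M" "y \<in> carrier M" for x y
    unfolding q_def rep_eq[OF c, symmetric] using inj_on_eq_iff[OF e] rep[OF c(1)] rep[OF c(2)] by blast
  define s where "s u = (SOME x. x \<in> carrier M \<and> q x = u)" for u
  have s: "s (q x) \<in> carrier M" "q (s (q x)) = q x" if "x \<in> carrier M" for x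
    unfolding s_def using someI[of "\<lambda>y. y \<in> carrier M \<and> q y = q x" x] that by auto
  define N :: "('a, 'n) module" where
    "N = \<lparr>carrier = q ` carrier M, monoid.mult = (\<lambda>x y. x), one = q \<zero>\<^bsub>M\<^esub>, ring.zero = q \<zero>\<^bsub>M\<^esub>,
      ring.add = (\<lambda>u v. q (s u \<oplus>\<^bsub>M\<^esub> s v)), smult = (\<lambda>r u. q (r \<odot>\<^bsub>M\<^esub> s u))\<rparr>"
  have Nc: "carrier N = q ` carrier M" and Nz: "\<zero>\<^bsub>N\<^esub> = q \<zero>\<^bsub>M\<^esub>" by (simp_all add: N_def)
  have Nadd: "q x \<oplus>\<^bsub>N\<^esub> q y = q (x \<oplus>\<^bsub>M\<^esub> y)" if c: "x \<in> carrier M" "y \<in> carrier M" for x y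
  proof -
    have "s (q x) \<ominus>\<^bsub>M\<^esub> x \<in> D" "s (q y) \<ominus>\<^bsub>M\<^esub> y \<in> D" using s c q_eq by blast+
    then have "(s (q x) \<ominus>\<^bsub>M\<^esub> x) \<oplus>\<^bsub>M\<^esub> (s (q y) \<ominus>\<^bsub>M\<^esub> y) \<in> D" by (rule d(3))
    moreover have "(s (q x) \<ominus>\<^bsub>M\<^esub> x) \<oplus>\<^bsub>M\<^esub> (s (q y) \<ominus>\<^bsub>M\<^esub> y) = (s (q x) \<oplus>\<^bsub>M\<^esub> s (q y)) \<ominus>\<^bsub>M\<^esub> (x \<oplus>\<^bsub>M\<^esub> y)"
      using c s by (simp add: a_minus_def M.minus_add M.a_ac)
    ultimately show ?thesis using q_eq[of "s (q x) \<oplus>\<^bsub>M\<^esub> s (q y)" "x \<oplus>\<^bsub>M\<^esub> y"] c s by (simp add: N_def)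
  qed
  have Nsm: "r \<odot>\<^bsub>N\<^esub> q x = q (r \<odot>\<^bsub>M\<^esub> x)" if c: "r \<in> carrier R" "x \<in> carrier M" for r x
  proof -
    have "s (q x) \<ominus>\<^bsub>M\<^esub> x \<in> D" using s c q_eq by blast
    then have "r \<odot>\<^bsub>M\<^esub> (s (q x) \<ominus>\<^bsub>M\<^esub> x) \<in> D" using d(4) c by blast
    moreover have "r \<odot>\<^bsub>M\<^esub> (s (q x) \<ominus>\<^bsub>M\<^esub> x) = (r \<odot>\<^bsub>M\<^esub> s (q x)) \<ominus>\<^bsub>M\<^esub> (r \<odot>\<^bsub>M\<^esub> x)"
      using c(1) c(2) s(1)[OF c(2)] by (simp add: a_minus_def smult_r_distr smult_minus)
    ultimately have "(r \<odot>\<^bsub>M\<^esub> s (q x)) \<ominus>\<^bsub>M\<^esub> (r \<odot>\<^bsub>M\<^esub> x) \<in> D" by (simp only:)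
    moreover have "r \<odot>\<^bsub>M\<^esub> s (q x) \<in> carrier M" "r \<odot>\<^bsub>M\<^esub> x \<in> carrier M"
      using c s smult_closed by blast+
    ultimately have "q (r \<odot>\<^bsub>M\<^esub> s (q x)) = q (r \<odot>\<^bsub>M\<^esub> x)" using q_eq by blast
    then show ?thesis by (simp add: N_def)
  qed
  have "abelian_group N"
  proof (rule abelian_groupI)
    show "\<exists>y\<in>carrier N. y \<oplus>\<^bsub>N\<^esub> x = \<zero>\<^bsub>N\<^esub>" if xN: "x \<in> carrier N" for x
    proof -
      obtain a where a: "a \<in> carrier M" "x = q a" using xN unfolding Nc by blast
      then have "q (\<ominus>\<^bsub>M\<^esub> a) \<oplus>\<^bsub>N\<^esub> x = \<zero>\<^bsub>N\<^esub>" by (simp add: Nadd Nz M.l_neg)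
      then show ?thesis using a unfolding Nc by blast
    qed
    show "x \<oplus>\<^bsub>N\<^esub> y = y \<oplus>\<^bsub>N\<^esub> x" if xy: "x \<in> carrier N" "y \<in> carrier N" for x y
    proof -
      obtain a b where "a \<in> carrier M" "x = q a" "b \<in> carrier M" "y = q b" using xy unfolding Nc by blast
      then show ?thesis using M.a_comm[of a b] by (simp add: Nadd)
    qed
    show "x \<oplus>\<^bsub>N\<^esub> y \<oplus>\<^bsub>N\<^esub> z = x \<oplus>\<^bsub>N\<^esub> (y \<oplus>\<^bsub>N\<^esub> z)"
      if xyz: "x \<in> carrier N" "y \<in> carrier N" "z \<in> carrier N" for x y z
    proof -
      obtain a b c where "a \<in> carrier M" "x = q a" "b \<in> carrier M" "y = q b" "c \<in> carrier M" "z = q c"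
        using xyz unfolding Nc by blast
      then show ?thesis by (simp add: Nadd M.a_assoc)
    qed
    show "x \<oplus>\<^bsub>N\<^esub> y \<in> carrier N" if "x \<in> carrier N" "y \<in> carrier N" for x y
      using that unfolding Nc by (auto simp: Nadd)
    show "\<zero>\<^bsub>N\<^esub> \<oplus>\<^bsub>N\<^esub> x = x" if "x \<in> carrier N" for x
      using that unfolding Nc Nz by (auto simp: Nadd)
  qed (simp add: Nc Nz)
  then have "right_module R N"
    by (intro right_module.intro right_module_axioms.intro R.ring_axioms)
      (auto simp: Nc Nadd Nsm smult_closed smult_l_distr smult_r_distr smult_assoc smult_one)
  moreover have "q \<in> rmod_hom R M N"
    by (rule rmod_homI) (auto simp: Nc Nadd Nsm)
  moreover have "q x = \<zero>\<^bsub>N\<^esub> \<longleftrightarrow> x \<in> D" if "x \<in> carrier M" for x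
    using q_eq[OF that M.zero_closed] that M.minus_equality[of "\<zero>\<^bsub>M\<^esub>" "\<zero>\<^bsub>M\<^esub>"]
    by (simp add: Nz a_minus_def)
  ultimately show thesis using that Nc by metis
qed

text \<open>
  Baer's criterion. Extensions of \<open>f\<close> are handled as graphs: a submodule \<open>D\<close> of \<open>N \<times> R\<close> that contains the graph of \<open>f\<close>
  and is maximal subject to meeting \<open>0 \<times> R\<close> trivially. Given \<open>x \<in> N\<close>, the pairs \<open>(r, y)\<close> with \<open>(x r, y) \<in> D\<close> form
  the graph of a homomorphism on a right ideal, hence \<open>y = c r\<close> for some \<open>c\<close>, and \<open>(x, c)\<close> can be added to \<open>D\<close>.
\<close>

theorem right_baer_imp_injective:
  fixes R :: "('a, 'r) ring_scheme" (structure) and U :: "'n itself"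
  assumes R: "ring R" and baer: "right_baer R"
  shows "right_self_injective U R"
  unfolding right_self_injective_def injective_module_def
proof (intro conjI allI impI, rule right_module_right_regular[OF R], elim conjE)
  fix N :: "('a, 'n) module" and K
  assume N: "right_module R N" and K: "submodule K R N"
  interpret N: right_module R N by fact
  interpret rr: right_module R "right_regular R" by (rule right_module_right_regular[OF R])
  interpret NK: right_module R "N\<lparr>carrier := K\<rparr>" by (rule N.right_module_restrict[OF K])
  let ?P = "prod_module N (right_regular R)"
  interpret P: right_module R ?P by (rule right_module_prod[OF N rr.right_module_axioms])
  note k = N.submoduleD[OF K]
  show "homs_extend R N K (right_regular R)"
    unfolding homs_extend_def
  proof
    fix f assume f: "f \<in> rmod_hom R (N\<lparr>carrier := K\<rparr>) (right_regular R)"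
    note h = rmod_homD[OF f, simplified]
    have f0: "f \<zero>\<^bsub>N\<^esub> = \<zero>" using NK.hom_zero[OF rr.right_module_axioms f] by simp
    let ?D0 = "(\<lambda>x. (x, f x)) ` K"
    let ?A = "{(\<zero>\<^bsub>N\<^esub>, y) | y. y \<noteq> \<zero>}"
    have D0: "submodule ?D0 R ?P"
    proof (rule P.submoduleI)
      show "\<zero>\<^bsub>?P\<^esub> \<in> ?D0" using k(2) f0 by force
    qed (use k h in auto)
    have "?D0 \<inter> ?A = {}" using f0 by auto
    then obtain D where D: "submodule D R ?P" "?D0 \<subseteq> D" "D \<inter> ?A = {}"
      "\<And>E. submodule E R ?P \<Longrightarrow> D \<subseteq> E \<Longrightarrow> E \<inter> ?A = {} \<Longrightarrow> E = D"
      by (rule P.maximal_submodule_avoiding[OF D0]) blast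
    note dd = P.submoduleD[OF D(1), simplified]
    have zero: "y = \<zero>" if "(\<zero>\<^bsub>N\<^esub>, y) \<in> D" for y using that D(3) by blast
    have neg: "(\<ominus>\<^bsub>N\<^esub> x, \<ominus> y) \<in> D" if xy: "(x, y) \<in> D" for x y
    proof -
      have "x \<in> carrier N" "y \<in> carrier R" using dd(1) xy by auto
      then show ?thesis using dd(4)[OF xy, of "\<ominus> \<one>"] N.smult_minus_one N.R.r_minus by simp
    qed
    have uniq: "y = y'" if xy: "(x, y) \<in> D" "(x, y') \<in> D" for x y y'
    proof -
      have c: "x \<in> carrier N" "y \<in> carrier R" "y' \<in> carrier R" using dd(1) xy by auto
      have "(x \<oplus>\<^bsub>N\<^esub> \<ominus>\<^bsub>N\<^esub> x, y \<oplus> \<ominus> y') \<in> D" using dd(3)[OF xy(1) neg[OF xy(2)]] by simp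
      then have "y \<ominus> y' = \<zero>" using zero c by (simp add: N.M.r_neg a_minus_def)
      then show ?thesis using c by simp
    qed
    have total: "\<exists>y. (x, y) \<in> D" if x: "x \<in> carrier N" for x
    proof -
      let ?S = "{(r, y). r \<in> carrier R \<and> (r \<odot>\<^bsub>N\<^esub> x, y) \<in> D}"
      obtain c where c: "c \<in> carrier R" "\<And>r y. (r, y) \<in> ?S \<Longrightarrow> y = c \<otimes> r"
      proof (rule N.R.right_baer_relation[OF baer, of ?S])
        show "?S \<subseteq> carrier R \<times> carrier R" using dd(1) by auto
        show "(\<zero>, \<zero>) \<in> ?S" using dd(2) N.smult_zero[OF x] by simp
        show "(r \<oplus> r', y \<oplus> y') \<in> ?S" if "(r, y) \<in> ?S" "(r', y') \<in> ?S" for r y r' y'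
          using that dd(3)[of "(r \<odot>\<^bsub>N\<^esub> x, y)" "(r' \<odot>\<^bsub>N\<^esub> x, y')"] x by (simp add: N.smult_l_distr)
        show "(r \<otimes> s, y \<otimes> s) \<in> ?S" if "(r, y) \<in> ?S" "s \<in> carrier R" for r y s
          using that dd(4)[of "(r \<odot>\<^bsub>N\<^esub> x, y)" s] x by (simp add: N.smult_assoc)
        show "y = \<zero>" if "(\<zero>, y) \<in> ?S" for y
          using that zero N.smult_zero[OF x] by simp
      qed (rule that)
      let ?C = "(\<lambda>r. r \<odot>\<^bsub>?P\<^esub> (x, c)) ` carrier R"
      have xc: "(x, c) \<in> carrier ?P" using x c by simp
      have C: "submodule ?C R ?P" by (rule P.submodule_cyclic[OF xc])
      have E: "submodule (D <+>\<^bsub>?P\<^esub> ?C) R ?P" by (rule P.submodule_sum[OF D(1) C])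
      have "(D <+>\<^bsub>?P\<^esub> ?C) \<inter> ?A = {}"
      proof (rule ccontr)
        assume "(D <+>\<^bsub>?P\<^esub> ?C) \<inter> ?A \<noteq> {}"
        then obtain y where y: "(\<zero>\<^bsub>N\<^esub>, y) \<in> D <+>\<^bsub>?P\<^esub> ?C" "y \<noteq> \<zero>" by blast
        from y(1) obtain p p' where "p \<in> D" "p' \<in> ?C" "(\<zero>\<^bsub>N\<^esub>, y) = p \<oplus>\<^bsub>?P\<^esub> p'" unfolding set_add_iff by blast
        then obtain u v r where uv: "(u, v) \<in> D" "r \<in> carrier R"
          "\<zero>\<^bsub>N\<^esub> = u \<oplus>\<^bsub>N\<^esub> r \<odot>\<^bsub>N\<^esub> x" "y = v \<oplus> c \<otimes> r" by (cases p) auto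
        have cc: "u \<in> carrier N" "v \<in> carrier R" "r \<odot>\<^bsub>N\<^esub> x \<in> carrier N"
          using dd(1) uv x N.smult_closed by auto
        have "r \<odot>\<^bsub>N\<^esub> x = \<ominus>\<^bsub>N\<^esub> u" using N.M.minus_equality[of "r \<odot>\<^bsub>N\<^esub> x" u] uv(3) cc by (simp add: N.M.a_comm)
        then have "(r, \<ominus> v) \<in> ?S" using neg[OF uv(1)] uv(2) by simp
        then have "c \<otimes> r = \<ominus> v" by (rule c(2)[symmetric])
        then have "y = \<zero>" using uv(4) cc N.R.r_neg by simp
        then show False using y by blast
      qed
      then have "D <+>\<^bsub>?P\<^esub> ?C = D" using D(4)[OF E P.submodule_sum_upper(1)[OF D(1) C]] by blast
      then have "?C \<subseteq> D" using P.submodule_sum_upper(2)[OF D(1) C] by simp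
      moreover have "\<one> \<odot>\<^bsub>?P\<^esub> (x, c) \<in> ?C" by (rule imageI) simp
      ultimately have "\<one> \<odot>\<^bsub>?P\<^esub> (x, c) \<in> D" by blast
      then have "(x, c) \<in> D" using P.smult_one[OF xc] by simp
      then show ?thesis by blast
    qed
    \<comment> \<open>So \<open>D\<close> is the graph of a map defined on all of \<open>N\<close>.\<close>
    define g where "g x = (THE y. (x, y) \<in> D)" for x
    have gD: "(x, g x) \<in> D" if "x \<in> carrier N" for x
      unfolding g_def using total[OF that] uniq by (metis (no_types, lifting) theI)
    have g: "g x = y" if "(x, y) \<in> D" for x y
      using gD uniq that dd(1) by blast
    have "g \<in> rmod_hom R N (right_regular R)"
    proof (rule rmod_homI)
      show "g x \<in> carrier (right_regular R)" if "x \<in> carrier N" for x using gD[OF that] dd(1) by auto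
      show "g (x \<oplus>\<^bsub>N\<^esub> y) = g x \<oplus>\<^bsub>right_regular R\<^esub> g y" if "x \<in> carrier N" "y \<in> carrier N" for x y
        using g dd(3)[OF gD[OF that(1)] gD[OF that(2)]] by simp
      show "g (r \<odot>\<^bsub>N\<^esub> x) = r \<odot>\<^bsub>right_regular R\<^esub> g x" if "r \<in> carrier R" "x \<in> carrier N" for r x
        using g dd(4)[OF gD[OF that(2)] that(1)] by simp
    qed
    moreover have "\<forall>x\<in>K. g x = f x" using g D(2) by blast
    ultimately show "\<exists>g\<in>rmod_hom R N (right_regular R). \<forall>x\<in>K. g x = f x" by blast
  qed
qed

theorem injective_imp_right_baer:
  fixes R :: "('a, 'r) ring_scheme" (structure) and e :: "'a \<Rightarrow> 'n"
  assumes R: "ring R" and inj: "right_self_injective TYPE('n) R" and e: "inj_on e (carrier R)"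
  shows "right_baer R"
proof -
  interpret rr: right_module R "right_regular R" by (rule right_module_right_regular[OF R])
  obtain N :: "('a, 'n) module" and q where N: "right_module R N" and q: "q \<in> rmod_hom R (right_regular R) N"
    "q ` carrier (right_regular R) = carrier N"
    "\<And>x. x \<in> carrier (right_regular R) \<Longrightarrow> q x = \<zero>\<^bsub>N\<^esub> \<longleftrightarrow> x \<in> {\<zero>\<^bsub>right_regular R\<^esub>}"
    by (rule rr.quotient_module[OF rr.submodule_zero, of e]) (use e in auto)
  interpret N: right_module R N by fact
  note h = rmod_homD[OF q(1), simplified]
  have qinj: "x = y" if "x \<in> carrier R" "y \<in> carrier R" "q x = q y" for x y
  proof -
    have "q (x \<ominus>\<^bsub>right_regular R\<^esub> y) = q x \<ominus>\<^bsub>N\<^esub> q y" by (rule rr.hom_diff[OF N q(1)]) (use that in auto)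
    then have "q (x \<ominus>\<^bsub>right_regular R\<^esub> y) = \<zero>\<^bsub>N\<^esub>" using that h by (simp add: a_minus_def N.M.r_neg)
    then have "x \<ominus>\<^bsub>right_regular R\<^esub> y = \<zero>" using q(3) that rr.M.minus_closed by simp
    moreover have "\<ominus>\<^bsub>right_regular R\<^esub> y = \<ominus> y"
      using rr.M.minus_equality[of "\<ominus> y" y] that rr.R.l_neg by simp
    ultimately show ?thesis using that by (simp add: a_minus_def[of "right_regular R"]) (simp add: a_minus_def[symmetric])
  qed
  show ?thesis unfolding right_baer_def
  proof (intro allI impI, elim conjE)
    fix I f assume I: "right_ideal R I" and f: "f \<in> I \<rightarrow> carrier R"
      "\<forall>x\<in>I. \<forall>y\<in>I. f (x \<oplus> y) = f x \<oplus> f y"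
      "\<forall>x\<in>I. \<forall>r\<in>carrier R. f (x \<otimes> r) = f x \<otimes> r"
    note cI = right_idealD(5)[OF I]
    have K: "submodule (q ` I) R N"
      by (rule rr.submodule_image[OF N q(1)]) (use I in \<open>simp add: submodule_right_regular[OF R]\<close>)
    define f' where "f' u = f (inv_into (carrier R) q u)" for u
    have qi: "inj_on q (carrier R)" using qinj by (auto intro: inj_onI)
    have f': "f' (q x) = f x" if "x \<in> I" for x
      unfolding f'_def using inv_into_f_f[OF qi cI[OF that]] by simp
    have "f' \<in> rmod_hom R (N\<lparr>carrier := q ` I\<rparr>) (right_regular R)"
    proof (rule rmod_homI)
      show "f' u \<in> carrier (right_regular R)" if "u \<in> carrier (N\<lparr>carrier := q ` I\<rparr>)" for u
        using that f' f(1) by auto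
      show "f' (u \<oplus>\<^bsub>N\<lparr>carrier := q ` I\<rparr>\<^esub> v) = f' u \<oplus>\<^bsub>right_regular R\<^esub> f' v"
        if uv: "u \<in> carrier (N\<lparr>carrier := q ` I\<rparr>)" "v \<in> carrier (N\<lparr>carrier := q ` I\<rparr>)" for u v
      proof -
        obtain x y where xy: "x \<in> I" "y \<in> I" "u = q x" "v = q y" using uv by auto
        then have "u \<oplus>\<^bsub>N\<^esub> v = q (x \<oplus> y)" using h(2) cI by simp
        then show ?thesis using f'[OF right_idealD(3)[OF I xy(1,2)]] f' f(2) xy by simp
      qed
      show "f' (r \<odot>\<^bsub>N\<lparr>carrier := q ` I\<rparr>\<^esub> u) = r \<odot>\<^bsub>right_regular R\<^esub> f' u"
        if ru: "r \<in> carrier R" "u \<in> carrier (N\<lparr>carrier := q ` I\<rparr>)" for r u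
      proof -
        obtain x where x: "x \<in> I" "u = q x" using ru by auto
        then have "r \<odot>\<^bsub>N\<^esub> u = q (x \<otimes> r)" using h(3) cI ru by simp
        then show ?thesis using f'[OF right_idealD(4)[OF I x(1) ru(1)]] f' f(3) x ru by simp
      qed
    qed
    then obtain g where g: "g \<in> rmod_hom R N (right_regular R)" "\<forall>u\<in>q ` I. g u = f' u"
      using inj N K unfolding right_self_injective_def injective_module_def homs_extend_def by blast
    have "f x = g (q \<one>) \<otimes> x" if x: "x \<in> I" for x
    proof -
      have "f x = g (q x)" using g(2) f'[OF x] x by simp
      also have "q x = x \<odot>\<^bsub>N\<^esub> q \<one>" using h(3)[of x "\<one>"] cI[OF x] by simp
      also have "g \<dots> = g (q \<one>) \<otimes> x" using rmod_homD(3)[OF g(1) cI[OF x]] h(1) by simp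
      finally show ?thesis .
    qed
    moreover have "g (q \<one>) \<in> carrier R" using rmod_homD(1)[OF g(1)] h(1) by simp
    ultimately show "\<exists>c\<in>carrier R. \<forall>x\<in>I. f x = c \<otimes> x" by blast
  qed
qed

section \<open>Strong ss-injectivity\<close>

text \<open>
  By \<open>simple_over_right_ideal\<close> over the zero ideal, every nonzero right ideal contains a simple one.
\<close>

lemma (in ring) essential_socle:
  assumes ss: "right_semisimple_mod R Z" and Z: "two_sided R Z" and nil: "nilpotent R Z"
  shows "essential_submodule R (right_regular R) (socle R (right_regular R))"
proof -
  interpret rr: right_module R "right_regular R" by (rule right_module_right_regular[OF ring_axioms])
  have "socle R (right_regular R) \<inter> L \<noteq> {\<zero>}" if L: "right_ideal R L" "L \<noteq> {\<zero>}" for L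
  proof -
    have "\<not> L \<subseteq> {\<zero>}" using L right_idealD(2)[OF L(1)] by blast
    then obtain a where a: "a \<in> L" "a \<notin> {\<zero>}"
      "\<And>r. r \<in> carrier R \<Longrightarrow> a \<otimes> r \<notin> {\<zero>} \<Longrightarrow> \<exists>s\<in>carrier R. a \<ominus> a \<otimes> r \<otimes> s \<in> {\<zero>}"
      by (rule simple_over_right_ideal[OF ss Z nil right_ideal_zero L(1)]) blast
    have ac: "a \<in> carrier R" by (rule right_idealD(5)[OF L(1) a(1)])
    let ?V = "(\<lambda>r. a \<otimes> r) ` carrier R"
    have aV: "a \<in> ?V" by (rule principal_self[OF ac])
    have "B = {\<zero>} \<or> B = ?V" if B: "right_ideal R B" "B \<subseteq> ?V" for B
    proof (rule disjCI)
      assume "B \<noteq> ?V"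
      show "B = {\<zero>}"
      proof (rule ccontr)
        assume "B \<noteq> {\<zero>}"
        then obtain b where b: "b \<in> B" "b \<noteq> \<zero>" using right_idealD(2)[OF B(1)] by blast
        then obtain r where r: "r \<in> carrier R" "b = a \<otimes> r" using B(2) by blast
        then obtain s where s: "s \<in> carrier R" "a \<ominus> a \<otimes> r \<otimes> s = \<zero>" using a(3) b by blast
        then have "a = b \<otimes> s" using ac r by simp
        then have "a \<in> B" using right_idealD(4)[OF B(1) b(1) s(1)] by simp
        then have "?V \<subseteq> B" using right_idealD(4)[OF B(1)] by blast
        then show False using B(2) \<open>B \<noteq> ?V\<close> by blast
      qed
    qed
    moreover have "?V \<noteq> {\<zero>}" using aV a(2) by blast
    ultimately have "simple_submodule R (right_regular R) ?V"
      using right_ideal_principal[OF ac]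
      by (simp add: simple_submodule_def submodule_right_regular[OF ring_axioms])
    then have "a \<in> socle R (right_regular R)" using rr.simple_subset_socle aV by blast
    then show ?thesis using a by blast
  qed
  then show ?thesis
    using rr.submodule_socle by (simp add: essential_submodule_def submodule_right_regular[OF ring_axioms])
qed

text \<open>
  The submodules inside \<open>j R\<close> inherit the maximum condition from the right ideals of \<open>R\<close>, even if \<open>M\<close> is large.
\<close>

lemma (in right_module) maximal_submodule_within:
  assumes noeth: "right_noetherian R" and j: "j \<in> rmod_hom R (right_regular R) M"
    and P: "\<And>T. P T \<Longrightarrow> submodule T R M \<and> T \<subseteq> j ` carrier R" and T0: "P T0"
  obtains T where "P T" "\<And>T'. P T' \<Longrightarrow> T \<subseteq> T' \<Longrightarrow> T' = T"
proof -
  interpret rr: right_module R "right_regular R" by (rule right_module_right_regular[OF R.ring_axioms])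
  let ?pre = "\<lambda>T. {r \<in> carrier R. j r \<in> T}"
  have pre: "right_ideal R (?pre T)" "j ` ?pre T = T" if "P T" for T
    using rr.submodule_preimage[OF right_module_axioms j, of T] P[OF that]
    by (auto simp: submodule_right_regular[OF R.ring_axioms])
  let ?Q = "\<lambda>I. right_ideal R I \<and> P (j ` I)"
  have Q0: "?Q (?pre T0)" using pre[OF T0] T0 by simp
  have Qr: "right_ideal R I" if "?Q I" for I using that by blast
  obtain I where I: "?Q I" "\<And>J. ?Q J \<Longrightarrow> I \<subseteq> J \<Longrightarrow> J = I"
    by (rule right_noetherian_maximal[OF R.ring_axioms noeth, of ?Q, OF Qr Q0]) simp_all
  have Ir: "right_ideal R I" and PI: "P (j ` I)" using I(1) by simp_all
  have "T' = j ` I" if T': "P T'" "j ` I \<subseteq> T'" for T'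
  proof -
    have "I \<subseteq> ?pre T'" using T'(2) right_idealD(5)[OF Ir] by blast
    moreover have "?Q (?pre T')" using pre[OF T'(1)] T'(1) by simp
    ultimately have "?pre T' = I" using I(2) by blast
    then show ?thesis using pre(2)[OF T'(1)] by simp
  qed
  with PI show thesis by (rule that)
qed

text \<open>
  Simple submodules of \<open>M\<close> lie in \<open>j R\<close>. Let \<open>K\<close> be a maximal semisimple small submodule; as small submodules are
  closed under sums, \<open>K\<close> contains every small simple submodule. Let \<open>T \<subseteq> j R\<close> be a maximal submodule with
  \<open>T \<inter> K = 0\<close> that is the image of an idempotent \<open>\<pi>\<close>. Then \<open>K + T\<close> contains every simple \<open>V\<close>: otherwise
  \<open>W = (\<one> - \<pi>) V\<close> is simple and not small, so it is a direct summand, and \<open>T + W\<close> would be larger than \<open>T\<close>.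
  Also \<open>\<pi> K = 0\<close>, because \<open>\<pi>\<close> maps small simple submodules into \<open>K \<inter> T\<close>. If \<open>g\<close> extends the inverse of \<open>j\<close> on
  \<open>K\<close>, then \<open>\<phi> = j\<^sup>-\<^sup>1 \<pi> + g (\<one> - \<pi>)\<close> inverts \<open>j\<close> on \<open>K + T\<close>.
\<close>

theorem (in right_module) essential_extension_hom:
  assumes noeth: "right_noetherian R"
    and j: "j \<in> rmod_hom R (right_regular R) M" "inj_on j (carrier R)"
    and ess: "\<And>V. submodule V R M \<Longrightarrow> V \<noteq> {\<zero>\<^bsub>M\<^esub>} \<Longrightarrow> V \<inter> j ` carrier R \<noteq> {\<zero>\<^bsub>M\<^esub>}"
    and ext: "\<And>K. semisimple_module R (M\<lparr>carrier := K\<rparr>) \<Longrightarrow> small_submodule R M K \<Longrightarrow>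
      homs_extend R M K (right_regular R)"
  obtains \<phi> where "\<phi> \<in> rmod_hom R M (right_regular R)"
    "\<And>V s. simple_submodule R (right_regular R) V \<Longrightarrow> s \<in> V \<Longrightarrow> \<phi> (j s) = s"
proof -
  interpret rr: right_module R "right_regular R" by (rule right_module_right_regular[OF R.ring_axioms])
  note jh = rmod_homD[OF j(1), simplified]
  let ?J = "j ` carrier R"
  have J: "submodule ?J R M"
    using rr.submodule_image[OF right_module_axioms j(1) rr.submodule_carrier] by simp
  have VJ: "V \<subseteq> ?J" if V: "simple_submodule R M V" for V
    using ess[OF simple_submoduleD(1,2)[OF V]] simple_Int[OF V J] by blast
  define ji where "ji = inv_into (carrier R) j"
  have ji: "ji (j r) = r" if "r \<in> carrier R" for r
    unfolding ji_def by (rule inv_into_f_f[OF j(2) that])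
  have ji_hom: "ji \<in> rmod_hom R (M\<lparr>carrier := K\<rparr>) (right_regular R)" if K: "K \<subseteq> ?J" for K
  proof (rule rmod_homI)
    show "ji x \<in> carrier (right_regular R)" if x: "x \<in> carrier (M\<lparr>carrier := K\<rparr>)" for x
      using x K ji by auto
    show "ji (x \<oplus>\<^bsub>M\<lparr>carrier := K\<rparr>\<^esub> y) = ji x \<oplus>\<^bsub>right_regular R\<^esub> ji y"
      if xy: "x \<in> carrier (M\<lparr>carrier := K\<rparr>)" "y \<in> carrier (M\<lparr>carrier := K\<rparr>)" for x y
    proof -
      have "x \<in> ?J" "y \<in> ?J" using xy K by auto
      then obtain r s where "r \<in> carrier R" "x = j r" "s \<in> carrier R" "y = j s" by blast
      then show ?thesis using ji[of "r \<oplus> s"] ji[of r] ji[of s] jh(2)[of r s] by simp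
    qed
    show "ji (r \<odot>\<^bsub>M\<lparr>carrier := K\<rparr>\<^esub> x) = r \<odot>\<^bsub>right_regular R\<^esub> ji x"
      if rx: "r \<in> carrier R" "x \<in> carrier (M\<lparr>carrier := K\<rparr>)" for r x
    proof -
      have "x \<in> ?J" using rx K by auto
      then obtain s where "s \<in> carrier R" "x = j s" by blast
      then show ?thesis using ji[of "s \<otimes> r"] ji[of s] jh(3)[of r s] rx(1) by simp
    qed
  qed
  let ?PK = "\<lambda>K. submodule K R M \<and> K \<subseteq> ?J \<and> small_submodule R M K \<and> semisimple_module R (M\<lparr>carrier := K\<rparr>)"
  have "?PK {\<zero>\<^bsub>M\<^esub>}"
    using submodule_zero small_zero submoduleD(2)[OF J] submoduleD(2) semisimple_restrict[OF submodule_zero] by auto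
  then obtain K where PK: "?PK K" and Kmax: "\<And>T. ?PK T \<Longrightarrow> K \<subseteq> T \<Longrightarrow> T = K"
    by (rule maximal_submodule_within[OF noeth j(1), of ?PK, rotated]) blast+
  then have K: "submodule K R M" "K \<subseteq> ?J" "small_submodule R M K" "semisimple_module R (M\<lparr>carrier := K\<rparr>)"
    by auto
  have Ksemi: "K \<subseteq> L" if "submodule L R M" "\<And>V. simple_submodule R M V \<Longrightarrow> V \<subseteq> K \<Longrightarrow> V \<subseteq> L" for L
    using K(4) that unfolding semisimple_restrict[OF K(1)] by blast
  have small_in: "V \<subseteq> K" if V: "simple_submodule R M V" "small_submodule R M V" for V
  proof -
    have Vs: "submodule V R M" by (rule simple_submoduleD(1)[OF V(1)])
    have KV: "submodule (K <+>\<^bsub>M\<^esub> V) R M" by (rule submodule_sum[OF K(1) Vs])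
    have up: "K \<subseteq> K <+>\<^bsub>M\<^esub> V" "V \<subseteq> K <+>\<^bsub>M\<^esub> V" by (rule submodule_sum_upper[OF K(1) Vs])+
    have "semisimple_module R (M\<lparr>carrier := K <+>\<^bsub>M\<^esub> V\<rparr>)"
      unfolding semisimple_restrict[OF KV]
    proof (intro allI impI, elim conjE)
      fix L assume L: "submodule L R M" "\<forall>W. simple_submodule R M W \<and> W \<subseteq> K <+>\<^bsub>M\<^esub> V \<longrightarrow> W \<subseteq> L"
      have "K \<subseteq> L" using Ksemi[OF L(1)] L(2) up by blast
      moreover have "V \<subseteq> L" using L(2) V(1) up by blast
      ultimately show "K <+>\<^bsub>M\<^esub> V \<subseteq> L" by (rule submodule_sum_least[OF L(1)])
    qed
    then have "?PK (K <+>\<^bsub>M\<^esub> V)"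
      using KV small_sum[OF K(3) V(2)] submodule_sum_least[OF J K(2) VJ[OF V(1)]] by blast
    then have "K <+>\<^bsub>M\<^esub> V = K" using Kmax up by blast
    then show ?thesis using up by blast
  qed
  let ?PT = "\<lambda>T. submodule T R M \<and> T \<subseteq> ?J \<and> T \<inter> K = {\<zero>\<^bsub>M\<^esub>} \<and>
    (\<exists>\<pi>\<in>rmod_hom R M M. (\<forall>x\<in>carrier M. \<pi> x \<in> T) \<and> (\<forall>t\<in>T. \<pi> t = t))"
  have "(\<lambda>x. \<zero>\<^bsub>M\<^esub>) \<in> rmod_hom R M M"
    using submoduleD(4)[OF submodule_zero, of "\<zero>\<^bsub>M\<^esub>"] by (auto intro!: rmod_homI)
  then have "?PT {\<zero>\<^bsub>M\<^esub>}"
    using submodule_zero submoduleD(2)[OF J] submoduleD(2)[OF K(1)] by auto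
  then obtain T where PT: "?PT T" and Tmax: "\<And>T'. ?PT T' \<Longrightarrow> T \<subseteq> T' \<Longrightarrow> T' = T"
    by (rule maximal_submodule_within[OF noeth j(1), of ?PT, rotated]) blast+
  then obtain \<pi> where T: "submodule T R M" "T \<subseteq> ?J" "T \<inter> K = {\<zero>\<^bsub>M\<^esub>}"
    and \<pi>: "\<pi> \<in> rmod_hom R M M" "\<And>x. x \<in> carrier M \<Longrightarrow> \<pi> x \<in> T" "\<And>t. t \<in> T \<Longrightarrow> \<pi> t = t" by blast
  note cT = submoduleD(5)[OF T(1)] and cK = submoduleD(5)[OF K(1)]
  have KT: "submodule (K <+>\<^bsub>M\<^esub> T) R M" by (rule submodule_sum[OF K(1) T(1)])
  define \<sigma> where "\<sigma> x = x \<ominus>\<^bsub>M\<^esub> \<pi> x" for x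
  have \<sigma>: "\<sigma> \<in> rmod_hom R M M"
    unfolding \<sigma>_def by (rule rmod_hom_diff[OF right_module_axioms rmod_hom_id \<pi>(1)])
  note \<sigma>h = rmod_homD[OF \<sigma>]
  have \<sigma>T: "\<sigma> t = \<zero>\<^bsub>M\<^esub>" if "t \<in> T" for t
    unfolding \<sigma>_def using \<pi>(3)[OF that] cT[OF that] by (simp add: a_minus_def M.r_neg)
  have split: "x = \<sigma> x \<oplus>\<^bsub>M\<^esub> \<pi> x" if "x \<in> carrier M" for x
    unfolding \<sigma>_def using that cT[OF \<pi>(2)[OF that]] by (simp add: a_minus_def M.a_assoc M.l_neg)
  have all: "V \<subseteq> K <+>\<^bsub>M\<^esub> T" if V: "simple_submodule R M V" for V
  proof (rule ccontr)
    assume no: "\<not> V \<subseteq> K <+>\<^bsub>M\<^esub> T"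
    note Vs = simple_submoduleD(1)[OF V]
    let ?W = "\<sigma> ` V"
    have Wno: "\<not> ?W \<subseteq> K <+>\<^bsub>M\<^esub> T"
    proof
      assume W: "?W \<subseteq> K <+>\<^bsub>M\<^esub> T"
      have "V \<subseteq> K <+>\<^bsub>M\<^esub> T"
      proof
        fix v assume v: "v \<in> V"
        have vc: "v \<in> carrier M" by (rule submoduleD(5)[OF Vs v])
        have "\<sigma> v \<in> K <+>\<^bsub>M\<^esub> T" using W v by blast
        moreover have "\<pi> v \<in> K <+>\<^bsub>M\<^esub> T" using \<pi>(2)[OF vc] submodule_sum_upper(2)[OF K(1) T(1)] by blast
        ultimately show "v \<in> K <+>\<^bsub>M\<^esub> T" using submoduleD(3)[OF KT] split[OF vc] by metis
      qed
      then show False using no by blast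
    qed
    have "?W \<noteq> {\<zero>\<^bsub>M\<^esub>}" using Wno submoduleD(2)[OF KT] by (metis empty_subsetI insert_subset)
    then have W: "simple_submodule R M ?W"
      using simple_submodule_image[OF right_module_axioms \<sigma> V] by blast
    note Ws = simple_submoduleD(1)[OF W]
    have "\<not> small_submodule R M ?W"
      using small_in[OF W] Wno submodule_sum_upper(1)[OF K(1) T(1)] by blast
    then obtain L where L: "submodule L R M" "L \<noteq> carrier M" "?W <+>\<^bsub>M\<^esub> L = carrier M"
      using Ws unfolding small_submodule_def by blast
    have "\<not> ?W \<subseteq> L"
    proof
      assume "?W \<subseteq> L"
      then have "?W <+>\<^bsub>M\<^esub> L \<subseteq> L" using submodule_sum_least[OF L(1)] by blast
      then show False using L submoduleD(1)[OF L(1)] by blast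
    qed
    then have "?W \<inter> L = {\<zero>\<^bsub>M\<^esub>}" by (rule simple_Int[OF W L(1)])
    then obtain \<rho> where \<rho>: "\<rho> \<in> rmod_hom R M M" "\<And>x. x \<in> carrier M \<Longrightarrow> \<rho> x \<in> ?W" "\<And>v. v \<in> ?W \<Longrightarrow> \<rho> v = v"
      by (rule complement_projection[OF Ws L(1) _ L(3)]) blast
    let ?T = "T <+>\<^bsub>M\<^esub> ?W"
    have Ts: "submodule ?T R M" by (rule submodule_sum[OF T(1) Ws])
    have up: "T \<subseteq> ?T" "?W \<subseteq> ?T" by (rule submodule_sum_upper[OF T(1) Ws])+
    let ?\<pi> = "\<lambda>x. \<pi> x \<oplus>\<^bsub>M\<^esub> \<rho> (\<sigma> x)"
    have hom: "?\<pi> \<in> rmod_hom R M M"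
      by (rule rmod_hom_add[OF right_module_axioms \<pi>(1) rmod_hom_compose[OF \<sigma> \<rho>(1)]])
    have into: "?\<pi> x \<in> ?T" if "x \<in> carrier M" for x
      using set_addI[OF \<pi>(2)[OF that] \<rho>(2)[OF \<sigma>h(1)[OF that]]] .
    \<comment> \<open>The map \<open>\<sigma> = \<one> - \<pi>\<close> is idempotent and kills \<open>T\<close>, hence fixes \<open>W\<close>, and so does \<open>\<rho>\<close>.\<close>
    have fixed: "?\<pi> x = x" if x: "x \<in> ?T" for x
    proof -
      obtain t v where tv: "t \<in> T" "v \<in> V" "x = t \<oplus>\<^bsub>M\<^esub> \<sigma> v" using x by (auto simp: set_add_iff)
      have c: "t \<in> carrier M" "v \<in> carrier M" "\<sigma> v \<in> carrier M" "\<pi> v \<in> carrier M"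
        using cT[OF tv(1)] submoduleD(5)[OF Vs tv(2)] \<sigma>h(1) cT[OF \<pi>(2)] by auto
      have "\<pi> (\<sigma> v) = \<pi> v \<ominus>\<^bsub>M\<^esub> \<pi> (\<pi> v)"
        unfolding \<sigma>_def by (rule hom_diff[OF right_module_axioms \<pi>(1) c(2,4)])
      then have \<pi>\<sigma>: "\<pi> (\<sigma> v) = \<zero>\<^bsub>M\<^esub>" using \<pi>(3)[OF \<pi>(2)[OF c(2)]] c by (simp add: a_minus_def M.r_neg)
      have "\<sigma> (\<sigma> v) = \<sigma> v \<ominus>\<^bsub>M\<^esub> \<pi> (\<sigma> v)" by (simp add: \<sigma>_def)
      then have \<sigma>\<sigma>: "\<sigma> (\<sigma> v) = \<sigma> v" unfolding \<pi>\<sigma> using c M.minus_equality[of "\<zero>\<^bsub>M\<^esub>" "\<zero>\<^bsub>M\<^esub>"] by (simp add: a_minus_def)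
      have "\<pi> x = t" unfolding tv(3) using rmod_homD(2)[OF \<pi>(1) c(1,3)] \<pi>\<sigma> \<pi>(3)[OF tv(1)] c by simp
      moreover have "\<sigma> x = \<sigma> v" unfolding tv(3) using \<sigma>h(2)[OF c(1,3)] \<sigma>\<sigma> \<sigma>T[OF tv(1)] c by simp
      ultimately show ?thesis using \<rho>(3)[of "\<sigma> v"] tv by simp
    qed
    have "?T \<inter> K = {\<zero>\<^bsub>M\<^esub>}"
    proof -
      have "x = \<zero>\<^bsub>M\<^esub>" if x: "x \<in> ?T" "x \<in> K" for x
      proof -
        obtain t w where tw: "t \<in> T" "w \<in> ?W" "x = t \<oplus>\<^bsub>M\<^esub> w" using x(1) by (auto simp: set_add_iff)
        have c: "t \<in> carrier M" "w \<in> carrier M" using cT tw submoduleD(5)[OF Ws] by auto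
        have "w = x \<oplus>\<^bsub>M\<^esub> \<ominus>\<^bsub>M\<^esub> t" unfolding tw(3) using c by (simp add: M.a_comm[of t w] M.a_assoc M.r_neg)
        then have "w \<in> K <+>\<^bsub>M\<^esub> T" using set_addI[OF x(2) submoduleD(6)[OF T(1) tw(1)], of M] by simp
        then have "w = \<zero>\<^bsub>M\<^esub>" using simple_Int[OF W KT Wno] tw(2) by blast
        then have "x = t" using tw c by simp
        then show ?thesis using T(3) tw(1) x(2) by blast
      qed
      then show ?thesis using submoduleD(2)[OF Ts] submoduleD(2)[OF K(1)] by blast
    qed
    then have "?PT ?T"
      by (intro conjI Ts submodule_sum_least[OF J T(2) VJ[OF W]] bexI[OF _ hom] ballI into fixed)
    then have "?T = T" using Tmax up by blast
    then show False using up Wno submodule_sum_upper(2)[OF K(1) T(1)] by blast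
  qed
  have \<pi>K: "\<pi> k = \<zero>\<^bsub>M\<^esub>" if k: "k \<in> K" for k
  proof -
    have "K \<subseteq> {x \<in> carrier M. \<pi> x \<in> K}"
    proof (rule Ksemi[OF submodule_preimage[OF right_module_axioms \<pi>(1) K(1)]])
      fix V assume V: "simple_submodule R M V" "V \<subseteq> K"
      note Vs = simple_submoduleD(1)[OF V(1)]
      have "small_submodule R M (\<pi> ` V)" by (rule small_image[OF \<pi>(1) small_subset[OF K(3) Vs V(2)]])
      then have "\<pi> ` V \<subseteq> K"
        using simple_submodule_image[OF right_module_axioms \<pi>(1) V(1)] small_in submoduleD(2)[OF K(1)]
        by (metis empty_subsetI insert_subset)
      then show "V \<subseteq> {x \<in> carrier M. \<pi> x \<in> K}" using submoduleD(5)[OF Vs] by blast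
    qed
    then have "\<pi> k \<in> K" using k by blast
    then show ?thesis using \<pi>(2)[OF cK[OF k]] T(3) by blast
  qed
  obtain g where g: "g \<in> rmod_hom R M (right_regular R)" "\<And>k. k \<in> K \<Longrightarrow> g k = ji k"
    using ext[OF K(4,3)] ji_hom[OF K(2)] unfolding homs_extend_def by blast
  define \<phi> where "\<phi> x = ji (\<pi> x) \<oplus>\<^bsub>right_regular R\<^esub> g (\<sigma> x)" for x
  have ji\<pi>: "(\<lambda>x. ji (\<pi> x)) \<in> rmod_hom R M (right_regular R)"
  proof (rule rmod_hom_compose[OF _ ji_hom[OF T(2)]])
    show "\<pi> \<in> rmod_hom R M (M\<lparr>carrier := T\<rparr>)"
      by (rule rmod_homI) (use \<pi>(2) rmod_homD[OF \<pi>(1)] in auto)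
  qed
  have "\<phi> \<in> rmod_hom R M (right_regular R)"
    unfolding \<phi>_def by (rule rmod_hom_add[OF rr.right_module_axioms ji\<pi> rmod_hom_compose[OF \<sigma> g(1)]])
  moreover have "\<phi> (j s) = s" if V: "simple_submodule R (right_regular R) V" and s: "s \<in> V" for V s
  proof -
    have sc: "s \<in> carrier R" using rr.submoduleD(5)[OF rr.simple_submoduleD(1)[OF V] s] by simp
    have js: "j s \<in> carrier M" by (rule jh(1)[OF sc])
    have "j ` V \<subseteq> K <+>\<^bsub>M\<^esub> T"
      using rr.simple_submodule_image[OF right_module_axioms j(1) V] all submoduleD(2)[OF KT]
      by (metis empty_subsetI insert_subset)
    then obtain k t where kt: "k \<in> K" "t \<in> T" "j s = k \<oplus>\<^bsub>M\<^esub> t" using s by (auto simp: set_add_iff image_subset_iff)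
    have c: "k \<in> carrier M" "t \<in> carrier M" using cK kt(1) cT kt(2) by auto
    have "\<pi> (j s) = t" unfolding kt(3) using rmod_homD(2)[OF \<pi>(1) c] \<pi>K[OF kt(1)] \<pi>(3)[OF kt(2)] c by simp
    moreover have "\<sigma> k = k" unfolding \<sigma>_def \<pi>K[OF kt(1)]
      using c M.minus_equality[of "\<zero>\<^bsub>M\<^esub>" "\<zero>\<^bsub>M\<^esub>"] by (simp add: a_minus_def)
    then have "\<sigma> (j s) = k" unfolding kt(3) using \<sigma>h(2)[OF c] \<sigma>T[OF kt(2)] c by simp
    ultimately have "\<phi> (j s) = ji t \<oplus> ji k" using g(2)[OF kt(1)] by (simp add: \<phi>_def)
    moreover obtain a b where ab: "a \<in> carrier R" "k = j a" "b \<in> carrier R" "t = j b" using kt K(2) T(2) by blast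
    moreover have "j s = j (a \<oplus> b)" using kt(3) ab jh(2) by simp
    then have "s = a \<oplus> b" using inj_onD[OF j(2) _ sc] ab by simp
    ultimately show ?thesis using ji by (simp add: R.a_comm)
  qed
  ultimately show thesis by (rule that)
qed

text \<open>
  The module \<open>N\<close> to which strong ss-injectivity is applied is a quotient of \<open>R \<times> R\<close>; this is why the type \<^typ>\<open>'n\<close> needs
  room for pairs of ring elements. In \<open>N\<close> the class of \<open>(x, f x)\<close> is zero, so \<open>\<phi> (x, 0) = - c (f x)\<close> for
  \<open>x \<in> I\<close>, and a left inverse \<open>d\<close> of \<open>c\<close> turns this into \<open>f x = - d \<phi> (x, 0)\<close>.
\<close>

theorem strongly_ss_injective_right_baer:
  fixes R :: "('a, 'r) ring_scheme" (structure) and e :: "'a \<times> 'a \<Rightarrow> 'n"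
  assumes R: "ring R" and ssi: "strongly_right_ss_injective TYPE('n) R"
    and noeth: "right_noetherian R"
    and ess: "essential_submodule R (right_regular R) (socle R (right_regular R))"
    and e: "inj e"
  shows "right_baer R"
proof -
  interpret rr: right_module R "right_regular R" by (rule right_module_right_regular[OF R])
  let ?S = "socle R (right_regular R)"
  let ?Z = "right_singular R"
  have nil: "nilpotent R ?Z" by (rule rr.R.right_singular_nilpotent[OF noeth])
  have Zc: "?Z \<subseteq> carrier R" by (auto simp: right_singular_def)
  have Sess: "?S \<inter> L \<noteq> {\<zero>}" if "right_ideal R L" "L \<noteq> {\<zero>}" for L
    using ess that by (simp add: essential_submodule_def submodule_right_regular[OF R])
  have S: "right_ideal R ?S" using rr.submodule_socle by (simp add: submodule_right_regular[OF R])
  let ?P = "prod_module (right_regular R) (right_regular R)"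
  interpret P: right_module R ?P by (rule right_module_prod[OF rr.right_module_axioms rr.right_module_axioms])
  show ?thesis unfolding right_baer_def
  proof (intro allI impI, elim conjE)
    fix I f assume I: "right_ideal R I" and f: "f \<in> I \<rightarrow> carrier R"
      "\<forall>x\<in>I. \<forall>y\<in>I. f (x \<oplus> y) = f x \<oplus> f y"
      "\<forall>x\<in>I. \<forall>r\<in>carrier R. f (x \<otimes> r) = f x \<otimes> r"
    note i = right_idealD[OF I]
    have f0: "f \<zero> = \<zero>"
    proof -
      have "f (\<zero> \<otimes> \<zero>) = f \<zero> \<otimes> \<zero>" using f(3) i(2) by blast
      moreover have "f \<zero> \<in> carrier R" using f(1) i(2) by blast
      ultimately show ?thesis by simp
    qed
    let ?D0 = "(\<lambda>x. (x, f x)) ` I"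
    let ?A = "{(\<zero>, y) | y. y \<noteq> \<zero>}"
    have D0: "submodule ?D0 R ?P"
    proof (rule P.submoduleI)
      show "\<zero>\<^bsub>?P\<^esub> \<in> ?D0" using i(2) f0 by force
    qed (use i f in auto)
    have "?D0 \<inter> ?A = {}" using f0 by auto
    then obtain D where D: "submodule D R ?P" "?D0 \<subseteq> D" "D \<inter> ?A = {}"
      "\<And>E. submodule E R ?P \<Longrightarrow> D \<subseteq> E \<Longrightarrow> E \<inter> ?A = {} \<Longrightarrow> E = D"
      by (rule P.maximal_submodule_avoiding[OF D0]) blast
    obtain N :: "('a, 'n) module" and q where N: "right_module R N" and q: "q \<in> rmod_hom R ?P N"
      "q ` carrier ?P = carrier N" "\<And>x. x \<in> carrier ?P \<Longrightarrow> q x = \<zero>\<^bsub>N\<^esub> \<longleftrightarrow> x \<in> D"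
      by (rule P.quotient_module[OF D(1), of e]) (use e in \<open>auto intro: inj_on_subset\<close>)
    interpret N: right_module R N by fact
    define j where "j r = q (\<zero>, r)" for r
    have j: "j \<in> rmod_hom R (right_regular R) N"
      unfolding j_def
    proof (rule rmod_hom_compose[OF _ q(1)])
      show "(\<lambda>r. (\<zero>, r)) \<in> rmod_hom R (right_regular R) ?P" by (rule rmod_homI) auto
    qed
    note jh = rmod_homD[OF j, simplified]
    have j0: "r = \<zero>" if "r \<in> carrier R" "j r = \<zero>\<^bsub>N\<^esub>" for r
      using q(3)[of "(\<zero>, r)"] that D(3) by (auto simp: j_def)
    have jinj: "inj_on j (carrier R)"
    proof (rule inj_onI)
      fix x y assume xy: "x \<in> carrier R" "y \<in> carrier R" "j x = j y"
      have "x \<oplus> y \<otimes> \<ominus> \<one> = \<zero>"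
      proof (rule j0)
        have "j (x \<oplus> y \<otimes> \<ominus> \<one>) = j x \<oplus>\<^bsub>N\<^esub> (\<ominus> \<one>) \<odot>\<^bsub>N\<^esub> j y"
          using xy jh(2) jh(3)[of "\<ominus> \<one>" y] by simp
        then show "j (x \<oplus> y \<otimes> \<ominus> \<one>) = \<zero>\<^bsub>N\<^esub>"
          using xy jh(1) by (simp add: N.smult_minus_one N.M.r_neg)
      qed (use xy in simp)
      then have "x \<ominus> y = \<zero>" using xy by (simp add: rr.R.r_minus a_minus_def)
      then show "x = y" using xy by simp
    qed
    have essN: "V \<inter> j ` carrier R \<noteq> {\<zero>\<^bsub>N\<^esub>}" if V: "submodule V R N" "V \<noteq> {\<zero>\<^bsub>N\<^esub>}" for V
    proof
      assume triv: "V \<inter> j ` carrier R = {\<zero>\<^bsub>N\<^esub>}"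
      let ?E = "{x \<in> carrier ?P. q x \<in> V}"
      have E: "submodule ?E R ?P" by (rule P.submodule_preimage[OF N q(1) V(1)])
      have "D \<subseteq> ?E"
      proof
        fix p assume p: "p \<in> D"
        then have pc: "p \<in> carrier ?P" by (rule P.submoduleD(5)[OF D(1)])
        then have "q p = \<zero>\<^bsub>N\<^esub>" using q(3) p by blast
        then show "p \<in> ?E" using pc N.submoduleD(2)[OF V(1)] by simp
      qed
      moreover have "?E \<inter> ?A = {}"
      proof (rule ccontr)
        assume "?E \<inter> ?A \<noteq> {}"
        then obtain y where y: "y \<in> carrier R" "j y \<in> V" "y \<noteq> \<zero>" by (auto simp: j_def)
        then have "j y = \<zero>\<^bsub>N\<^esub>" using triv by blast
        then show False using j0 y by blast
      qed
      ultimately have "?E = D" using D(4)[OF E] by blast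
      have "V \<subseteq> {\<zero>\<^bsub>N\<^esub>}"
      proof
        fix v assume v: "v \<in> V"
        then have "v \<in> q ` carrier ?P" using q(2) N.submoduleD(5)[OF V(1)] by simp
        then obtain x where x: "x \<in> carrier ?P" "v = q x" by blast
        then have "x \<in> D" using v \<open>?E = D\<close> by blast
        then show "v \<in> {\<zero>\<^bsub>N\<^esub>}" using q(3)[OF x(1)] x(2) by simp
      qed
      then show False using V N.submoduleD(2)[OF V(1)] by blast
    qed
    have ext: "homs_extend R N K (right_regular R)"
      if "semisimple_module R (N\<lparr>carrier := K\<rparr>)" "small_submodule R N K" for K
      using ssi N that unfolding strongly_right_ss_injective_def by blast
    obtain \<phi> where \<phi>: "\<phi> \<in> rmod_hom R N (right_regular R)"
      "\<And>V s. simple_submodule R (right_regular R) V \<Longrightarrow> s \<in> V \<Longrightarrow> \<phi> (j s) = s"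
    proof (rule N.essential_extension_hom[OF noeth j jinj])
      show "V \<inter> j ` carrier R \<noteq> {\<zero>\<^bsub>N\<^esub>}" if "submodule V R N" "V \<noteq> {\<zero>\<^bsub>N\<^esub>}" for V
        using that by (rule essN)
      show "homs_extend R N K (right_regular R)"
        if "semisimple_module R (N\<lparr>carrier := K\<rparr>)" "small_submodule R N K" for K
        using that by (rule ext)
    qed (rule that)
    note \<phi>h = rmod_homD[OF \<phi>(1), simplified]
    define c where "c = \<phi> (j \<one>)"
    have cc: "c \<in> carrier R" unfolding c_def using \<phi>h(1) jh(1) by simp
    have \<phi>j: "\<phi> (j r) = c \<otimes> r" if r: "r \<in> carrier R" for r
      using jh(3)[OF r, of "\<one>"] \<phi>h(3)[OF r, of "j \<one>"] jh(1)[of "\<one>"] r by (simp add: c_def)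
    let ?F = "{s \<in> carrier R. (\<one> \<ominus> c) \<otimes> s \<in> {\<zero>}}"
    have F: "right_ideal R ?F" by (rule rr.R.right_ideal_colon[OF rr.R.right_ideal_zero]) (use cc in simp)
    have "?S \<subseteq> ?F"
    proof (rule rr.socle_least)
      show "submodule ?F R (right_regular R)" using F by (simp add: submodule_right_regular[OF R])
      fix V assume V: "simple_submodule R (right_regular R) V"
      show "V \<subseteq> ?F"
      proof
        fix s assume s: "s \<in> V"
        have sc: "s \<in> carrier R" using rr.submoduleD(5)[OF rr.simple_submoduleD(1)[OF V] s] by simp
        have "c \<otimes> s = s" using \<phi>(2)[OF V s] \<phi>j[OF sc] by simp
        then have "(\<one> \<ominus> c) \<otimes> s = \<zero>"
          using sc cc by (simp add: a_minus_def rr.R.l_distr rr.R.l_minus rr.R.r_neg)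
        then show "s \<in> ?F" using sc by simp
      qed
    qed
    then have "\<one> \<ominus> c \<in> ?Z"
      unfolding right_singular_def
    proof (intro CollectI conjI ballI impI)
      fix x assume x: "x \<in> carrier R" "x \<noteq> \<zero>"
      let ?X = "(\<lambda>r. x \<otimes> r) ` carrier R"
      have X: "right_ideal R ?X" by (rule rr.R.right_ideal_principal[OF x(1)])
      have "?X \<noteq> {\<zero>}" using rr.R.principal_self[OF x(1)] x(2) by blast
      then have "?S \<inter> ?X \<noteq> {\<zero>}" by (rule Sess[OF X])
      moreover have "\<zero> \<in> ?S \<inter> ?X" using right_idealD(2)[OF S] right_idealD(2)[OF X] by blast
      ultimately obtain y where "y \<in> ?S" "y \<in> ?X" "y \<noteq> \<zero>" by blast
      then show "\<exists>r\<in>carrier R. x \<otimes> r \<noteq> \<zero> \<and> (\<one> \<ominus> c) \<otimes> (x \<otimes> r) = \<zero>"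
        using \<open>?S \<subseteq> ?F\<close> by blast
    qed (use cc in simp)
    then obtain d where d: "d \<in> carrier R" "d \<otimes> (\<one> \<ominus> (\<one> \<ominus> c)) = \<one>"
      by (rule rr.R.nilpotent_left_inverse[OF nil _ Zc])
    have "\<one> \<ominus> (\<one> \<ominus> c) = c"
      using cc by (simp add: a_minus_def rr.R.minus_add rr.R.r_neg2 rr.R.r_neg1)
    then have dc: "d \<otimes> c = \<one>" using d(2) by simp
    define i0 where "i0 = q (\<one>, \<zero>)"
    have i0c: "i0 \<in> carrier N" unfolding i0_def by (rule rmod_homD(1)[OF q(1)]) simp
    define b where "b = \<ominus> (d \<otimes> \<phi> i0)"
    have bc: "b \<in> carrier R" unfolding b_def using d(1) \<phi>h(1)[OF i0c] by simp
    have "f x = b \<otimes> x" if x: "x \<in> I" for x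
    proof -
      have xc: "x \<in> carrier R" "f x \<in> carrier R" using x i(5) f(1) by auto
      have "q (x, f x) = \<zero>\<^bsub>N\<^esub>" using q(3)[of "(x, f x)"] D(2) x xc by auto
      moreover have "q (x, f x) = q (x, \<zero>) \<oplus>\<^bsub>N\<^esub> j (f x)"
        using rmod_homD(2)[OF q(1), of "(x, \<zero>)" "(\<zero>, f x)"] xc by (simp add: j_def)
      moreover have "q (x, \<zero>) = x \<odot>\<^bsub>N\<^esub> i0"
        using rmod_homD(3)[OF q(1), of x "(\<one>, \<zero>)"] xc by (simp add: i0_def)
      ultimately have "\<phi> (x \<odot>\<^bsub>N\<^esub> i0 \<oplus>\<^bsub>N\<^esub> j (f x)) = \<phi> \<zero>\<^bsub>N\<^esub>" by simp
      then have z: "\<phi> i0 \<otimes> x \<oplus> c \<otimes> f x = \<zero>"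
        using N.hom_zero[OF rr.right_module_axioms \<phi>(1)] \<phi>h(2)[of "x \<odot>\<^bsub>N\<^esub> i0" "j (f x)"]
          \<phi>h(3)[OF xc(1) i0c] \<phi>j[OF xc(2)] N.smult_closed[OF xc(1) i0c] jh(1)[OF xc(2)] by simp
      have pc: "\<phi> i0 \<in> carrier R" by (rule \<phi>h(1)[OF i0c])
      have "d \<otimes> (\<phi> i0 \<otimes> x \<oplus> c \<otimes> f x) = d \<otimes> \<phi> i0 \<otimes> x \<oplus> f x"
        using d(1) cc pc xc dc by (simp add: rr.R.r_distr rr.R.m_assoc[symmetric])
      then have "d \<otimes> \<phi> i0 \<otimes> x \<oplus> f x = \<zero>" using z d(1) by simp
      then have "f x = \<ominus> (d \<otimes> \<phi> i0 \<otimes> x)"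
        using rr.R.minus_equality[of "f x" "d \<otimes> \<phi> i0 \<otimes> x"] d(1) pc xc by (simp add: rr.R.a_comm)
      then show ?thesis unfolding b_def using d(1) pc xc by (simp add: rr.R.l_minus)
    qed
    then show "\<exists>c\<in>carrier R. \<forall>x\<in>I. f x = c \<otimes> x" using bc by blast
  qed
qed

section \<open>The characterization\<close>

theorem theorem5p10:
  fixes R :: "('a, 'r) ring_scheme"
  assumes "ring R"
  shows "quasi_frobenius TYPE(('a, 'u) module_universe) R \<longleftrightarrow>
           strongly_right_ss_injective TYPE(('a, 'u) module_universe) R \<and>
           right_noetherian R \<and>
           essential_submodule R (right_regular R) (socle R (right_regular R))"
    (is "?qf \<longleftrightarrow> ?ssi \<and> ?noeth \<and> ?ess")
proof -
  interpret R: ring R by fact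
  interpret op: ring "opposite_ring R" by (rule R.opposite)
  \<comment> \<open>Copies of \<open>R\<close> and of \<open>R \<times> R\<close> in the universe, for Baer\'s criterion and for the quotient of \<open>R \<times> R\<close>.\<close>
  define e1 :: "'a \<Rightarrow> ('a, 'u) module_universe" where "e1 a = Inl {(a, 0)}" for a
  define e2 :: "'a \<times> 'a \<Rightarrow> ('a, 'u) module_universe" where "e2 p = Inl {(fst p, 0), (snd p, 1)}" for p
  have e1: "inj e1" by (rule injI) (simp add: e1_def)
  have e2: "inj e2" by (rule injI) (auto simp: e2_def prod_eq_iff doubleton_eq_iff)
  show ?thesis
  proof
    assume qf: ?qf
    have baer: "right_baer R" if "right_self_injective TYPE(('a, 'u) module_universe) R"
      by (rule injective_imp_right_baer[OF assms that]) (use e1 in \<open>rule inj_on_subset\<close>, simp)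
    have obaer: "right_baer (opposite_ring R)" if "left_self_injective TYPE(('a, 'u) module_universe) R"
      by (rule injective_imp_right_baer[OF op.ring_axioms that[unfolded left_self_injective_def]])
        (use e1 in \<open>rule inj_on_subset\<close>, simp)
    have "right_baer R \<and> left_artinian R"
    proof -
      consider "right_baer R" "left_artinian R" | "right_baer R" "right_artinian R"
        | "right_baer (opposite_ring R)" "right_artinian R" | "right_baer (opposite_ring R)" "left_artinian R"
        using qf baer obaer unfolding quasi_frobenius_def by blast
      then show ?thesis
      proof cases
        case 1
        then show ?thesis by blast
      next
        case 2
        then show ?thesis using R.right_baer_right_artinian by blast
      next
        case 3
        then have "left_artinian (opposite_ring R)" by (simp add: left_artinian_def)
        then show ?thesis using op.right_baer_left_artinian(2,3)[OF 3(1)] by (simp add: left_artinian_def)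
      next
        case 4
        then have "left_artinian (opposite_ring R)"
          using op.right_baer_right_artinian by (simp add: left_artinian_def)
        then show ?thesis using op.right_baer_left_artinian(3)[OF 4(1)] 4(2) by simp
      qed
    qed
    then have b: "right_baer R" and la: "left_artinian R" by auto
    note c = R.right_baer_left_artinian[OF b la]
    have "right_self_injective TYPE(('a, 'u) module_universe) R" by (rule right_baer_imp_injective[OF assms b])
    then have ?ssi
      unfolding strongly_right_ss_injective_def right_self_injective_def injective_module_def
        small_submodule_def by blast
    moreover have ?ess by (rule R.essential_socle[OF c(5) R.two_sided_right_singular c(4)])
    ultimately show "?ssi \<and> ?noeth \<and> ?ess" using c(1) by blast
  next
    assume h: "?ssi \<and> ?noeth \<and> ?ess"
    have b: "right_baer R" by (rule strongly_ss_injective_right_baer[OF assms _ _ _ e2]) (use h in auto)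
    have reg: "regular_mod R (right_singular R)"
      using R.right_baer_regular[OF b] by (simp add: regular_mod_def)
    have Z: "two_sided R (right_singular R)" by (rule R.two_sided_right_singular)
    have n: ?noeth using h by blast
    have "right_artinian R"
      by (rule R.noetherian_imp_artinian[OF R.noetherian_right_semisimple_mod[OF reg Z n] Z
            R.right_singular_nilpotent[OF n] n])
    moreover have "right_self_injective TYPE(('a, 'u) module_universe) R"
      by (rule right_baer_imp_injective[OF assms b])
    ultimately show ?qf by (simp add: quasi_frobenius_def)
  qed
qed

end
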